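(* Let $1\le m_i<k_i$ for $i=0,\dots,n$, let $\omega\in\mathbb R$, $\alpha,\beta\ge 0$, and set $c_j=\alpha\lambda_j^h+\beta$, $j=1,\dots,N$; assume $(\lambda_j^h-\omega^2)^2+\omega^2c_j^2\neq 0$ for all $j$. Let $\mathbf U\in V^h$ satisfy $$a(\mathbf U,\mathbf v)+\iota\omega(\mathcal D\mathbf U,\mathbf v)-\omega^2(\mathbf U,\mathbf v)=b(\mathbf v)\quad\forall \mathbf v\in V^h,$$ and let $\mathbf U^{\mathbf m}\in V^{h,\mathbf m}$ satisfy $$a(\mathbf U^{\mathbf m},\mathbf v)+\iota\omega(\mathcal D\mathbf U^{\mathbf m},\mathbf v)-\omega^2(\mathbf U^{\mathbf m},\mathbf v)=b(\mathbf v)\quad\forall \mathbf v\in V^{h,\mathbf m}.$$ Then the discrete error $\mathbf E=\mathbf U-\mathbf U^{\mathbf m}$ satisfies, in the energy norm $|||\mathbf v|||=\sqrt{a(\mathbf v,\mathbf v)}$, $$|||\mathbf E|||\le \sqrt{I_1}+S(\omega)\sqrt{2I_2},$$ where $$I_1=\sum_{i=0}^n\frac{1}{\Lambda_{i,m_i+1}}\|\mathbf R_i^h(\mathbf U^{\mathbf m})\|^2,\qquad I_2=\sum_{i=0}^n\frac{1}{\Lambda_{i,m_i+1}^2}\|\mathbf R_i^h(\mathbf U^{\mathbf m})\|^2,$$ and $$S(\omega)=\sup_{1\le j\le N}\frac{\sqrt{(\omega^4+\omega^2c_j^2)\lambda_j^h}}{\sqrt{(\lambda_j^h-\omega^2)^2+\omega^2c_j^2}}.$$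 Moreover, $I_1$ and $I_2$ are given in matrix form by $$I_1=\sum_{i=0}^n\frac{1}{\Lambda_{i,m_i+1}}\bar{\mathbf R}_i^{*}\mathbf M_i\bar{\mathbf R}_i,\qquad I_2=\sum_{i=0}^n\frac{1}{\Lambda_{i,m_i+1}^2}\bar{\mathbf R}_i^{*}\mathbf M_i\bar{\mathbf R}_i,$$ where $\bar{\mathbf R}_i$ is the coefficient vector of $\mathbf R_i^h(\mathbf U^{\mathbf m})$ in a given real basis of $V_i^h$, $\mathbf M_i$ is the mass ($L^2$ Gram) matrix of that basis, and $*$ denotes the conjugate transpose.
   Context: Setting. $\Omega\subset\mathbb R^d$ ($d=2,3$) is a bounded domain with boundary $\partial\Omega=\Gamma_D\cup\Gamma_N$, $\Gamma_D\cap\Gamma_N=\emptyset$, and $\mathcal T$ is a subdivision of $\Omega$ into elements (e.g. triangles or tetrahedra). $V^h=\{\mathbf v\in[H^1(\Omega)]^d:\mathbf v|_{\Gamma_D}=\mathbf 0,\ \mathbf v|_T\in[\mathcal P_p(T)]^d\ \forall T\in\mathcal T\}$ is the space of continuous piecewise polynomial vector fields of order $p$; $N=\dim V^h$. $(\cdot,\cdot)$ is the $L^2(\Omega)$ inner product with norm $\|\cdot\|$. $a(\mathbf v,\mathbf w)=2(\mu\,\boldsymbol\varepsilon(\mathbf v):\boldsymbol\varepsilon(\mathbf w))+(\kappa\nabla\cdot\mathbf v,\nabla\cdot\mathbf w)$ is the (symmetric) linear elasticity form, where the first term is integrated over $\Omega$, $\boldsymbol\varepsilon$ is the strain tensor and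 $\boldsymbol\varepsilon(\mathbf v):\boldsymbol\varepsilon(\mathbf w)=\sum_{i,j}\varepsilon_{ij}(\mathbf v)\varepsilon_{ij}(\mathbf w)$; $a$ is assumed bounded and coercive on $V^h$. $b(\mathbf v)=(\mathbf f,\mathbf v)+(\mathbf g_N,\mathbf v)_{\Gamma_N}$ is a bounded load functional. $\iota$ is the imaginary unit; solutions are complex valued, so all spaces are taken over $\mathbb C$, and $a(\cdot,\cdot)$ and $(\cdot,\cdot)$ are extended as Hermitian sesquilinear forms (linear in the first, conjugate-linear in the second argument; $b$ conjugate-linear). Damping. $\mathcal D$ is Rayleigh damping: $(\mathcal D\mathbf v,\mathbf w)=\alpha\,a(\mathbf v,\mathbf w)+\beta(\mathbf v,\mathbf w)$ with $\alpha,\beta\ge0$. Global eigenvalues. $\lambda_1^h,\dots,\lambda_N^h$ are the eigenvalues of the problem: find $(\lambda^h,\mathbf Z)$ with $a(\mathbf Z,\mathbf v)=\lambda^h(\mathbf Z,\mathbf v)$ for all $\mathbf v\in V^h$. Component mode synthesis decomposition. $\Omega$ is partitioned into $n$ connected subdomains $\Omega_1,\dots,\Omega_n$, each a union of elements of $\mathcal T$, with interface $\Gamma$ between the subdomains. For $i=1,\dots,n$, $V_i^h=\{\mathbf v\in V^h:\mathbf v|_{\Omega\setminus\Omega_i}=\mathbf 0\}$, and $V_0^h=\{\mathcal E\boldsymbol\nu:\boldsymbol\nu\in V^h|_\Gamma\}$, where $V^h|_\Gamma$ is the trace space of $V^h$ on $\Gamma$ and $\mathcal E\boldsymbol\nu\in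 V^h$ is the energy minimizing extension: $a(\mathcal E\boldsymbol\nu,\mathbf v)=0$ for all $\mathbf v\in V_i^h$, $i=1,\dots,n$, and $\mathcal E\boldsymbol\nu|_\Gamma=\boldsymbol\nu$. Then $V^h=\bigoplus_{i=0}^nV_i^h$ is an $a$-orthogonal decomposition. Let $k_i=\dim V_i^h$. For each $i=0,\dots,n$, $(\Lambda_{i,j},\mathbf Z_{i,j})_{j=1}^{k_i}$ are the eigenpairs of: $a(\mathbf Z_{i,j},\mathbf v)=\Lambda_{i,j}(\mathbf Z_{i,j},\mathbf v)$ for all $\mathbf v\in V_i^h$, with $\Lambda_{i,1}\le\Lambda_{i,2}\le\cdots\le\Lambda_{i,k_i}$ and $\{\mathbf Z_{i,j}\}_j$ an $L^2$-orthonormal basis of $V_i^h$. For a multi-index $\mathbf m=(m_i)_{i=0}^n$, the reduced space is $V^{h,\mathbf m}=\bigoplus_{i=0}^nV_i^{h,m_i}$ with $V_i^{h,m_i}=\mathrm{span}\{\mathbf Z_{i,j}\}_{j=1}^{m_i}$. Subspace residuals. For $\mathbf w\in V^h$, $\mathbf R_i^h(\mathbf w)\in V_i^h$ is defined by $(\mathbf R_i^h(\mathbf w),\mathbf v)=b(\mathbf v)-a(\mathbf w,\mathbf v)-\iota\omega(\mathcal D\mathbf w,\mathbf v)+\omega^2(\mathbf w,\mathbf v)$ for all $\mathbf v\in V_i^h$. *)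

theory Defs
  imports "HOL-Analysis.Analysis" "HOL-Library.Function_Algebras"
begin

section \<open>Complex vector fields\<close>

type_synonym 'd cfield = "real ^ 'd \<Rightarrow> complex ^ 'd"

definition cscale :: "complex \<Rightarrow> 'd::finite cfield \<Rightarrow> 'd cfield" where
  "cscale c v = (\<lambda>x. c *s v x)"

global_interpretation cfield: vector_space "cscale :: complex \<Rightarrow> 'd::finite cfield \<Rightarrow> 'd cfield"
  by unfold_locales
    (simp_all add: cscale_def fun_eq_iff vec_eq_iff algebra_simps)

definition real_valued :: "'d::finite cfield \<Rightarrow> bool" where
  "real_valued v \<longleftrightarrow> (\<forall>x i. v x $ i \<in> \<real>)"


section \<open>\<open>L\<^sup>2\<close> and \<open>H\<^sup>1\<close>\<close>

definition L2 :: "(real ^ 'd::finite) set \<Rightarrow> (real ^ 'd \<Rightarrow> complex) set" where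
  "L2 \<Omega> = {u. u \<in> borel_measurable (lebesgue_on \<Omega>) \<and>
              integrable (lebesgue_on \<Omega>) (\<lambda>x. (cmod (u x))\<^sup>2)}"

definition essentially_bounded :: "(real ^ 'd::finite) set \<Rightarrow> (real ^ 'd \<Rightarrow> real) \<Rightarrow> bool" where
  "essentially_bounded \<Omega> \<mu> \<longleftrightarrow> \<mu> \<in> borel_measurable (lebesgue_on \<Omega>) \<and>
     (\<exists>C. AE x in lebesgue_on \<Omega>. \<bar>\<mu> x\<bar> \<le> C)"

definition l2_inner :: "(real ^ 'd::finite) set \<Rightarrow> 'd cfield \<Rightarrow> 'd cfield \<Rightarrow> complex" where
  "l2_inner \<Omega> v w = (LINT x|lebesgue_on \<Omega>. (\<Sum>i\<in>UNIV. v x $ i * cnj (w x $ i)))"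

definition l2_norm :: "(real ^ 'd::finite) set \<Rightarrow> 'd cfield \<Rightarrow> real" where
  "l2_norm \<Omega> v = sqrt (Re (l2_inner \<Omega> v v))"

definition partial :: "'d::finite \<Rightarrow> (real ^ 'd \<Rightarrow> real) \<Rightarrow> real ^ 'd \<Rightarrow> real" where
  "partial k \<phi> x = frechet_derivative \<phi> (at x) (axis k 1)"

text \<open>Test functions for first-order weak derivatives are the compactly supported \<open>C\<^sup>1\<close> functions
  (as in Gilbarg--Trudinger); by mollification, compactly supported smooth functions
  give the same weak derivatives.\<close>

definition test_functions :: "(real ^ 'd::finite) set \<Rightarrow> (real ^ 'd \<Rightarrow> real) set" where
  "test_functions \<Omega> = {\<phi>. \<phi> differentiable_on UNIV \<and> (\<forall>k. continuous_on UNIV (partial k \<phi>)) \<and>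
     compact (closure {x. \<phi> x \<noteq> 0}) \<and> closure {x. \<phi> x \<noteq> 0} \<subseteq> \<Omega>}"

definition is_weak_partial ::
  "(real ^ 'd::finite) set \<Rightarrow> 'd \<Rightarrow> (real ^ 'd \<Rightarrow> complex) \<Rightarrow> (real ^ 'd \<Rightarrow> complex) \<Rightarrow> bool" where
  "is_weak_partial \<Omega> k u g \<longleftrightarrow> (\<forall>\<phi>\<in>test_functions \<Omega>.
     (LINT x|lebesgue_on \<Omega>. u x * of_real (partial k \<phi> x)) =
     - (LINT x|lebesgue_on \<Omega>. g x * of_real (\<phi> x)))"

definition H1 :: "(real ^ 'd::finite) set \<Rightarrow> (real ^ 'd \<Rightarrow> complex) set" where
  "H1 \<Omega> = {u \<in> L2 \<Omega>. \<forall>k. \<exists>g\<in>L2 \<Omega>. is_weak_partial \<Omega> k u g}"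

text \<open>A weak derivative is determined up to null sets only; it is used below only under
  integrals, so the choice of the representative is immaterial.\<close>

definition weak_partial ::
  "(real ^ 'd::finite) set \<Rightarrow> 'd \<Rightarrow> (real ^ 'd \<Rightarrow> complex) \<Rightarrow> real ^ 'd \<Rightarrow> complex" where
  "weak_partial \<Omega> k u = (SOME g. g \<in> L2 \<Omega> \<and> is_weak_partial \<Omega> k u g)"

definition h1_norm :: "(real ^ 'd::finite) set \<Rightarrow> 'd cfield \<Rightarrow> real" where
  "h1_norm \<Omega> v = sqrt ((l2_norm \<Omega> v)\<^sup>2 +
     (\<Sum>i\<in>UNIV. \<Sum>k\<in>UNIV. LINT x|lebesgue_on \<Omega>. (cmod (weak_partial \<Omega> k (\<lambda>x. v x $ i) x))\<^sup>2))"


section \<open>The finite element space\<close>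

definition bounded_domain :: "(real ^ 'd::finite) set \<Rightarrow> bool" where
  "bounded_domain \<Omega> \<longleftrightarrow> open \<Omega> \<and> connected \<Omega> \<and> bounded \<Omega> \<and> \<Omega> \<noteq> {}"

text \<open>Elements are closed cells of arbitrary shape; no conformity of the mesh is required.\<close>

definition subdivision :: "(real ^ 'd::finite) set \<Rightarrow> (real ^ 'd) set set \<Rightarrow> bool" where
  "subdivision \<Omega> \<T> \<longleftrightarrow> finite \<T> \<and> \<Union>\<T> = closure \<Omega> \<and>
     (\<forall>T\<in>\<T>. compact T \<and> T \<noteq> {} \<and> closure (interior T) = T \<and> negligible (frontier T)) \<and>
     (\<forall>T\<in>\<T>. \<forall>T'\<in>\<T>. T \<noteq> T' \<longrightarrow> interior T \<inter> interior T' = {})"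

text \<open>Scalar complex polynomials of total degree at most \<open>p\<close> in the coordinates.\<close>

definition polynomial_on :: "nat \<Rightarrow> (real ^ 'd::finite) set \<Rightarrow> (real ^ 'd \<Rightarrow> complex) \<Rightarrow> bool" where
  "polynomial_on p T u \<longleftrightarrow> (\<exists>c. \<forall>x\<in>T. u x =
     (\<Sum>e | (\<Sum>i\<in>UNIV. e i) \<le> p. c (e :: 'd \<Rightarrow> nat) * of_real (\<Prod>i\<in>UNIV. (x $ i) ^ e i)))"

text \<open>The elements of the space are identified with their representatives that are continuous
  on the closed domain, extended by zero outside, so that traces are pointwise restrictions
  and equality of fields is equality of functions.\<close>

definition fe_space ::
  "(real ^ 'd::finite) set \<Rightarrow> (real ^ 'd) set \<Rightarrow> (real ^ 'd) set set \<Rightarrow> nat \<Rightarrow> 'd cfield set" where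
  "fe_space \<Omega> \<Gamma>D \<T> p = {v. continuous_on (closure \<Omega>) v \<and> (\<forall>x. x \<notin> closure \<Omega> \<longrightarrow> v x = 0) \<and>
     (\<forall>i. (\<lambda>x. v x $ i) \<in> H1 \<Omega>) \<and>
     (\<forall>x\<in>\<Gamma>D. v x = 0) \<and>
     (\<forall>T\<in>\<T>. \<forall>i. polynomial_on p T (\<lambda>x. v x $ i))}"


section \<open>Elasticity form, damping and load\<close>

definition strain ::
  "(real ^ 'd::finite) set \<Rightarrow> 'd cfield \<Rightarrow> 'd \<Rightarrow> 'd \<Rightarrow> real ^ 'd \<Rightarrow> complex" where
  "strain \<Omega> v i j x =
     (weak_partial \<Omega> j (\<lambda>x. v x $ i) x + weak_partial \<Omega> i (\<lambda>x. v x $ j) x) / 2"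

definition divergence :: "(real ^ 'd::finite) set \<Rightarrow> 'd cfield \<Rightarrow> real ^ 'd \<Rightarrow> complex" where
  "divergence \<Omega> v x = (\<Sum>i\<in>UNIV. weak_partial \<Omega> i (\<lambda>x. v x $ i) x)"

definition elasticity_form ::
  "(real ^ 'd::finite) set \<Rightarrow> (real ^ 'd \<Rightarrow> real) \<Rightarrow> (real ^ 'd \<Rightarrow> real) \<Rightarrow>
     'd cfield \<Rightarrow> 'd cfield \<Rightarrow> complex" where
  "elasticity_form \<Omega> \<mu> \<kappa> v w =
     2 * (LINT x|lebesgue_on \<Omega>. of_real (\<mu> x) *
            (\<Sum>i\<in>UNIV. \<Sum>j\<in>UNIV. strain \<Omega> v i j x * cnj (strain \<Omega> w i j x))) +
     (LINT x|lebesgue_on \<Omega>. of_real (\<kappa> x) * divergence \<Omega> v x * cnj (divergence \<Omega> w x))"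

definition bounded_form ::
  "(real ^ 'd::finite) set \<Rightarrow> 'd cfield set \<Rightarrow> ('d cfield \<Rightarrow> 'd cfield \<Rightarrow> complex) \<Rightarrow> bool" where
  "bounded_form \<Omega> V a \<longleftrightarrow>
     (\<exists>C. \<forall>v\<in>V. \<forall>w\<in>V. cmod (a v w) \<le> C * h1_norm \<Omega> v * h1_norm \<Omega> w)"

definition coercive_form ::
  "(real ^ 'd::finite) set \<Rightarrow> 'd cfield set \<Rightarrow> ('d cfield \<Rightarrow> 'd cfield \<Rightarrow> complex) \<Rightarrow> bool" where
  "coercive_form \<Omega> V a \<longleftrightarrow> (\<exists>c>0. \<forall>v\<in>V. Re (a v v) \<ge> c * (h1_norm \<Omega> v)\<^sup>2)"

definition energy_norm :: "('d::finite cfield \<Rightarrow> 'd cfield \<Rightarrow> complex) \<Rightarrow> 'd cfield \<Rightarrow> real" where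
  "energy_norm a v = sqrt (Re (a v v))"

definition damping_form ::
  "(real ^ 'd::finite) set \<Rightarrow> ('d cfield \<Rightarrow> 'd cfield \<Rightarrow> complex) \<Rightarrow> real \<Rightarrow> real \<Rightarrow>
     'd cfield \<Rightarrow> 'd cfield \<Rightarrow> complex" where
  "damping_form \<Omega> a \<alpha> \<beta> v w = of_real \<alpha> * a v w + of_real \<beta> * l2_inner \<Omega> v w"

text \<open>The \<open>s\<close>-dimensional Hausdorff measure on Borel sets, normalised so that for integer \<open>s\<close> it is
  the \<open>s\<close>-dimensional area of smooth surfaces. The set function is a metric outer measure, hence
  countably additive on Borel sets, so that it really is the value of the measure there.\<close>

definition hausdorff_content :: "nat \<Rightarrow> real \<Rightarrow> 'a::metric_space set \<Rightarrow> ennreal" where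
  "hausdorff_content s \<delta> A =
     (INF C \<in> {C :: nat \<Rightarrow> 'a set. A \<subseteq> (\<Union>n. C n) \<and> (\<forall>n. bounded (C n) \<and> diameter (C n) \<le> \<delta>)}.
        \<Sum>n. ennreal (unit_ball_vol (real s) * (diameter (C n) / 2) ^ s))"

definition hausdorff_measure :: "nat \<Rightarrow> 'a::metric_space measure" where
  "hausdorff_measure s =
     measure_of UNIV (sets borel) (\<lambda>A. SUP \<delta>\<in>{0<..}. hausdorff_content s \<delta> A)"

definition surface_measure :: "(real ^ 'd::finite) measure" where
  "surface_measure = hausdorff_measure (CARD('d) - 1)"

definition load ::
  "(real ^ 'd::finite) set \<Rightarrow> (real ^ 'd) set \<Rightarrow> 'd cfield \<Rightarrow> 'd cfield \<Rightarrow> 'd cfield \<Rightarrow> complex" where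
  "load \<Omega> \<Gamma>N f g v = l2_inner \<Omega> f v +
     (LINT x:\<Gamma>N|surface_measure. (\<Sum>i\<in>UNIV. g x $ i * cnj (v x $ i)))"

text \<open>The integrability conditions say that the load is well defined: Isabelle's integral of a
  non-integrable function is zero.\<close>

definition bounded_load ::
  "(real ^ 'd::finite) set \<Rightarrow> (real ^ 'd) set \<Rightarrow> 'd cfield \<Rightarrow> 'd cfield \<Rightarrow> 'd cfield set \<Rightarrow> bool" where
  "bounded_load \<Omega> \<Gamma>N f g V \<longleftrightarrow>
     (\<forall>v\<in>V. integrable (lebesgue_on \<Omega>) (\<lambda>x. \<Sum>i\<in>UNIV. f x $ i * cnj (v x $ i)) \<and>
       set_integrable surface_measure \<Gamma>N (\<lambda>x. \<Sum>i\<in>UNIV. g x $ i * cnj (v x $ i))) \<and>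
     (\<exists>C. \<forall>v\<in>V. cmod (load \<Omega> \<Gamma>N f g v) \<le> C * h1_norm \<Omega> v)"


section \<open>Eigenvalues\<close>

definition eigenspace ::
  "(real ^ 'd::finite) set \<Rightarrow> ('d cfield \<Rightarrow> 'd cfield \<Rightarrow> complex) \<Rightarrow> 'd cfield set \<Rightarrow> real \<Rightarrow>
     'd cfield set" where
  "eigenspace \<Omega> a V l = {Z \<in> V. \<forall>v\<in>V. a Z v = of_real l * l2_inner \<Omega> Z v}"

text \<open>\<open>lam 1, \<dots>, lam N\<close> lists the eigenvalues on \<open>V\<close> with multiplicities,
  \<open>N\<close> being the dimension of \<open>V\<close>.\<close>

definition eigenvalue_list ::
  "(real ^ 'd::finite) set \<Rightarrow> ('d cfield \<Rightarrow> 'd cfield \<Rightarrow> complex) \<Rightarrow> 'd cfield set \<Rightarrow> nat \<Rightarrow>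
     (nat \<Rightarrow> real) \<Rightarrow> bool" where
  "eigenvalue_list \<Omega> a V N lam \<longleftrightarrow> N = cfield.dim V \<and>
     (\<forall>l. card {j \<in> {1..N}. lam j = l} = cfield.dim (eigenspace \<Omega> a V l))"

definition ordered_eigenbasis ::
  "(real ^ 'd::finite) set \<Rightarrow> ('d cfield \<Rightarrow> 'd cfield \<Rightarrow> complex) \<Rightarrow> 'd cfield set \<Rightarrow>
     (nat \<Rightarrow> real) \<Rightarrow> (nat \<Rightarrow> 'd cfield) \<Rightarrow> bool" where
  "ordered_eigenbasis \<Omega> a V \<Lambda> Z \<longleftrightarrow>
     (let k = cfield.dim V in
       (\<forall>j\<in>{1..k}. Z j \<in> eigenspace \<Omega> a V (\<Lambda> j)) \<and>
       (\<forall>j\<in>{1..k}. \<forall>l\<in>{1..k}. l2_inner \<Omega> (Z j) (Z l) = (if j = l then 1 else 0)) \<and>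
       cfield.span (Z ` {1..k}) = V \<and>
       mono_on {1..k} \<Lambda>)"


section \<open>Component mode synthesis\<close>

text \<open>The open subdomain belonging to a set \<open>S\<close> of (closed) elements is \<open>\<Omega> \<inter> interior (\<Union>S)\<close>.\<close>

definition subdomain_partition ::
  "(real ^ 'd::finite) set \<Rightarrow> (real ^ 'd) set set \<Rightarrow> nat \<Rightarrow> (nat \<Rightarrow> (real ^ 'd) set) \<Rightarrow> bool" where
  "subdomain_partition \<Omega> \<T> n \<Omega>s \<longleftrightarrow> n \<ge> 1 \<and>
     (\<forall>i\<in>{1..n}. connected (\<Omega>s i) \<and> \<Omega>s i \<noteq> {} \<and> (\<exists>S\<subseteq>\<T>. \<Omega>s i = \<Omega> \<inter> interior (\<Union>S))) \<and>
     disjoint_family_on \<Omega>s {1..n} \<and>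
     (\<Union>i\<in>{1..n}. closure (\<Omega>s i)) = closure \<Omega>"

definition interface :: "nat \<Rightarrow> (nat \<Rightarrow> (real ^ 'd::finite) set) \<Rightarrow> (real ^ 'd) set" where
  "interface n \<Omega>s =
     (\<Union>i\<in>{1..n}. \<Union>j\<in>{1..n} - {i}. closure (\<Omega>s i) \<inter> closure (\<Omega>s j))"

definition local_space ::
  "(real ^ 'd::finite) set \<Rightarrow> 'd cfield set \<Rightarrow> (real ^ 'd) set \<Rightarrow> 'd cfield set" where
  "local_space \<Omega> V \<Omega>i = {v \<in> V. \<forall>x\<in>\<Omega> - \<Omega>i. v x = 0}"

text \<open>Traces on \<open>\<Gamma>\<close> are represented as functions vanishing outside \<open>\<Gamma>\<close>.\<close>

definition trace_space :: "'d::finite cfield set \<Rightarrow> (real ^ 'd) set \<Rightarrow> 'd cfield set" where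
  "trace_space V \<Gamma> = (\<lambda>v x. if x \<in> \<Gamma> then v x else 0) ` V"

definition energy_extension ::
  "(real ^ 'd::finite) set \<Rightarrow> 'd cfield set \<Rightarrow> ('d cfield \<Rightarrow> 'd cfield \<Rightarrow> complex) \<Rightarrow>
     nat \<Rightarrow> (nat \<Rightarrow> (real ^ 'd) set) \<Rightarrow> 'd cfield \<Rightarrow> 'd cfield \<Rightarrow> bool" where
  "energy_extension \<Omega> V a n \<Omega>s \<nu> w \<longleftrightarrow> w \<in> V \<and>
     (\<forall>i\<in>{1..n}. \<forall>v\<in>local_space \<Omega> V (\<Omega>s i). a w v = 0) \<and>
     (\<forall>x\<in>interface n \<Omega>s. w x = \<nu> x)"

definition interface_space ::
  "(real ^ 'd::finite) set \<Rightarrow> 'd cfield set \<Rightarrow> ('d cfield \<Rightarrow> 'd cfield \<Rightarrow> complex) \<Rightarrow>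
     nat \<Rightarrow> (nat \<Rightarrow> (real ^ 'd) set) \<Rightarrow> 'd cfield set" where
  "interface_space \<Omega> V a n \<Omega>s =
     {w. \<exists>\<nu>\<in>trace_space V (interface n \<Omega>s). energy_extension \<Omega> V a n \<Omega>s \<nu> w}"

definition component_space ::
  "(real ^ 'd::finite) set \<Rightarrow> 'd cfield set \<Rightarrow> ('d cfield \<Rightarrow> 'd cfield \<Rightarrow> complex) \<Rightarrow>
     nat \<Rightarrow> (nat \<Rightarrow> (real ^ 'd) set) \<Rightarrow> nat \<Rightarrow> 'd cfield set" where
  "component_space \<Omega> V a n \<Omega>s i =
     (if i = 0 then interface_space \<Omega> V a n \<Omega>s else local_space \<Omega> V (\<Omega>s i))"

definition reduced_space ::
  "nat \<Rightarrow> (nat \<Rightarrow> nat \<Rightarrow> 'd::finite cfield) \<Rightarrow> (nat \<Rightarrow> nat) \<Rightarrow> 'd cfield set" where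
  "reduced_space n Z m =
     {\<Sum>i\<in>{0..n}. v i | v. \<forall>i\<in>{0..n}. v i \<in> cfield.span (Z i ` {1..m i})}"

definition dynamic_form ::
  "(real ^ 'd::finite) set \<Rightarrow> ('d cfield \<Rightarrow> 'd cfield \<Rightarrow> complex) \<Rightarrow> real \<Rightarrow> real \<Rightarrow> real \<Rightarrow>
     'd cfield \<Rightarrow> 'd cfield \<Rightarrow> complex" where
  "dynamic_form \<Omega> a \<alpha> \<beta> \<omega> w v =
     a w v + \<i> * of_real \<omega> * damping_form \<Omega> a \<alpha> \<beta> w v - (of_real \<omega>)\<^sup>2 * l2_inner \<Omega> w v"

definition subspace_residual ::
  "(real ^ 'd::finite) set \<Rightarrow> ('d cfield \<Rightarrow> 'd cfield \<Rightarrow> complex) \<Rightarrow> real \<Rightarrow> real \<Rightarrow> real \<Rightarrow>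
     ('d cfield \<Rightarrow> complex) \<Rightarrow> 'd cfield set \<Rightarrow> 'd cfield \<Rightarrow> 'd cfield" where
  "subspace_residual \<Omega> a \<alpha> \<beta> \<omega> b Vi w =
     (THE r. r \<in> Vi \<and> (\<forall>v\<in>Vi. l2_inner \<Omega> r v =
        b v - a w v - \<i> * of_real \<omega> * damping_form \<Omega> a \<alpha> \<beta> w v + (of_real \<omega>)\<^sup>2 * l2_inner \<Omega> w v))"


section \<open>Matrix form\<close>

definition real_basis :: "'d::finite cfield set \<Rightarrow> nat \<Rightarrow> (nat \<Rightarrow> 'd cfield) \<Rightarrow> bool" where
  "real_basis V k \<phi> \<longleftrightarrow> (\<forall>j\<in>{1..k}. real_valued (\<phi> j)) \<and> inj_on \<phi> {1..k} \<and>
     cfield.independent (\<phi> ` {1..k}) \<and> cfield.span (\<phi> ` {1..k}) = V"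

definition mass_matrix ::
  "(real ^ 'd::finite) set \<Rightarrow> (nat \<Rightarrow> 'd cfield) \<Rightarrow> nat \<Rightarrow> nat \<Rightarrow> complex" where
  "mass_matrix \<Omega> \<phi> j l = l2_inner \<Omega> (\<phi> j) (\<phi> l)"

text \<open>The product \<open>r\<^sup>* M r\<close>, with indices running from \<open>1\<close> to \<open>k\<close>.\<close>

definition hermitian_product :: "nat \<Rightarrow> (nat \<Rightarrow> nat \<Rightarrow> complex) \<Rightarrow> (nat \<Rightarrow> complex) \<Rightarrow> complex" where
  "hermitian_product k M r = (\<Sum>j\<in>{1..k}. \<Sum>l\<in>{1..k}. cnj (r j) * M j l * r l)"

end

theory Submission
  imports Defs "HOL-Computational_Algebra.Fundamental_Theorem_Algebra"
begin

text \<open>Let \<open>E = U - U\<^sup>m\<close> and let \<open>W\<close> be the static solution with \<open>a(W, v)\<close> equal to the dynamic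
  form of \<open>(E, v)\<close> for all \<open>v\<close>. Because the component spaces are \<open>a\<close>-orthogonal and span the whole
  space, \<open>W\<close> is the sum of the solutions of the static problems on the components with data \<open>R\<^sub>i\<close>, and
  Galerkin orthogonality removes the first \<open>m\<^sub>i\<close> modes of each: this gives \<open>|||W|||\<^sup>2 \<le> I\<^sub>1\<close>.
  The components other than the interface are also \<open>L\<^sup>2\<close>-orthogonal because their supports are disjoint,
  whence \<open>\<parallel>W\<parallel>\<^sup>2 \<le> 2 I\<^sub>2\<close>, the factor two coming from the interface component. Finally \<open>E - W\<close> is
  computed from \<open>W\<close> mode by mode in a global eigenbasis, which gives \<open>|||E - W||| \<le> S(\<omega>) \<parallel>W\<parallel>\<close>.

  The elasticity form is sesquilinear, and local for disjoint supports, because weak derivatives are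
  unique up to null sets; this is the fundamental lemma of the calculus of variations, obtained here
  by testing with approximations of indicators of cubes and applying Lebesgue differentiation.\<close>

section \<open>Pairs of positive Hermitian forms\<close>

text \<open>The real part of the dynamic form need not be positive, so the error cannot be estimated
  from its residual by coercivity; the static problem confines this difficulty to one scalar per
  global mode. For a mode with eigenvalue l put c = \<alpha> l + \<beta> and D = l - \<omega>^2 + i
  \<omega> c. The coefficients satisfy l w = D e, hence D (e - w) = (l - D) w. The radicand in the
  numerator of S is |l - D|^2 l, where the factor l turns a squared mass coefficient into an energy.
  The global eigenvalues come as a list counted by dimensions of eigenspaces, without eigenvectors,
  so a simultaneous diagonalization of two positive Hermitian forms has to be built; its source is
  the fundamental theorem of algebra. Finite dimension is not read off the mesh either: the finitely
  many component eigenvectors span the whole space. The forms are axiomatized on a carrier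
  \<open>X\<close>, since the integrals behave well only for fields with weak derivatives and
  definiteness uses continuous representatives.\<close>

locale complex_vector_space = vector_space scale
  for scale :: "complex \<Rightarrow> 'b::ab_group_add \<Rightarrow> 'b"
begin

text \<open>More than \<open>card B\<close> distinct vectors inside \<open>span B\<close> are
  dependent, and the coefficients of a dependence between iterates are those of the polynomial. If
  two iterates coincide, the set of iterates is too small for this count; then a difference of two
  monomials serves.\<close>

lemma operator_annihilating_poly:
  assumes "finite B" and inW: "\<And>i. (T ^^ i) v \<in> span B"
  shows "\<exists>p. p \<noteq> 0 \<and> (\<Sum>i\<le>degree p. scale (coeff p i) ((T ^^ i) v)) = 0"
proof -
  define f where "f i = (T ^^ i) v" for i
  have trunc: "(\<Sum>i\<le>degree p. scale (coeff p i) (f i)) = (\<Sum>i\<le>n. scale (coeff p i) (f i))"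
    if "degree p \<le> n" for p n
    by (rule sum.mono_neutral_left) (use that in \<open>auto simp: coeff_eq_0\<close>)
  define n where "n = card B"
  show ?thesis
  proof (cases "inj_on f {..n}")
    case True
    have "dependent (f ` {..n})"
    proof (rule ccontr)
      assume "\<not> dependent (f ` {..n})"
      then have "card (f ` {..n}) \<le> card B"
        using independent_span_bound[OF \<open>finite B\<close>] inW by (auto simp: f_def)
      then show False using True by (simp add: card_image n_def)
    qed
    then obtain u w where u: "(\<Sum>w\<in>f ` {..n}. scale (u w) w) = 0" "w \<in> f ` {..n}" "u w \<noteq> 0"
      by (auto simp: dependent_finite)
    define p where "p = (\<Sum>i\<le>n. monom (u (f i)) i)"
    have c: "coeff p i = (if i \<le> n then u (f i) else 0)" for i
      by (simp add: p_def coeff_sum)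
    have "p \<noteq> 0" using u(2,3) c by (metis (no_types, lifting) atMost_iff coeff_0 imageE)
    moreover have "degree p \<le> n" by (rule degree_le) (simp add: c)
    moreover have "(\<Sum>i\<le>n. scale (coeff p i) (f i)) = 0"
      using u(1) True by (simp add: sum.reindex c)
    ultimately show ?thesis by (auto simp: trunc simp flip: f_def intro!: exI[of _ p])
  next
    case False
    then obtain i j where ij: "i \<noteq> j" "f i = f j" by (auto simp: inj_on_def)
    define p :: "complex poly" where "p = monom 1 i - monom 1 j"
    have "coeff p i = 1" using ij by (simp add: p_def)
    then have "p \<noteq> 0" by auto
    moreover have "degree p \<le> i + j"
      by (rule degree_le) (auto simp: p_def)
    moreover have "(\<Sum>l\<le>i+j. scale (coeff p l) (f l)) =
        (\<Sum>l\<le>i+j. (if l = i then f l else 0) - (if l = j then f l else 0))"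
      by (rule sum.cong) (auto simp: p_def scale_left_diff_distrib)
    then have "(\<Sum>l\<le>i+j. scale (coeff p l) (f l)) = 0"
      using ij by (simp add: sum_subtractf)
    ultimately show ?thesis by (auto simp: trunc simp flip: f_def intro!: exI[of _ p])
  qed
qed

text \<open>Let p be a polynomial of least degree annihilating \<open>v\<close>. Over the complex
  numbers p = (X - l) q; minimality makes q(T) v nonzero, and (T - l) q(T) v = p(T) v = 0. So q(T) v
  is an eigenvector.\<close>

lemma operator_eigenvector_exists:
  assumes fin: "finite B" and W: "subspace W" "W \<subseteq> span B"
    and TW: "\<And>w. w \<in> W \<Longrightarrow> T w \<in> W"
    and T_add: "\<And>u w. u \<in> W \<Longrightarrow> w \<in> W \<Longrightarrow> T (u + w) = T u + T w"
    and T_scale: "\<And>c w. w \<in> W \<Longrightarrow> T (scale c w) = scale c (T w)"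
    and v: "v \<in> W" "v \<noteq> 0"
  obtains z l where "z \<in> W" "z \<noteq> 0" "T z = scale l z"
proof -
  define f where "f i = (T ^^ i) v" for i
  have f_Suc: "T (f i) = f (Suc i)" for i by (simp add: f_def)
  have fW: "f i \<in> W" for i by (induction i) (use v TW in \<open>auto simp: f_def\<close>)
  have T_sum: "T (\<Sum>i\<in>A. g i) = (\<Sum>i\<in>A. T (g i))" if "finite A" "\<And>i. g i \<in> W" for A and g :: "nat \<Rightarrow> 'b"
    using that(1)
  proof (induction A rule: finite_induct)
    case empty
    show ?case using T_scale[OF v(1), of 0] by simp
  next
    case (insert x F)
    have "(\<Sum>i\<in>F. g i) \<in> W" by (rule subspace_sum[OF W(1)]) (rule that(2))
    then show ?case using insert T_add that(2) by simp
  qed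
  \<comment> \<open>\<open>act p\<close> is p(T) v. The next fact allows the sum to run beyond the
    degree, which aligns sums of different polynomials.\<close>
  define act where "act p = (\<Sum>i\<le>degree p. scale (coeff p i) (f i))" for p
  have act: "act p = (\<Sum>i\<le>n. scale (coeff p i) (f i))" if "degree p \<le> n" for p n
    unfolding act_def by (rule sum.mono_neutral_left) (use that in \<open>auto simp: coeff_eq_0\<close>)
  have "\<exists>p. p \<noteq> 0 \<and> act p = 0"
    unfolding act_def f_def
    by (rule operator_annihilating_poly[OF fin]) (use fW W(2) in \<open>auto simp: f_def\<close>)
  then obtain p where p: "p \<noteq> 0" "act p = 0"
    and p_min: "\<And>q. q \<noteq> 0 \<Longrightarrow> act q = 0 \<Longrightarrow> degree p \<le> degree q"
    using ex_has_least_nat[of "\<lambda>p. p \<noteq> 0 \<and> act p = 0" _ degree] by blast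
  have "degree p \<noteq> 0"
  proof
    assume "degree p = 0"
    then have "scale (coeff p 0) v = 0" using p(2) by (simp add: act_def f_def)
    then show False using v(2) p(1) \<open>degree p = 0\<close> by (metis leading_coeff_0_iff scale_eq_0_iff)
  qed
  then obtain l where "poly p l = 0"
    using fundamental_theorem_of_algebra constant_degree by metis
  then obtain q where q: "p = [:- l, 1:] * q" by (auto simp: poly_eq_0_iff_dvd elim: dvdE)
  have "q \<noteq> 0" using q p(1) by auto
  then have deg: "degree p = Suc (degree q)" unfolding q by (subst degree_mult_eq) auto
  then have "act q \<noteq> 0" using p_min[OF \<open>q \<noteq> 0\<close>] by auto
  define n where "n = degree q"
  have "T (act q) = (\<Sum>i\<le>n. T (scale (coeff q i) (f i)))"
    unfolding act_def n_def using fW W(1) by (intro T_sum) (auto simp: subspace_scale)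
  then have Tq: "T (act q) = (\<Sum>i\<le>n. scale (coeff q i) (f (Suc i)))"
    using fW by (simp add: T_scale f_Suc)
  \<comment> \<open>Multiplication by X - l shifts the coefficients of q up by one and subtracts l
    times them. This splits \<open>act p\<close> into \<open>T (act q)\<close> minus l times
    \<open>act q\<close>; the summand of q at \<open>Suc n\<close> is harmless, as it lies beyond
    the degree.\<close>
  have "act p = (\<Sum>i\<le>Suc n. scale (coeff p i) (f i))" by (rule act) (simp add: deg n_def)
  also have "\<dots> = scale (coeff p 0) (f 0) + (\<Sum>i\<le>n. scale (coeff p (Suc i)) (f (Suc i)))"
    by (rule sum.atMost_Suc_shift)
  also have "\<dots> = scale (- l * coeff q 0) (f 0) +
      (\<Sum>i\<le>n. scale (coeff q i) (f (Suc i)) - scale l (scale (coeff q (Suc i)) (f (Suc i))))"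
    by (simp add: q coeff_pCons scale_left_diff_distrib scale_left_distrib algebra_simps)
  also have "\<dots> = T (act q) - scale l (scale (coeff q 0) (f 0) + (\<Sum>i\<le>n. scale (coeff q (Suc i)) (f (Suc i))))"
    by (simp add: Tq sum_subtractf scale_sum_right scale_right_distrib)
  also have "scale (coeff q 0) (f 0) + (\<Sum>i\<le>n. scale (coeff q (Suc i)) (f (Suc i))) =
      (\<Sum>i\<le>Suc n. scale (coeff q i) (f i))"
    by (rule sum.atMost_Suc_shift[symmetric])
  also have "\<dots> = act q" by (rule act[symmetric]) (simp add: n_def)
  finally have "T (act q) = scale l (act q)" using p(2) by simp
  moreover have "act q \<in> W" unfolding act_def by (intro subspace_sum subspace_scale W(1) fW)
  ultimately show thesis using that \<open>act q \<noteq> 0\<close> by blast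
qed

end

section \<open>Positive Hermitian forms on a subspace\<close>

locale positive_form = complex_vector_space scale
  for scale :: "complex \<Rightarrow> 'b::ab_group_add \<Rightarrow> 'b" +
  fixes X :: "'b set" and h :: "'b \<Rightarrow> 'b \<Rightarrow> complex"
  assumes subspace_X: "subspace X"
    and add_left: "u \<in> X \<Longrightarrow> v \<in> X \<Longrightarrow> w \<in> X \<Longrightarrow> h (u + v) w = h u w + h v w"
    and scale_left: "u \<in> X \<Longrightarrow> w \<in> X \<Longrightarrow> h (scale c u) w = c * h u w"
    and hermitian: "u \<in> X \<Longrightarrow> v \<in> X \<Longrightarrow> h v u = cnj (h u v)"
    and positive: "u \<in> X \<Longrightarrow> u \<noteq> 0 \<Longrightarrow> Re (h u u) > 0"
begin

lemma span_subset_X: "E \<subseteq> X \<Longrightarrow> span E \<subseteq> X"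
  by (simp add: span_minimal subspace_X)

lemmas X_intros = subspace_0[OF subspace_X] subspace_add[OF subspace_X]
  subspace_diff[OF subspace_X] subspace_scale[OF subspace_X] subspace_sum[OF subspace_X]

lemma zero_left: "w \<in> X \<Longrightarrow> h 0 w = 0"
  using scale_left[of w w 0] by simp

lemma zero_right: "w \<in> X \<Longrightarrow> h w 0 = 0"
  using hermitian[of 0 w] zero_left by (simp add: X_intros)

lemma diff_left: "u \<in> X \<Longrightarrow> v \<in> X \<Longrightarrow> w \<in> X \<Longrightarrow> h (u - v) w = h u w - h v w"
  using add_left[of "u - v" v w] by (simp add: X_intros)

lemma sum_left:
  assumes "finite A" "\<And>i. i \<in> A \<Longrightarrow> f i \<in> X" "w \<in> X"
  shows "h (\<Sum>i\<in>A. f i) w = (\<Sum>i\<in>A. h (f i) w)"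
  using assms(1,2)
  by (induction A rule: finite_induct) (simp_all add: zero_left add_left assms(3) X_intros)

lemma add_right: "u \<in> X \<Longrightarrow> v \<in> X \<Longrightarrow> w \<in> X \<Longrightarrow> h w (u + v) = h w u + h w v"
  using hermitian[of _ w] by (simp add: X_intros add_left)

lemma diff_right: "u \<in> X \<Longrightarrow> v \<in> X \<Longrightarrow> w \<in> X \<Longrightarrow> h w (u - v) = h w u - h w v"
  using hermitian[of _ w] by (simp add: X_intros diff_left)

lemma scale_right: "u \<in> X \<Longrightarrow> w \<in> X \<Longrightarrow> h w (scale c u) = cnj c * h w u"
  using hermitian[of _ w] by (simp add: X_intros scale_left)

lemma sum_right:
  assumes "finite A" "\<And>i. i \<in> A \<Longrightarrow> f i \<in> X" "w \<in> X"
  shows "h w (\<Sum>i\<in>A. f i) = (\<Sum>i\<in>A. h w (f i))"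
  using assms(1,2)
  by (induction A rule: finite_induct) (simp_all add: zero_right add_right assms(3) X_intros)

lemma self_real: "u \<in> X \<Longrightarrow> h u u = of_real (Re (h u u))"
  using hermitian[of u u] by (simp add: complex_eq_iff)

lemma self_nonneg: "u \<in> X \<Longrightarrow> Re (h u u) \<ge> 0"
  using positive[of u] zero_left[of u] by (cases "u = 0") auto

lemma eq_zeroI: "u \<in> X \<Longrightarrow> h u u = 0 \<Longrightarrow> u = 0"
  using positive[of u] by auto

lemma normalize:
  assumes "u \<in> X" "u \<noteq> 0"
  obtains t where "t \<noteq> 0" "h (scale t u) (scale t u) = 1"
proof -
  have pos: "Re (h u u) > 0" using assms positive by auto
  define s where "s = 1 / sqrt (Re (h u u))"
  have "h (scale (of_real s) u) (scale (of_real s) u) = of_real (s * s) * of_real (Re (h u u))"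
    using assms by (subst self_real[symmetric]) (simp_all add: scale_left scale_right X_intros)
  also have "\<dots> = 1" using pos unfolding of_real_mult[symmetric] by (simp add: s_def)
  finally show thesis using that[of "of_real s"] pos by (simp add: s_def)
qed

text \<open>This is the parallelogram law with the square of the difference dropped; it is the
  source of the factor two in front of I2.\<close>

lemma add_self_le:
  assumes "u \<in> X" "v \<in> X"
  shows "Re (h (u + v) (u + v)) \<le> 2 * Re (h u u) + 2 * Re (h v v)"
  using self_nonneg[of "u - v"] assms
  by (simp add: X_intros add_left add_right diff_left diff_right)

lemma sum_orthogonal:
  assumes "finite A" "\<And>i. i \<in> A \<Longrightarrow> f i \<in> X"
    and "\<And>i j. i \<in> A \<Longrightarrow> j \<in> A \<Longrightarrow> i \<noteq> j \<Longrightarrow> h (f i) (f j) = 0"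
  shows "h (\<Sum>i\<in>A. f i) (\<Sum>i\<in>A. f i) = (\<Sum>i\<in>A. h (f i) (f i))"
proof -
  have "h (\<Sum>i\<in>A. f i) (\<Sum>i\<in>A. f i) = (\<Sum>i\<in>A. \<Sum>j\<in>A. h (f i) (f j))"
    using assms(1,2) by (simp add: sum_left sum_right X_intros) (rule sum.swap)
  also have "\<dots> = (\<Sum>i\<in>A. \<Sum>j\<in>A. if j = i then h (f i) (f i) else 0)"
    using assms(3) by (intro sum.cong) auto
  finally show ?thesis using assms(1) by simp
qed

section \<open>Finite orthonormal sets and coordinates\<close>

definition orthonormal :: "'b set \<Rightarrow> bool" where
  "orthonormal E \<longleftrightarrow> finite E \<and> E \<subseteq> X \<and> (\<forall>u\<in>E. \<forall>v\<in>E. h u v = (if u = v then 1 else 0))"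

lemma orthonormal_coeff:
  assumes E: "orthonormal E" and "e \<in> E"
  shows "h (\<Sum>e\<in>E. scale (c e) e) e = c e"
proof -
  have fin: "finite E" and EX: "E \<subseteq> X" using E by (auto simp: orthonormal_def)
  have "h (\<Sum>e\<in>E. scale (c e) e) e = (\<Sum>e'\<in>E. c e' * h e' e)"
    using EX assms(2)
    by (subst sum_left) (auto simp: fin X_intros scale_left subset_iff intro!: sum.cong)
  also have "\<dots> = (\<Sum>e'\<in>E. if e' = e then c e else 0)"
    using E assms by (intro sum.cong) (auto simp: orthonormal_def)
  finally show ?thesis using assms fin by simp
qed

lemma orthonormal_expansion:
  assumes E: "orthonormal E" and v: "v \<in> span E"
  shows "v = (\<Sum>e\<in>E. scale (h v e) e)"
proof -
  have "finite E" using E by (simp add: orthonormal_def)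
  then obtain c where "v = (\<Sum>e\<in>E. scale (c e) e)" using v span_finite by auto
  then show ?thesis using orthonormal_coeff[OF E] by simp
qed

lemma inner_expansion:
  assumes E: "orthonormal E" and v: "v \<in> span E" and w: "w \<in> X"
  shows "h v w = (\<Sum>e\<in>E. h v e * h e w)"
proof -
  have fin: "finite E" and EX: "E \<subseteq> X" using E by (auto simp: orthonormal_def)
  have "h v w = h (\<Sum>e\<in>E. scale (h v e) e) w" using orthonormal_expansion[OF E v] by simp
  also have "\<dots> = (\<Sum>e\<in>E. h (scale (h v e) e) w)"
    by (rule sum_left) (use fin EX w in \<open>auto simp: X_intros\<close>)
  finally show ?thesis using EX w by (auto simp: scale_left intro!: sum.cong)
qed

lemma parseval:
  assumes E: "orthonormal E" and v: "v \<in> span E"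
  shows "Re (h v v) = (\<Sum>e\<in>E. (cmod (h v e))\<^sup>2)"
proof -
  have EX: "E \<subseteq> X" using E by (auto simp: orthonormal_def)
  then have vX: "v \<in> X" using v span_subset_X by auto
  have "h v v = (\<Sum>e\<in>E. of_real ((cmod (h v e))\<^sup>2))"
    unfolding inner_expansion[OF E v vX]
  proof (rule sum.cong[OF refl])
    fix e assume "e \<in> E"
    then have "h e v = cnj (h v e)" using EX vX hermitian by auto
    then show "h v e * h e v = of_real ((cmod (h v e))\<^sup>2)" by (simp only: complex_norm_square)
  qed
  then show ?thesis by simp
qed

text \<open>Gram-Schmidt, one vector at a time. A vector whose remainder \<open>w\<close> vanishes
  already lies in the span and leaves \<open>E\<close> as it is, so dependent generators are handled
  too.\<close>

lemma orthonormal_basis_exists: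
  assumes "finite B" "B \<subseteq> X"
  obtains E where "orthonormal E" "span E = span B"
proof -
  have "\<exists>E. orthonormal E \<and> span E = span B" using assms
  proof (induction B rule: finite_induct)
    case empty
    then show ?case by (intro exI[of _ "{}"]) (simp add: orthonormal_def)
  next
    case (insert b B)
    then obtain E where E: "orthonormal E" and sp: "span E = span B" by auto
    have fin: "finite E" and EX: "E \<subseteq> X" using E by (auto simp: orthonormal_def)
    have bX: "b \<in> X" using insert by auto
    define y where "y = (\<Sum>e\<in>E. scale (h b e) e)"
    define w where "w = b - y"
    have y: "y \<in> span E" unfolding y_def by (intro span_sum span_scale span_base)
    then have yX: "y \<in> X" using EX span_subset_X by auto
    have wX: "w \<in> X" by (simp add: w_def X_intros bX yX)
    have we: "h w e = 0" if "e \<in> E" for e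
      unfolding w_def using EX that bX yX orthonormal_coeff[OF E that, of "h b"]
      by (subst diff_left) (auto simp: y_def)
    have bw: "b = w + y" by (simp add: w_def)
    show ?case
    proof (cases "w = 0")
      case True
      then have "b \<in> span E" using y by (simp add: w_def)
      then have "span (insert b B) = span E"
        using sp by (metis span_redundant span_insert)
      then show ?thesis using E by blast
    next
      case False
      obtain t where t0: "t \<noteq> 0" and tt: "h (scale t w) (scale t w) = 1"
        using normalize[OF wX False] by metis
      define z where "z = scale t w"
      have zX: "z \<in> X" by (simp add: z_def X_intros wX)
      have zz: "h z z = 1" using tt by (simp add: z_def)
      have ze: "h z e = 0" if "e \<in> E" for e
        using that we wX EX by (auto simp: z_def scale_left)
      have ez: "h e z = 0" if "e \<in> E" for e
        using ze[OF that] hermitian[of z e] zX EX that by auto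
      have "orthonormal (insert z E)"
        using E zX zz ze ez by (auto simp: orthonormal_def)
      moreover have "span (insert z E) = span (insert b B)"
      proof (rule span_eq[THEN iffD2], intro conjI)
        have "w \<in> span (insert b B)"
          unfolding w_def using y sp
          by (intro span_diff) (auto intro: span_base span_mono[THEN subsetD, OF subset_insertI])
        then show "insert z E \<subseteq> span (insert b B)"
          using sp unfolding z_def
          by (auto intro: span_scale span_mono[THEN subsetD, OF subset_insertI] span_base)
        have "w = scale (inverse t) z" using t0 by (simp add: z_def)
        then have "w \<in> span (insert z E)" by (simp add: span_scale span_base)
        then have "b \<in> span (insert z E)" unfolding bw
          using y by (intro span_add) (auto intro: span_mono[THEN subsetD, OF subset_insertI])
        moreover have "B \<subseteq> span (insert z E)"
          using sp by (metis span_superset span_mono subset_insertI subset_trans)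
        ultimately show "insert b B \<subseteq> span (insert z E)" by auto
      qed
      ultimately show ?thesis by blast
    qed
  qed
  then show thesis using that by blast
qed

end

section \<open>Simultaneous diagonalization of two forms\<close>

locale form_pair = mass: positive_form scale X m + energy: positive_form scale X a
  for scale :: "complex \<Rightarrow> 'b::ab_group_add \<Rightarrow> 'b" and X m a
begin

text \<open>The eigenvalue of \<open>e\<close> is encoded as \<open>Re (a e e)\<close>, which is
  forced by \<open>m e e = 1\<close>. Testing only against \<open>span E\<close> lets one notion
  cover both the global problem and the problems on the components.\<close>

definition eigenbasis :: "'b set \<Rightarrow> bool" where
  "eigenbasis E \<longleftrightarrow> mass.orthonormal E \<and>
     (\<forall>e\<in>E. \<forall>v\<in>mass.span E. a e v = of_real (Re (a e e)) * m e v)"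

text \<open>The form \<open>a\<close> is represented with respect to \<open>m\<close> by the
  operator \<open>T\<close> whose coordinates in an orthonormal basis are \<open>a w e\<close>; on
  the span, a(w, v) = m(T w, v). Eigenvectors of \<open>T\<close> therefore solve the generalized
  eigenvalue problem.\<close>

lemma eigenvector_exists:
  assumes "finite B" "B \<subseteq> X" "v \<in> mass.span B" "v \<noteq> 0"
  obtains z where "z \<in> mass.span B" "m z z = 1"
    "\<And>v. v \<in> mass.span B \<Longrightarrow> a z v = of_real (Re (a z z)) * m z v"
proof -
  obtain E where E: "mass.orthonormal E" and sp: "mass.span E = mass.span B"
    using mass.orthonormal_basis_exists assms by metis
  define W where "W = mass.span B"
  have WX: "W \<subseteq> X" unfolding W_def using assms mass.span_subset_X by auto
  have fin: "finite E" and EW: "E \<subseteq> W"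
    using E sp mass.span_superset by (auto simp: mass.orthonormal_def W_def)
  have EX: "E \<subseteq> X" using EW WX by auto
  define T where "T w = (\<Sum>e\<in>E. scale (a w e) e)" for w
  have TW: "T w \<in> W" for w
    unfolding T_def W_def sp[symmetric] by (intro mass.span_sum mass.span_scale mass.span_base)
  have "\<exists>z l. z \<in> W \<and> z \<noteq> 0 \<and> T z = scale l z"
  proof (rule mass.operator_eigenvector_exists[OF assms(1), of W T v])
    show "T (u + w) = T u + T w" if "u \<in> W" "w \<in> W" for u w
    proof -
      have "T (u + w) = (\<Sum>e\<in>E. scale (a u e + a w e) e)"
        unfolding T_def using that EX WX
        by (intro sum.cong refl) (simp add: energy.add_left subset_iff)
      then show ?thesis by (simp add: T_def mass.scale_left_distrib sum.distrib)
    qed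
    show "T (scale c w) = scale c (T w)" if "w \<in> W" for w c
    proof -
      have "T (scale c w) = (\<Sum>e\<in>E. scale (c * a w e) e)"
        unfolding T_def using that EX WX
        by (intro sum.cong refl) (simp add: energy.scale_left subset_iff)
      then show ?thesis by (simp add: T_def mass.scale_sum_right)
    qed
  qed (use assms TW in \<open>auto simp: W_def\<close>)
  then obtain y l where y: "y \<in> W" "y \<noteq> 0" "T y = scale l y" by blast
  have yX: "y \<in> X" using y WX by auto
  have yv: "a y v = l * m y v" if "v \<in> W" for v
  proof -
    have vX: "v \<in> X" and vE: "v \<in> mass.span E" using that WX sp by (auto simp: W_def)
    have "a y v = a y (\<Sum>e\<in>E. scale (m v e) e)"
      using mass.orthonormal_expansion[OF E vE] by simp
    also have "\<dots> = (\<Sum>e\<in>E. a y (scale (m v e) e))"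
      by (rule energy.sum_right) (use fin EX yX in \<open>auto simp: mass.X_intros\<close>)
    also have "\<dots> = (\<Sum>e\<in>E. a y e * m e v)"
      using EX yX vX mass.hermitian[OF vX]
      by (intro sum.cong) (auto simp: energy.scale_right)
    also have "\<dots> = (\<Sum>e\<in>E. m (T y) e * m e v)"
      by (intro sum.cong refl) (simp add: T_def mass.orthonormal_coeff[OF E])
    also have "\<dots> = m (T y) v"
      by (rule mass.inner_expansion[OF E _ vX, symmetric]) (use TW sp W_def in auto)
    also have "\<dots> = l * m y v" using y vX yX by (simp add: mass.scale_left)
    finally show ?thesis .
  qed
  obtain t where tt: "m (scale t y) (scale t y) = 1"
    using mass.normalize[OF yX y(2)] by metis
  define z where "z = scale t y"
  have zW: "z \<in> W" unfolding z_def W_def using y by (auto simp: W_def mass.span_scale)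
  then have zX: "z \<in> X" using WX by auto
  have zz: "m z z = 1" using tt by (simp add: z_def)
  have zv: "a z v = l * m z v" if "v \<in> W" for v
    using yv[OF that] yX that WX by (auto simp: z_def energy.scale_left mass.scale_left)
  \<comment> \<open>Testing the equation with \<open>z\<close> itself gives l = a(z, z), which is
    real because \<open>a\<close> is Hermitian.\<close>
  have l: "l = of_real (Re (a z z))"
    using zv[OF zW] zz energy.self_real[OF zX] by simp
  show thesis
  proof (rule that[of z])
    show "a z v = of_real (Re (a z z)) * m z v" if "v \<in> mass.span B" for v
      unfolding l[symmetric] using zv that by (simp add: W_def)
  qed (use zW zz in \<open>simp_all add: W_def\<close>)
qed

text \<open>An eigenvector \<open>z\<close> is split off and the induction continues on its
  mass-orthogonal complement \<open>W'\<close>. The induction runs on a bound for the number of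
  generators, because the basis \<open>B'\<close> of the complement is in general not a subset of
  \<open>B\<close>.\<close>

lemma eigenbasis_exists:
  assumes "finite B" "B \<subseteq> X"
  obtains E where "eigenbasis E" "mass.span E = mass.span B"
proof -
  have "\<exists>E. eigenbasis E \<and> mass.span E = mass.span B"
    if "finite B" "B \<subseteq> X" "card B \<le> n" for B n
    using that
  proof (induction n arbitrary: B)
    case 0
    then show ?case by (intro exI[of _ "{}"]) (simp add: eigenbasis_def mass.orthonormal_def)
  next
    case (Suc n)
    let ?W = "mass.span B"
    have WX: "?W \<subseteq> X" using Suc mass.span_subset_X by auto
    show ?case
    proof (cases "?W = {0}")
      case True
      then show ?thesis
        by (intro exI[of _ "{}"]) (simp add: eigenbasis_def mass.orthonormal_def)
    next
      case False
      then obtain v where "v \<in> ?W" "v \<noteq> 0" using mass.span_zero by blast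
      then obtain z where z: "z \<in> ?W" "m z z = 1"
        and zv: "\<And>v. v \<in> ?W \<Longrightarrow> a z v = of_real (Re (a z z)) * m z v"
        using eigenvector_exists[OF Suc.prems(1,2)] by metis
      have zX: "z \<in> X" using z WX by auto
      define W' where "W' = {w \<in> ?W. m w z = 0}"
      have subW': "mass.subspace W'"
        unfolding mass.subspace_def W'_def using WX zX
        by (auto simp: mass.zero_left mass.add_left mass.scale_left mass.span_zero
            mass.span_add mass.span_scale subset_iff)
      obtain B' where B': "B' \<subseteq> W'" "mass.independent B'" "W' \<subseteq> mass.span B'"
        using mass.basis_exists by metis
      have spB': "mass.span B' = W'"
        using B' subW' mass.span_minimal by blast
      have "z \<notin> mass.span B'" using spB' z by (auto simp: W'_def)
      then have "mass.independent (insert z B')"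
        using B' by (simp add: mass.independent_insert)
      moreover have "insert z B' \<subseteq> ?W" using B' z by (auto simp: W'_def)
      \<comment> \<open>The independent set includes \<open>z\<close> as well, so at most
        \<open>card B - 1\<close> vectors remain for \<open>B'\<close>; this drives the
        induction.\<close>
      ultimately have "finite (insert z B') \<and> card (insert z B') \<le> card B"
        by (rule mass.independent_span_bound[OF Suc.prems(1)])
      moreover have "z \<notin> B'" using \<open>z \<notin> mass.span B'\<close> mass.span_base by auto
      ultimately have finB': "finite B'" "card B' \<le> n" using Suc.prems by auto
      have "B' \<subseteq> X" using B' WX by (auto simp: W'_def)
      then obtain E where E: "eigenbasis E" "mass.span E = W'"
        using Suc.IH[OF finB'(1) _ finB'(2)] spB' by auto
      have Eort: "mass.orthonormal E" using E by (simp add: eigenbasis_def)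
      have EW': "E \<subseteq> W'" using E mass.span_superset by auto
      have ez: "m e z = 0" "e \<in> X" "e \<in> ?W" if "e \<in> E" for e using that EW' WX by (auto simp: W'_def)
      have ze: "m z e = 0" if "e \<in> E" for e
        using mass.hermitian[of e z] ez[OF that] zX by simp
      have spE: "mass.span (insert z E) = ?W"
      proof
        show "mass.span (insert z E) \<subseteq> ?W"
          using z EW' by (intro mass.span_minimal) (auto simp: W'_def)
        show "?W \<subseteq> mass.span (insert z E)"
        proof
          fix v assume v: "v \<in> ?W"
          then have vX: "v \<in> X" using WX by auto
          have "v - scale (m v z) z \<in> W'"
            using v z vX zX unfolding W'_def
            by (auto simp: mass.span_diff mass.span_scale mass.diff_left mass.scale_left mass.X_intros)
          then have "v - scale (m v z) z \<in> mass.span E" using E by simp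
          then show "v \<in> mass.span (insert z E)"
            by (auto simp: mass.span_insert)
        qed
      qed
      have "mass.orthonormal (insert z E)"
        using Eort zX z ez ze by (auto simp: mass.orthonormal_def)
      moreover have "a e v = of_real (Re (a e e)) * m e v" if e: "e \<in> E" and v: "v \<in> ?W" for e v
      proof -
        have vX: "v \<in> X" using v WX by auto
        define v' where "v' = v - scale (m v z) z"
        have v': "v' \<in> W'"
          using v z vX zX unfolding W'_def v'_def
          by (auto simp: mass.span_diff mass.span_scale mass.diff_left mass.scale_left mass.X_intros)
        have v'X: "v' \<in> X" using vX zX by (simp add: v'_def mass.X_intros)
        have vv: "v = v' + scale (m v z) z" by (simp add: v'_def)
        \<comment> \<open>The induction hypothesis gives the eigenvalue equation of \<open>e\<close>
          only against \<open>W'\<close>. In the missing direction \<open>z\<close> both sides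
          vanish: a(z, e) is a multiple of m(z, e) = 0, and \<open>a\<close> is Hermitian.\<close>
        have aez: "a e z = 0"
          using energy.hermitian[of z e] zv[of e] ez[OF e] ze[OF e] zX by simp
        have "a e v = a e v'" "m e v = m e v'"
          using ez[OF e] v'X zX aez
          by (subst vv, simp add: energy.add_right energy.scale_right mass.add_right mass.scale_right mass.X_intros)+
        then show ?thesis using E v' e by (simp add: eigenbasis_def)
      qed
      ultimately have "eigenbasis (insert z E)"
        unfolding eigenbasis_def spE using zv by auto
      then show ?thesis using spE by blast
    qed
  qed
  then show thesis using assms that by blast
qed

section \<open>Modal coefficients: energy, static solutions and the error\<close>

lemma eigenbasis_positive: "eigenbasis E \<Longrightarrow> e \<in> E \<Longrightarrow> Re (a e e) > 0"
  using energy.positive mass.zero_left unfolding eigenbasis_def mass.orthonormal_def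
  by (metis subsetD zero_neq_one)

text \<open>The eigenvalue is real, so conjugating the eigenvalue equation moves the eigenvector
  into the second argument without changing the factor.\<close>

lemma energy_coeff:
  assumes "eigenbasis E" "e \<in> E" "v \<in> mass.span E"
  shows "a v e = of_real (Re (a e e)) * m v e"
proof -
  have "E \<subseteq> X" using assms by (auto simp: eigenbasis_def mass.orthonormal_def)
  then have X: "e \<in> X" "v \<in> X" using assms mass.span_subset_X by auto
  have "a e v = of_real (Re (a e e)) * m e v" using assms by (simp add: eigenbasis_def)
  then show ?thesis using energy.hermitian[OF X] mass.hermitian[OF X] by simp
qed

lemma energy_parseval:
  assumes E: "eigenbasis E" and v: "v \<in> mass.span E"
  shows "Re (a v v) = (\<Sum>e\<in>E. Re (a e e) * (cmod (m v e))\<^sup>2)"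
proof -
  have Eo: "mass.orthonormal E" and fin: "finite E" and EX: "E \<subseteq> X"
    using E by (auto simp: eigenbasis_def mass.orthonormal_def)
  have vX: "v \<in> X" using v EX mass.span_subset_X by auto
  have "a v v = a (\<Sum>e\<in>E. scale (m v e) e) v"
    using mass.orthonormal_expansion[OF Eo v] by simp
  also have "\<dots> = (\<Sum>e\<in>E. m v e * a e v)"
    using fin EX vX by (subst energy.sum_left) (auto simp: mass.X_intros energy.scale_left intro!: sum.cong)
  also have "\<dots> = (\<Sum>e\<in>E. of_real (Re (a e e) * (cmod (m v e))\<^sup>2))"
  proof (rule sum.cong[OF refl])
    fix e assume e: "e \<in> E"
    have "m e v = cnj (m v e)" using e EX vX mass.hermitian by auto
    then show "m v e * a e v = of_real (Re (a e e) * (cmod (m v e))\<^sup>2)"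
      using E e v by (simp add: eigenbasis_def complex_norm_square[symmetric] mult.left_commute)
  qed
  finally show ?thesis by simp
qed

text \<open>The solution divides each coefficient of \<open>R\<close> by its eigenvalue. Modes on
  which \<open>R\<close> has no component contribute nothing, so only the others must have
  eigenvalue at least \<open>L\<close>: one division appears in the energy, two in the squared mass
  norm. \<open>L\<close> will be the first discarded eigenvalue of a component.\<close>

lemma local_static_solution:
  assumes E: "eigenbasis E" and R: "R \<in> mass.span E" and L: "L > 0"
    and gap: "\<And>e. e \<in> E \<Longrightarrow> m R e \<noteq> 0 \<Longrightarrow> L \<le> Re (a e e)"
  obtains w where "w \<in> mass.span E" "\<And>v. v \<in> mass.span E \<Longrightarrow> a w v = m R v"
    "Re (a w w) \<le> 1 / L * Re (m R R)" "Re (m w w) \<le> 1 / L\<^sup>2 * Re (m R R)"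
proof -
  have Eo: "mass.orthonormal E" and fin: "finite E" and EX: "E \<subseteq> X"
    using E by (auto simp: eigenbasis_def mass.orthonormal_def)
  define w where "w = (\<Sum>e\<in>E. scale (m R e / of_real (Re (a e e))) e)"
  have w: "w \<in> mass.span E"
    unfolding w_def by (intro mass.span_sum mass.span_scale mass.span_base)
  have wX: "w \<in> X" and RX: "R \<in> X" using w R EX mass.span_subset_X by auto
  have we: "m w e = m R e / of_real (Re (a e e))" if "e \<in> E" for e
    unfolding w_def by (rule mass.orthonormal_coeff[OF Eo that])
  have awe: "a w e = m R e" if "e \<in> E" for e
    using energy_coeff[OF E that w] we[OF that] eigenbasis_positive[OF E that] by simp
  have sol: "a w v = m R v" if v: "v \<in> mass.span E" for v
  proof -
    have exp: "v = (\<Sum>e\<in>E. scale (m v e) e)" by (rule mass.orthonormal_expansion[OF Eo v])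
    have "a w (\<Sum>e\<in>E. scale (m v e) e) = m R (\<Sum>e\<in>E. scale (m v e) e)"
      using fin EX wX RX awe
      by (subst energy.sum_right) (auto simp: mass.X_intros energy.scale_right mass.sum_right mass.scale_right subset_iff intro!: sum.cong)
    then show ?thesis using exp by simp
  qed
  have "Re (a w w) = (\<Sum>e\<in>E. (cmod (m R e))\<^sup>2 / Re (a e e))"
    unfolding energy_parseval[OF E w] using eigenbasis_positive[OF E]
    by (intro sum.cong) (auto simp: we norm_divide power_divide power2_eq_square)
  also have "\<dots> \<le> (\<Sum>e\<in>E. 1 / L * (cmod (m R e))\<^sup>2)"
  proof (rule sum_mono)
    fix e assume "e \<in> E"
    then show "(cmod (m R e))\<^sup>2 / Re (a e e) \<le> 1 / L * (cmod (m R e))\<^sup>2"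
      using gap[of e] L by (cases "m R e = 0") (auto simp: divide_left_mono)
  qed
  also have "\<dots> = 1 / L * Re (m R R)"
    by (simp add: mass.parseval[OF Eo R] sum_distrib_left)
  finally have en: "Re (a w w) \<le> 1 / L * Re (m R R)" .
  have "Re (m w w) = (\<Sum>e\<in>E. (cmod (m R e))\<^sup>2 / (Re (a e e))\<^sup>2)"
    unfolding mass.parseval[OF Eo w]
    by (intro sum.cong) (auto simp: we norm_divide power_divide)
  also have "\<dots> \<le> (\<Sum>e\<in>E. 1 / L\<^sup>2 * (cmod (m R e))\<^sup>2)"
  proof (rule sum_mono)
    fix e assume "e \<in> E"
    then show "(cmod (m R e))\<^sup>2 / (Re (a e e))\<^sup>2 \<le> 1 / L\<^sup>2 * (cmod (m R e))\<^sup>2"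
      using gap[of e] L by (cases "m R e = 0") (auto intro!: divide_left_mono power_mono)
  qed
  also have "\<dots> = 1 / L\<^sup>2 * Re (m R R)"
    by (simp add: mass.parseval[OF Eo R] sum_distrib_left)
  finally have "Re (m w w) \<le> 1 / L\<^sup>2 * Re (m R R)" .
  then show thesis using that w sol en by blast
qed

text \<open>In modal coordinates the energy norm is a weighted Euclidean norm with weights the
  square roots of the eigenvalues, which reduces the claim to the triangle inequality of
  \<open>L2_set\<close>.\<close>

lemma energy_triangle:
  assumes E: "eigenbasis E" and u: "u \<in> mass.span E" and v: "v \<in> mass.span E"
  shows "sqrt (Re (a (u + v) (u + v))) \<le> sqrt (Re (a u u)) + sqrt (Re (a v v))"
proof -
  have EX: "E \<subseteq> X" using E by (auto simp: eigenbasis_def mass.orthonormal_def)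
  have uvX: "u \<in> X" "v \<in> X" using u v EX mass.span_subset_X by auto
  define q where "q w e = sqrt (Re (a e e)) * cmod (m w e)" for w e
  have q: "sqrt (Re (a w w)) = L2_set (q w) E" if "w \<in> mass.span E" for w
    using energy_parseval[OF E that] eigenbasis_positive[OF E]
    by (auto simp: L2_set_def q_def power_mult_distrib less_imp_le intro!: sum.cong)
  have "L2_set (q (u + v)) E \<le> L2_set (\<lambda>e. q u e + q v e) E"
  proof (rule L2_set_mono)
    fix e assume e: "e \<in> E"
    have "m (u + v) e = m u e + m v e" using uvX EX e by (auto simp: mass.add_left)
    then show "q (u + v) e \<le> q u e + q v e"
      using eigenbasis_positive[OF E e] norm_triangle_ineq[of "m u e" "m v e"]
      unfolding q_def distrib_left[symmetric] by (simp add: mult_left_mono)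
    show "0 \<le> q (u + v) e" using eigenbasis_positive[OF E e] by (simp add: q_def)
  qed
  also have "\<dots> \<le> L2_set (q u) E + L2_set (q v) E" by (rule L2_set_triangle_ineq)
  finally show ?thesis using q u v by (simp add: mass.span_add)
qed

text \<open>On the eigenvector with eigenvalue \<open>l\<close>, the remainder \<open>e - w\<close> has the coefficient of \<open>w\<close>
  times \<open>(\<omega>\<^sup>2 - \<i> \<omega> c) / (l - \<omega>\<^sup>2 + \<i> \<omega> c)\<close>.\<close>

lemma dynamic_error_bound:
  assumes E: "eigenbasis E" "mass.span E = X"
    and e: "e \<in> X" and w: "w \<in> X"
    and eq: "\<And>v. v \<in> X \<Longrightarrow> a w v = a e v + \<i> * of_real \<omega> * (of_real \<alpha> * a e v + of_real \<beta> * m e v)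
        - (of_real \<omega>)\<^sup>2 * m e v"
    and bound: "\<And>z. z \<in> E \<Longrightarrow>
        (Re (a z z) - \<omega>\<^sup>2)\<^sup>2 + \<omega>\<^sup>2 * (\<alpha> * Re (a z z) + \<beta>)\<^sup>2 \<noteq> 0 \<and>
        sqrt ((\<omega> ^ 4 + \<omega>\<^sup>2 * (\<alpha> * Re (a z z) + \<beta>)\<^sup>2) * Re (a z z)) /
          sqrt ((Re (a z z) - \<omega>\<^sup>2)\<^sup>2 + \<omega>\<^sup>2 * (\<alpha> * Re (a z z) + \<beta>)\<^sup>2) \<le> S"
    and S: "S \<ge> 0"
  shows "sqrt (Re (a e e)) \<le> sqrt (Re (a w w)) + S * sqrt (Re (m w w))"
proof -
  have Eo: "mass.orthonormal E" and EX: "E \<subseteq> X"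
    using E by (auto simp: eigenbasis_def mass.orthonormal_def)
  define y where "y = e - w"
  have yX: "y \<in> X" by (simp add: y_def mass.X_intros e w)
  have coeff: "Re (a z z) * (cmod (m y z))\<^sup>2 \<le> S\<^sup>2 * (cmod (m w z))\<^sup>2" if z: "z \<in> E" for z
  proof -
    define l c where "l = Re (a z z)" and "c = \<alpha> * l + \<beta>"
    \<comment> \<open>\<open>D\<close> is the dynamic stiffness of the mode and
      \<open>N = l - D\<close>; their squared moduli are exactly the radicands occurring in
      \<open>S\<close>, apart from the factor l.\<close>
    define D N where "D = Complex (l - \<omega>\<^sup>2) (\<omega> * c)" and "N = Complex (\<omega>\<^sup>2) (- \<omega> * c)"
    have zX: "z \<in> X" using z EX by auto
    have l: "l > 0" using eigenbasis_positive[OF E(1) z] by (simp add: l_def)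
    have ae: "a e z = of_real l * m e z" and aw: "a w z = of_real l * m w z"
      using energy_coeff[OF E(1) z] E(2) e w by (auto simp: l_def)
    have "of_real l * m w z = D * m e z"
      using eq[OF zX] unfolding ae aw D_def c_def
      by (simp add: complex_eq_iff algebra_simps power2_eq_square)
    then have Dy: "D * m y z = N * m w z"
      using e w zX by (simp add: y_def mass.diff_left D_def N_def complex_eq_iff algebra_simps)
    have cD: "(cmod D)\<^sup>2 = (l - \<omega>\<^sup>2)\<^sup>2 + \<omega>\<^sup>2 * c\<^sup>2"
      by (simp add: D_def cmod_power2 power_mult_distrib)
    have cN: "(cmod N)\<^sup>2 = \<omega> ^ 4 + \<omega>\<^sup>2 * c\<^sup>2"
      by (simp add: N_def cmod_power2 power_mult_distrib)
    have "(cmod D)\<^sup>2 \<noteq> 0" unfolding cD using bound[OF z] by (simp add: l_def c_def)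
    then have D0: "(cmod D)\<^sup>2 > 0" by simp
    have "sqrt ((cmod N)\<^sup>2 * l) / sqrt ((cmod D)\<^sup>2) \<le> S"
      using bound[OF z] unfolding cN cD l_def c_def by blast
    then have "(cmod N)\<^sup>2 * l / (cmod D)\<^sup>2 \<le> S\<^sup>2"
      using S unfolding real_sqrt_divide[symmetric] by (simp add: sqrt_le_D)
    moreover have "(cmod D)\<^sup>2 * (cmod (m y z))\<^sup>2 = (cmod N)\<^sup>2 * (cmod (m w z))\<^sup>2"
      using arg_cong[OF Dy, of "\<lambda>x. (cmod x)\<^sup>2"] by (simp add: norm_mult power_mult_distrib)
    then have "l * (cmod (m y z))\<^sup>2 = (cmod N)\<^sup>2 * l / (cmod D)\<^sup>2 * (cmod (m w z))\<^sup>2"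
      using D0 by (simp add: field_simps)
    ultimately show ?thesis unfolding l_def[symmetric] by (metis mult_right_mono zero_le_power2)
  qed
  have "Re (a y y) \<le> (\<Sum>z\<in>E. S\<^sup>2 * (cmod (m w z))\<^sup>2)"
    unfolding energy_parseval[OF E(1) yX[folded E(2)]] by (rule sum_mono) (rule coeff)
  also have "\<dots> = S\<^sup>2 * Re (m w w)"
    unfolding mass.parseval[OF Eo w[folded E(2)]] by (simp add: sum_distrib_left)
  finally have "sqrt (Re (a y y)) \<le> sqrt (S\<^sup>2 * Re (m w w))" by simp
  also have "\<dots> = S * sqrt (Re (m w w))" using S by (simp add: real_sqrt_mult)
  finally have "sqrt (Re (a y y)) \<le> S * sqrt (Re (m w w))" .
  moreover have "sqrt (Re (a (w + y) (w + y))) \<le> sqrt (Re (a w w)) + sqrt (Re (a y y))"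
    by (rule energy_triangle[OF E(1)]) (use w yX E(2) in auto)
  moreover have "w + y = e" by (simp add: y_def)
  ultimately show ?thesis by simp
qed

text \<open>It supplies the existence of the subspace residuals. Their data is the dynamic form of
  the error, that is, \<open>a\<close> and \<open>m\<close> with fixed first arguments, so
  conjugate-linearity in \<open>v\<close> is inherited from the forms and agreement on a basis
  suffices.\<close>

lemma riesz_representation:
  assumes E: "mass.orthonormal E" and x: "x \<in> X" and y: "y \<in> X"
  obtains r where "r \<in> mass.span E" "\<And>v. v \<in> mass.span E \<Longrightarrow> m r v = a x v + m y v"
proof -
  have fin: "finite E" and EX: "E \<subseteq> X" using E by (auto simp: mass.orthonormal_def)
  define r where "r = (\<Sum>e\<in>E. scale (a x e + m y e) e)"
  have r: "r \<in> mass.span E"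
    unfolding r_def by (intro mass.span_sum mass.span_scale mass.span_base)
  then have rX: "r \<in> X" using EX mass.span_subset_X by auto
  have "mass.span E \<subseteq> {v \<in> X. m r v = a x v + m y v}"
  proof (rule mass.span_minimal)
    show "E \<subseteq> {v \<in> X. m r v = a x v + m y v}"
      using EX mass.orthonormal_coeff[OF E] by (auto simp: r_def)
    show "mass.subspace {v \<in> X. m r v = a x v + m y v}"
      unfolding mass.subspace_def using rX x y
      by (auto simp: mass.X_intros mass.zero_right energy.zero_right mass.add_right
          energy.add_right mass.scale_right energy.scale_right algebra_simps)
  qed
  then show thesis using that[OF r] by auto
qed

text \<open>It turns the definite description in \<open>subspace_residual\<close> into an actual
  value: the difference of two representatives is tested against itself.\<close>

lemma riesz_unique:
  assumes "E \<subseteq> X" "r \<in> mass.span E" "r' \<in> mass.span E"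
    and "\<And>v. v \<in> mass.span E \<Longrightarrow> m r v = m r' v"
  shows "r = r'"
proof -
  have X: "r \<in> X" "r' \<in> X" using assms mass.span_subset_X by auto
  have "r - r' \<in> mass.span E" using assms by (simp add: mass.span_diff)
  then have "m (r - r') (r - r') = 0"
    using assms(4) X by (simp add: mass.diff_left mass.X_intros)
  then show ?thesis using mass.eq_zeroI[of "r - r'"] X by (simp add: mass.X_intros)
qed

text \<open>The energy-orthogonal projection of \<open>u\<close>, needed to strip a field of its
  interior components. Since a(w, e) is the eigenvalue times m(w, e), the coefficient of
  \<open>w\<close> has to be a(u, e) divided by the eigenvalue.\<close>

lemma energy_projection:
  assumes E: "eigenbasis E" and u: "u \<in> X"
  obtains w where "w \<in> mass.span E" "\<And>v. v \<in> mass.span E \<Longrightarrow> a w v = a u v"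
proof -
  have Eo: "mass.orthonormal E" and EX: "E \<subseteq> X"
    using E by (auto simp: eigenbasis_def mass.orthonormal_def)
  define w where "w = (\<Sum>e\<in>E. scale (a u e / of_real (Re (a e e))) e)"
  have w: "w \<in> mass.span E"
    unfolding w_def by (intro mass.span_sum mass.span_scale mass.span_base)
  then have wX: "w \<in> X" using EX mass.span_subset_X by auto
  have "a w e = a u e" if "e \<in> E" for e
    using energy_coeff[OF E that w] mass.orthonormal_coeff[OF Eo that] eigenbasis_positive[OF E that]
    by (simp add: w_def)
  then have "mass.span E \<subseteq> {v \<in> X. a w v = a u v}"
    using EX wX u
    by (intro mass.span_minimal)
      (auto simp: mass.subspace_def mass.X_intros energy.zero_right energy.add_right energy.scale_right)
  then show thesis using that[OF w] by auto
qed

text \<open>The error \<open>e\<close> is compared with the static solution \<open>w\<close> for the residual of the dynamic problem: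
  \<open>w\<close> splits along the energy-orthogonal subspaces, and \<open>e - w\<close> is controlled by the mass norm of \<open>w\<close>.\<close>

lemma component_mode_error_bound:
  fixes Eb :: "nat \<Rightarrow> 'b set"
  assumes eig: "\<And>i. i \<in> {0..n} \<Longrightarrow> eigenbasis (Eb i)"
    and energy_orth: "\<And>i j u v. i \<in> {0..n} \<Longrightarrow> j \<in> {0..n} \<Longrightarrow> i \<noteq> j \<Longrightarrow>
        u \<in> mass.span (Eb i) \<Longrightarrow> v \<in> mass.span (Eb j) \<Longrightarrow> a u v = 0"
    and mass_orth: "\<And>i j u v. i \<in> {1..n} \<Longrightarrow> j \<in> {1..n} \<Longrightarrow> i \<noteq> j \<Longrightarrow>
        u \<in> mass.span (Eb i) \<Longrightarrow> v \<in> mass.span (Eb j) \<Longrightarrow> m u v = 0"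
    and decomp: "\<And>v. v \<in> X \<Longrightarrow> \<exists>w. (\<forall>i\<in>{0..n}. w i \<in> mass.span (Eb i)) \<and> v = (\<Sum>i\<in>{0..n}. w i)"
    and E: "eigenbasis E" "mass.span E = X"
    and e: "e \<in> X"
    and R: "\<And>i. i \<in> {0..n} \<Longrightarrow> R i \<in> mass.span (Eb i)"
    and R_eq: "\<And>i v. i \<in> {0..n} \<Longrightarrow> v \<in> mass.span (Eb i) \<Longrightarrow> m (R i) v =
        a e v + \<i> * of_real \<omega> * (of_real \<alpha> * a e v + of_real \<beta> * m e v) - (of_real \<omega>)\<^sup>2 * m e v"
    and L: "\<And>i. i \<in> {0..n} \<Longrightarrow> L i > 0"
    and gap: "\<And>i z. i \<in> {0..n} \<Longrightarrow> z \<in> Eb i \<Longrightarrow> m (R i) z \<noteq> 0 \<Longrightarrow> L i \<le> Re (a z z)"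
    and bound: "\<And>z. z \<in> E \<Longrightarrow>
        (Re (a z z) - \<omega>\<^sup>2)\<^sup>2 + \<omega>\<^sup>2 * (\<alpha> * Re (a z z) + \<beta>)\<^sup>2 \<noteq> 0 \<and>
        sqrt ((\<omega> ^ 4 + \<omega>\<^sup>2 * (\<alpha> * Re (a z z) + \<beta>)\<^sup>2) * Re (a z z)) /
          sqrt ((Re (a z z) - \<omega>\<^sup>2)\<^sup>2 + \<omega>\<^sup>2 * (\<alpha> * Re (a z z) + \<beta>)\<^sup>2) \<le> S"
    and S: "S \<ge> 0"
  shows "sqrt (Re (a e e)) \<le> sqrt (\<Sum>i\<in>{0..n}. 1 / L i * Re (m (R i) (R i))) +
    S * sqrt (2 * (\<Sum>i\<in>{0..n}. 1 / (L i)\<^sup>2 * Re (m (R i) (R i))))"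
proof -
  have spX: "mass.span (Eb i) \<subseteq> X" if "i \<in> {0..n}" for i
    using eig[OF that] mass.span_subset_X by (auto simp: eigenbasis_def mass.orthonormal_def)
  have "\<exists>w. w \<in> mass.span (Eb i) \<and> (\<forall>v\<in>mass.span (Eb i). a w v = m (R i) v) \<and>
      Re (a w w) \<le> 1 / L i * Re (m (R i) (R i)) \<and> Re (m w w) \<le> 1 / (L i)\<^sup>2 * Re (m (R i) (R i))"
    if "i \<in> {0..n}" for i
    by (rule local_static_solution[OF eig[OF that] R[OF that] L[OF that] gap[OF that]]) auto
  then obtain w where w: "\<And>i. i \<in> {0..n} \<Longrightarrow> w i \<in> mass.span (Eb i)"
    and w_eq: "\<And>i v. i \<in> {0..n} \<Longrightarrow> v \<in> mass.span (Eb i) \<Longrightarrow> a (w i) v = m (R i) v"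
    and w_energy: "\<And>i. i \<in> {0..n} \<Longrightarrow> Re (a (w i) (w i)) \<le> 1 / L i * Re (m (R i) (R i))"
    and w_mass: "\<And>i. i \<in> {0..n} \<Longrightarrow> Re (m (w i) (w i)) \<le> 1 / (L i)\<^sup>2 * Re (m (R i) (R i))"
    by metis
  have wX: "w i \<in> X" if "i \<in> {0..n}" for i using w[OF that] spX[OF that] by auto
  define W where "W = (\<Sum>i\<in>{0..n}. w i)"
  have WX: "W \<in> X" unfolding W_def using wX by (auto intro: mass.X_intros)
  have "a W v = a e v + \<i> * of_real \<omega> * (of_real \<alpha> * a e v + of_real \<beta> * m e v) - (of_real \<omega>)\<^sup>2 * m e v"
    (is "_ = ?B v") if v: "v \<in> X" for v
  proof -
    obtain y where y: "\<And>i. i \<in> {0..n} \<Longrightarrow> y i \<in> mass.span (Eb i)" and vy: "v = (\<Sum>i\<in>{0..n}. y i)"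
      using decomp[OF v] by metis
    have yX: "y i \<in> X" if "i \<in> {0..n}" for i using y[OF that] spX[OF that] by auto
    have B_sum: "?B v = (\<Sum>i\<in>{0..n}. ?B (y i))"
    proof -
      have "a e v = (\<Sum>i\<in>{0..n}. a e (y i))" "m e v = (\<Sum>i\<in>{0..n}. m e (y i))"
        unfolding vy using e yX by (auto intro!: energy.sum_right mass.sum_right)
      then show ?thesis by (simp add: sum.distrib sum_subtractf sum_distrib_left distrib_left)
    qed
    \<comment> \<open>Energy orthogonality leaves only the i-th summand of \<open>W\<close>, and
      that summand solves the local problem with data \<open>R i\<close>.\<close>
    have "a W (y i) = ?B (y i)" if i: "i \<in> {0..n}" for i
    proof -
      have "a W (y i) = (\<Sum>j\<in>{0..n}. a (w j) (y i))"
        unfolding W_def by (rule energy.sum_left) (use wX yX i in auto)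
      also have "\<dots> = (\<Sum>j\<in>{0..n}. if j = i then m (R i) (y i) else 0)"
        using w y w_eq energy_orth i by (intro sum.cong) auto
      finally show ?thesis using R_eq[OF i y[OF i]] i by simp
    qed
    moreover have "a W v = (\<Sum>i\<in>{0..n}. a W (y i))"
      unfolding vy by (rule energy.sum_right) (use yX WX in auto)
    ultimately show ?thesis using B_sum by simp
  qed
  then have "sqrt (Re (a e e)) \<le> sqrt (Re (a W W)) + S * sqrt (Re (m W W))"
    by (rule dynamic_error_bound[OF E e WX _ bound S])
  moreover have "Re (a W W) \<le> (\<Sum>i\<in>{0..n}. 1 / L i * Re (m (R i) (R i)))"
  proof -
    have "a W W = (\<Sum>i\<in>{0..n}. a (w i) (w i))"
      unfolding W_def by (rule energy.sum_orthogonal) (use wX w energy_orth in auto)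
    then have "Re (a W W) = (\<Sum>i\<in>{0..n}. Re (a (w i) (w i)))" by simp
    also have "\<dots> \<le> (\<Sum>i\<in>{0..n}. 1 / L i * Re (m (R i) (R i)))"
      by (rule sum_mono) (rule w_energy)
    finally show ?thesis .
  qed
  moreover have "Re (m W W) \<le> 2 * (\<Sum>i\<in>{0..n}. 1 / (L i)\<^sup>2 * Re (m (R i) (R i)))"
  proof -
    \<comment> \<open>Only the interface part is separated by the inequality with factor two; the
      remaining parts add up exactly by orthogonality, so the constant does not grow with the number
      of subdomains.\<close>
    define W' where "W' = (\<Sum>i\<in>{1..n}. w i)"
    have W: "W = w 0 + W'" unfolding W_def W'_def by (simp add: sum.atLeast_Suc_atMost)
    have W'X: "W' \<in> X" unfolding W'_def using wX by (auto intro: mass.X_intros)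
    have "m W' W' = (\<Sum>i\<in>{1..n}. m (w i) (w i))"
      unfolding W'_def by (rule mass.sum_orthogonal) (use wX w mass_orth in auto)
    then have "Re (m W' W') = (\<Sum>i\<in>{1..n}. Re (m (w i) (w i)))" by simp
    then have "Re (m W W) \<le> 2 * (\<Sum>i\<in>{0..n}. Re (m (w i) (w i)))"
      using mass.add_self_le[of "w 0" W'] wX[of 0] W'X W by (simp add: sum.atLeast_Suc_atMost)
    also have "\<dots> \<le> 2 * (\<Sum>i\<in>{0..n}. 1 / (L i)\<^sup>2 * Re (m (R i) (R i)))"
      by (intro mult_left_mono sum_mono w_mass) auto
    finally show ?thesis .
  qed
  ultimately show ?thesis
    using S by (meson add_mono mult_left_mono order_trans real_sqrt_le_mono)
qed

end


section \<open>The fundamental lemma of the calculus of variations\<close>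

text \<open>The smoothness required of test functions without the support condition, so that it can
  be checked factor by factor for products of one-variable functions.\<close>

definition C1_function :: "(real ^ 'd::finite \<Rightarrow> real) \<Rightarrow> bool" where
  "C1_function \<phi> \<longleftrightarrow> \<phi> differentiable_on UNIV \<and> (\<forall>k. continuous_on UNIV (partial k \<phi>))"

lemma partial_eq: "(\<phi> has_derivative D) (at x) \<Longrightarrow> partial k \<phi> x = D (axis k 1)"
  unfolding partial_def by (metis frechet_derivative_at)

lemma C1_function_has_derivative:
  "C1_function \<phi> \<Longrightarrow> (\<phi> has_derivative frechet_derivative \<phi> (at x)) (at x)"
  unfolding C1_function_def by (simp add: differentiable_on_def flip: frechet_derivative_works)

lemma C1_function_continuous: "C1_function \<phi> \<Longrightarrow> continuous_on UNIV \<phi>"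
  unfolding C1_function_def by (simp add: differentiable_imp_continuous_on)

lemma C1_functionI:
  assumes "\<And>x. (\<phi> has_derivative D x) (at x)"
    and "\<And>k. continuous_on UNIV (\<lambda>x. D x (axis k 1))"
  shows "C1_function \<phi>"
proof -
  have "partial k \<phi> = (\<lambda>x. D x (axis k 1))" for k
    using partial_eq[OF assms(1)] by auto
  then show ?thesis
    using assms unfolding C1_function_def differentiable_on_def differentiable_def by auto
qed

lemma C1_function_mult:
  assumes "C1_function \<phi>" "C1_function \<psi>"
  shows "C1_function (\<lambda>x. \<phi> x * \<psi> x)"
proof (rule C1_functionI)
  show "((\<lambda>x. \<phi> x * \<psi> x) has_derivative
      (\<lambda>y. \<phi> x * frechet_derivative \<psi> (at x) y + frechet_derivative \<phi> (at x) y * \<psi> x)) (at x)" for x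
    by (intro has_derivative_mult C1_function_has_derivative assms)
  show "continuous_on UNIV (\<lambda>x. \<phi> x * frechet_derivative \<psi> (at x) (axis k 1) +
      frechet_derivative \<phi> (at x) (axis k 1) * \<psi> x)" for k
    using assms C1_function_continuous unfolding C1_function_def partial_def
    by (intro continuous_intros) auto
qed

lemma C1_function_prod:
  assumes "finite I" "\<And>i. i \<in> I \<Longrightarrow> C1_function (\<phi> i)"
  shows "C1_function (\<lambda>x. \<Prod>i\<in>I. \<phi> i x)"
  using assms
proof (induction I rule: finite_induct)
  case empty
  show ?case by (rule C1_functionI[where D = "\<lambda>_ _. 0"]) auto
next
  case (insert i I)
  then show ?case by (simp add: C1_function_mult)
qed

lemma C1_function_coordinate:
  assumes "\<And>t. (g has_real_derivative g' t) (at t)" "continuous_on UNIV g'"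
  shows "C1_function (\<lambda>x :: real ^ 'd::finite. g (x $ i))"
proof (rule C1_functionI)
  fix x :: "real ^ 'd"
  have "((\<lambda>x. x $ i) has_derivative (\<lambda>y. y $ i)) (at x)"
    by (intro bounded_linear_imp_has_derivative bounded_linear_vec_nth)
  moreover have "(g has_derivative (\<lambda>t. g' (x $ i) * t)) (at (x $ i))"
    using assms(1) by (simp add: has_field_derivative_def)
  ultimately show "((\<lambda>x. g (x $ i)) has_derivative (\<lambda>y. g' (x $ i) * y $ i)) (at x)"
    by (rule has_derivative_compose)
next
  fix k :: 'd
  have "continuous_on UNIV (\<lambda>x :: real ^ 'd. g' (x $ i))"
    by (rule continuous_on_compose2[OF assms(2)]) (auto intro: continuous_intros)
  then show "continuous_on UNIV (\<lambda>x :: real ^ 'd. g' (x $ i) * (axis k (1::real) :: real ^ 'd) $ i)"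
    by (intro continuous_intros)
qed

text \<open>A C1 step: the square removes the corner at 0, the denominator keeps the values below 1,
  and steepening the argument gives the indicator of the positive half-line in the limit.\<close>

definition ramp :: "real \<Rightarrow> real" where
  "ramp t = (max 0 t)\<^sup>2 / (1 + (max 0 t)\<^sup>2)"

lemma DERIV_max_square: "((\<lambda>t. (max 0 t)\<^sup>2) has_real_derivative 2 * max 0 t) (at t)"
proof (cases t "0 :: real" rule: linorder_cases)
  case less
  have "((\<lambda>_. 0 :: real) has_real_derivative 0) (at t)" by simp
  then have "((\<lambda>t. (max 0 t)\<^sup>2) has_real_derivative 0) (at t)"
    by (rule has_field_derivative_transform_within_open[where S = "{..<0}"]) (use less in auto)
  then show ?thesis using less by simp
next
  case greater
  have "((\<lambda>t. t\<^sup>2) has_real_derivative 2 * t) (at t)" by (auto intro!: derivative_eq_intros)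
  then have "((\<lambda>t. (max 0 t)\<^sup>2) has_real_derivative 2 * t) (at t)"
    by (rule has_field_derivative_transform_within_open[where S = "{0<..}"]) (use greater in auto)
  then show ?thesis using greater by simp
next
  case equal
  \<comment> \<open>At the corner the difference quotient has absolute value at most |y|, hence
    limit 0, the derivative claimed there.\<close>
  have "((\<lambda>y. (max 0 y)\<^sup>2 / y) \<longlongrightarrow> (0 :: real)) (at 0)"
  proof (rule Lim_null_comparison)
    show "\<forall>\<^sub>F y :: real in at 0. norm ((max 0 y)\<^sup>2 / y) \<le> \<bar>y\<bar>"
      by (rule always_eventually) (auto simp: max_def power2_eq_square)
    show "((\<lambda>y :: real. \<bar>y\<bar>) \<longlongrightarrow> 0) (at 0)"
      by (rule tendsto_eq_intros | simp)+
  qed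
  then show ?thesis using equal by (simp add: has_field_derivative_iff)
qed

lemma one_plus_square_pos: "1 + s\<^sup>2 > (0 :: real)"
  by (simp add: add_pos_nonneg)

lemma DERIV_ramp: "(ramp has_real_derivative 2 * max 0 t / (1 + (max 0 t)\<^sup>2)\<^sup>2) (at t)"
proof -
  have "1 + (max 0 t)\<^sup>2 \<noteq> 0" using one_plus_square_pos[of "max 0 t"] by linarith
  then have "((\<lambda>t. (max 0 t)\<^sup>2 / (1 + (max 0 t)\<^sup>2)) has_real_derivative
      (2 * max 0 t * (1 + (max 0 t)\<^sup>2) - (max 0 t)\<^sup>2 * (0 + 2 * max 0 t)) /
        ((1 + (max 0 t)\<^sup>2) * (1 + (max 0 t)\<^sup>2))) (at t)"
    by (intro DERIV_divide DERIV_add DERIV_const DERIV_max_square)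
  moreover have "ramp = (\<lambda>t. (max 0 t)\<^sup>2 / (1 + (max 0 t)\<^sup>2))" by (auto simp: ramp_def)
  ultimately show ?thesis by (simp add: algebra_simps power2_eq_square)
qed

lemma ramp_simps: "0 \<le> ramp t" "ramp t \<le> 1" "t \<le> 0 \<Longrightarrow> ramp t = 0" "t > 0 \<Longrightarrow> ramp t > 0"
  using one_plus_square_pos[of "max 0 t"] by (auto simp: ramp_def max_def divide_simps)

text \<open>For s > 0, s^2 / (1 + s^2) equals 1 / (1 + s^(-2)), which reduces the limit to that of
  the reciprocals of the integers.\<close>

lemma ramp_scaled_tendsto: "t > 0 \<Longrightarrow> (\<lambda>n. ramp (real (Suc n) * t)) \<longlonglongrightarrow> 1"
proof -
  assume t: "t > 0"
  have inv: "(\<lambda>n. (inverse t * inverse (real (Suc n)))\<^sup>2) \<longlonglongrightarrow> (inverse t * 0)\<^sup>2"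
    by (intro tendsto_intros LIMSEQ_inverse_real_of_nat)
  have "(\<lambda>n. 1 / ((inverse t * inverse (real (Suc n)))\<^sup>2 + 1)) \<longlonglongrightarrow> 1 / ((inverse t * 0)\<^sup>2 + 1)"
    by (intro tendsto_intros inv) simp
  moreover have "ramp (real (Suc n) * t) = 1 / ((inverse t * inverse (real (Suc n)))\<^sup>2 + 1)" for n
  proof -
    define s where "s = real (Suc n) * t"
    have s: "s > 0" using t by (simp add: s_def)
    have e: "inverse t * inverse (real (Suc n)) = inverse s"
      unfolding s_def by (simp only: inverse_mult_distrib mult.commute)
    have "ramp s = 1 / ((inverse s)\<^sup>2 + 1)"
      using s one_plus_square_pos[of s] by (simp add: ramp_def max_def field_simps)
    then show ?thesis unfolding e by (simp only: s_def)
  qed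
  ultimately show ?thesis by simp
qed

text \<open>One steepened ramp for each of the two faces in every coordinate direction. The index
  enters through \<open>Suc n\<close> so that the slope is never zero.\<close>

definition box_bump :: "real ^ 'd::finite \<Rightarrow> real ^ 'd \<Rightarrow> nat \<Rightarrow> real ^ 'd \<Rightarrow> real" where
  "box_bump a b n x = (\<Prod>i\<in>UNIV. ramp (real (Suc n) * (x $ i - a $ i))) *
     (\<Prod>i\<in>UNIV. ramp (real (Suc n) * (b $ i - x $ i)))"

lemma box_bump_C1: "C1_function (box_bump a b n)"
proof -
  define r' where "r' t = 2 * max 0 t / (1 + (max 0 t)\<^sup>2)\<^sup>2" for t :: real
  have r': "(ramp has_real_derivative r' t) (at t)" for t
    unfolding r'_def by (rule DERIV_ramp)
  have nz: "1 + (max 0 t)\<^sup>2 \<noteq> 0" for t :: real using one_plus_square_pos[of "max 0 t"] by linarith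
  have cont: "continuous_on UNIV r'"
    unfolding r'_def by (intro continuous_intros) (use nz in auto)
  have c: "C1_function (\<lambda>x. ramp (s * (x $ i) + t))" for s t and i :: 'a
  proof (rule C1_function_coordinate)
    show "((\<lambda>y. ramp (s * y + t)) has_real_derivative r' (s * y + t) * s) (at y)" for y
      by (rule DERIV_chain2[OF r']) (auto intro!: derivative_eq_intros)
    show "continuous_on UNIV (\<lambda>y. r' (s * y + t) * s)"
      by (intro continuous_intros continuous_on_compose2[OF cont]) auto
  qed
  have e: "box_bump a b n = (\<lambda>x. (\<Prod>i\<in>UNIV. ramp (real (Suc n) * x $ i + - real (Suc n) * a $ i)) *
     (\<Prod>i\<in>UNIV. ramp (- real (Suc n) * x $ i + real (Suc n) * b $ i)))"
    by (simp add: box_bump_def fun_eq_iff algebra_simps)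
  show ?thesis unfolding e by (intro C1_function_mult C1_function_prod c finite)
qed

lemma box_bump_eq_0: "x \<notin> box a b \<Longrightarrow> box_bump a b n x = 0"
proof -
  assume "x \<notin> box a b"
  then obtain i where "x $ i \<le> a $ i \<or> b $ i \<le> x $ i" by (auto simp: mem_box_cart not_less)
  then have "ramp (real (Suc n) * (x $ i - a $ i)) = 0 \<or> ramp (real (Suc n) * (b $ i - x $ i)) = 0"
    using ramp_simps(3) by (auto simp: mult_nonneg_nonpos)
  then show ?thesis unfolding box_bump_def by (auto simp: prod_zero_iff)
qed

text \<open>The bump is nonzero only in the open box, but its support may reach the faces; hence it
  is the closed box that has to lie in the domain.\<close>

lemma box_bump_test_function: "cbox a b \<subseteq> \<Omega> \<Longrightarrow> box_bump a b n \<in> test_functions \<Omega>"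
proof -
  assume sub: "cbox a b \<subseteq> \<Omega>"
  have "{x. box_bump a b n x \<noteq> 0} \<subseteq> cbox a b"
    using box_bump_eq_0 box_subset_cbox by blast
  then have "closure {x. box_bump a b n x \<noteq> 0} \<subseteq> cbox a b"
    by (rule closure_minimal) (rule closed_cbox)
  then show ?thesis
    using box_bump_C1[of a b n] sub
    unfolding test_functions_def C1_function_def
    by (auto simp: compact_eq_bounded_closed intro: bounded_subset[OF bounded_cbox])
qed

lemma box_bump_tendsto: "(\<lambda>n. box_bump a b n x) \<longlonglongrightarrow> indicator (box a b) x"
proof (cases "x \<in> box a b")
  case True
  have "(\<lambda>n. box_bump a b n x) \<longlonglongrightarrow> (\<Prod>i\<in>(UNIV :: 'a set). 1) * (\<Prod>i\<in>(UNIV :: 'a set). 1)"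
    unfolding box_bump_def using True
    by (intro tendsto_mult tendsto_prod ramp_scaled_tendsto) (simp_all add: mem_box_cart)
  then show ?thesis using True by simp
next
  case False
  then show ?thesis by (simp add: box_bump_eq_0)
qed

lemma box_bump_bounds: "0 \<le> box_bump a b n x" "box_bump a b n x \<le> 1"
proof -
  show "0 \<le> box_bump a b n x" unfolding box_bump_def
    by (intro mult_nonneg_nonneg prod_nonneg) (auto simp: ramp_simps)
  have "box_bump a b n x \<le> 1 * 1" unfolding box_bump_def
    by (intro mult_mono prod_le_1 prod_nonneg) (auto simp: ramp_simps)
  then show "box_bump a b n x \<le> 1" by simp
qed

lemma continuous_imp_borel_measurable_lebesgue:
  fixes \<phi> :: "real ^ 'd::finite \<Rightarrow> 'b::euclidean_space"
  assumes "continuous_on UNIV \<phi>"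
  shows "\<phi> \<in> borel_measurable lebesgue"
  by (rule measurable_completion) (simp add: borel_measurable_continuous_onI assms)

text \<open>The bumps tend pointwise to the indicator of the open box and are bounded by 1, so
  dominated convergence with majorant |G| carries the vanishing integrals to the limit. The
  conclusion uses the gauge integral over the closed box because differentiation of integrals is
  applied in that form.\<close>

lemma fundamental_lemma_box:
  fixes G :: "real ^ 'd::finite \<Rightarrow> complex"
  assumes G: "integrable lebesgue G"
    and zero: "\<And>\<phi>. \<phi> \<in> test_functions O' \<Longrightarrow> (LINT x|lebesgue. G x * of_real (\<phi> x)) = 0"
    and sub: "cbox a b \<subseteq> O'"
  shows "integral (cbox a b) G = 0"
proof -
  have meas: "box_bump a b n \<in> borel_measurable lebesgue" for n
    by (intro continuous_imp_borel_measurable_lebesgue C1_function_continuous box_bump_C1)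
  have "(\<lambda>n. LINT x|lebesgue. G x * of_real (box_bump a b n x)) \<longlonglongrightarrow>
      (LINT x|lebesgue. (if x \<in> box a b then G x else 0))"
  proof (rule integral_dominated_convergence[where w = "\<lambda>x. norm (G x)"])
    show "(\<lambda>x. if x \<in> box a b then G x else 0) \<in> borel_measurable lebesgue"
      using borel_measurable_integrable[OF G] by (intro measurable_If_set) auto
    show "(\<lambda>x. G x * of_real (box_bump a b n x)) \<in> borel_measurable lebesgue" for n
      using borel_measurable_integrable[OF G] meas[of n] by measurable
    show "integrable lebesgue (\<lambda>x. norm (G x))" using G by (rule integrable_norm)
    show "AE x in lebesgue. (\<lambda>n. G x * of_real (box_bump a b n x)) \<longlonglongrightarrow> (if x \<in> box a b then G x else 0)"
    proof (rule AE_I2)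
      fix x
      have "(\<lambda>n. G x * of_real (box_bump a b n x)) \<longlonglongrightarrow> G x * of_real (indicator (box a b) x)"
        by (intro tendsto_intros box_bump_tendsto)
      then show "(\<lambda>n. G x * of_real (box_bump a b n x)) \<longlonglongrightarrow> (if x \<in> box a b then G x else 0)"
        by (auto simp: indicator_def split: if_splits)
    qed
    show "AE x in lebesgue. norm (G x * of_real (box_bump a b n x)) \<le> norm (G x)" for n
      using box_bump_bounds[of a b n] by (intro AE_I2) (auto simp: norm_mult intro: mult_left_le)
  qed
  then have "(LINT x|lebesgue. (if x \<in> box a b then G x else 0)) = 0"
    using zero[OF box_bump_test_function[OF sub]] by (simp add: LIMSEQ_const_iff)
  moreover have "integrable (lebesgue_on (box a b)) G"
    using integrable_mult_indicator[OF _ G, of "box a b"]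
    by (simp add: integrable_restrict_space)
  ultimately have "integral (box a b) G = 0"
    using Lebesgue_Measure.integral_restrict_UNIV[of "box a b" G] lebesgue_integral_eq_integral[of "box a b" G]
    by simp
  then show ?thesis by (simp add: integral_open_interval)
qed

text \<open>Almost every value of \<open>G\<close> is the limit of its means over cubes with a
  corner at the point. For a point of the open set these cubes eventually lie in the set, where the
  means vanish.\<close>

lemma fundamental_lemma_calculus_of_variations:
  fixes G :: "real ^ 'd::finite \<Rightarrow> complex"
  assumes G: "integrable lebesgue G" and O': "open O'"
    and zero: "\<And>\<phi>. \<phi> \<in> test_functions O' \<Longrightarrow> (LINT x|lebesgue. G x * of_real (\<phi> x)) = 0"
  shows "AE x in lebesgue. x \<in> O' \<longrightarrow> G x = 0"
proof -
  have "G integrable_on UNIV"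
    using integrable_on_lebesgue_on[of UNIV G] G by (simp add: lebesgue_on_UNIV_eq)
  then have "G integrable_on cbox a b" for a b
    by (rule integrable_on_subcbox) simp
  then obtain N where N: "negligible N"
    and diff: "\<And>x e. x \<notin> N \<Longrightarrow> 0 < e \<Longrightarrow>
        \<exists>d>0. \<forall>h. 0 < h \<and> h < d \<longrightarrow>
          norm (integral (cbox x (x + h *\<^sub>R One)) G /\<^sub>R h ^ DIM(real ^ 'd) - G x) < e"
    using integrable_ccontinuous_explicit by blast
  have "G x = 0" if x: "x \<in> O'" "x \<notin> N" for x
  proof (rule ccontr)
    assume "G x \<noteq> 0"
    then obtain d where d: "d > 0" and
      small: "\<And>h. 0 < h \<Longrightarrow> h < d \<Longrightarrow>
        norm (integral (cbox x (x + h *\<^sub>R One)) G /\<^sub>R h ^ DIM(real ^ 'd) - G x) < norm (G x)"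
      using diff[OF x(2), of "norm (G x)"] by auto
    obtain r where r: "r > 0" "cball x r \<subseteq> O'" using O' x open_contains_cball by blast
    define D where "D = real DIM(real ^ 'd)"
    have D: "D > 0" by (simp add: D_def)
    \<comment> \<open>The edge is shorter than \<open>d\<close>, so the mean approximates
      \<open>G x\<close>, and at most \<open>r / D\<close>: the Euclidean norm is at most the sum of
      the \<open>D\<close> coordinates, which keeps the cube inside the ball of radius
      \<open>r\<close>.\<close>
    define h where "h = min (d / 2) (r / D)"
    have h: "0 < h" "h < d" "D * h \<le> r" using d r D by (auto simp: h_def min_def field_simps)
    have "cbox x (x + h *\<^sub>R One) \<subseteq> cball x r"
    proof
      fix y assume y: "y \<in> cbox x (x + h *\<^sub>R One)"
      have "norm (y - x) \<le> (\<Sum>i\<in>Basis. \<bar>(y - x) \<bullet> i\<bar>)" by (rule norm_le_l1)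
      also have "\<dots> \<le> (\<Sum>i\<in>(Basis :: (real ^ 'd) set). h)"
      proof (rule sum_mono)
        fix i :: "real ^ 'd" assume i: "i \<in> Basis"
        have "x \<bullet> i \<le> y \<bullet> i" "y \<bullet> i \<le> x \<bullet> i + h"
          using y i unfolding mem_box by (auto simp: inner_add_left)
        then show "\<bar>(y - x) \<bullet> i\<bar> \<le> h" by (simp add: inner_diff_left)
      qed
      also have "\<dots> \<le> r" using h by (simp add: D_def)
      finally show "y \<in> cball x r" by (simp add: dist_norm norm_minus_commute)
    qed
    then have "integral (cbox x (x + h *\<^sub>R One)) G = 0"
      using r by (intro fundamental_lemma_box[OF G zero, where O' = O']) auto
    then show False using small[OF h(1,2)] by simp
  qed
  then have "{x. \<not> (x \<in> O' \<longrightarrow> G x = 0)} \<subseteq> N" by auto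
  then show ?thesis using N unfolding negligible_iff_null_sets
    by (auto intro: AE_I')
qed


section \<open>Weak derivatives of \<open>L\<^sup>2\<close> functions\<close>

text \<open>The sum of the two squared moduli dominates the product, by the arithmetic-geometric
  inequality.\<close>

lemma integrable_norm2_imp_integrable_mult:
  fixes u w :: "'a \<Rightarrow> complex"
  assumes [measurable]: "u \<in> borel_measurable M" "w \<in> borel_measurable M"
    and "integrable M (\<lambda>x. (cmod (u x))\<^sup>2)" "integrable M (\<lambda>x. (cmod (w x))\<^sup>2)"
  shows "integrable M (\<lambda>x. u x * w x)"
proof (rule Bochner_Integration.integrable_bound)
  show "integrable M (\<lambda>x. (cmod (u x))\<^sup>2 + (cmod (w x))\<^sup>2)" using assms by simp
  show "AE x in M. norm (u x * w x) \<le> norm ((cmod (u x))\<^sup>2 + (cmod (w x))\<^sup>2)"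
  proof (rule AE_I2)
    fix x
    have "2 * (cmod (u x) * cmod (w x)) \<le> (cmod (u x))\<^sup>2 + (cmod (w x))\<^sup>2"
      using sum_squares_bound[of "cmod (u x)" "cmod (w x)"] by (simp only: mult.assoc)
    moreover have "0 \<le> cmod (u x) * cmod (w x)" by simp
    ultimately have "cmod (u x) * cmod (w x) \<le> (cmod (u x))\<^sup>2 + (cmod (w x))\<^sup>2"
      by linarith
    then show "norm (u x * w x) \<le> norm ((cmod (u x))\<^sup>2 + (cmod (w x))\<^sup>2)"
      by (simp add: norm_mult)
  qed
qed measurable

lemma L2_measurable: "u \<in> L2 \<Omega> \<Longrightarrow> u \<in> borel_measurable (lebesgue_on \<Omega>)"
  by (simp add: L2_def)

lemma L2_scale: "u \<in> L2 \<Omega> \<Longrightarrow> (\<lambda>x. c * u x) \<in> L2 \<Omega>"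
  by (auto simp: L2_def norm_mult power_mult_distrib)

lemma L2_cnj: "u \<in> L2 \<Omega> \<Longrightarrow> (\<lambda>x. cnj (u x)) \<in> L2 \<Omega>"
  by (auto simp: L2_def intro!: borel_measurable_continuous_on[of cnj] continuous_intros)

lemma L2_integrable_mult: "u \<in> L2 \<Omega> \<Longrightarrow> w \<in> L2 \<Omega> \<Longrightarrow> integrable (lebesgue_on \<Omega>) (\<lambda>x. u x * w x)"
  by (auto simp: L2_def intro: integrable_norm2_imp_integrable_mult)

lemma L2_add:
  assumes "u \<in> L2 \<Omega>" "w \<in> L2 \<Omega>"
  shows "(\<lambda>x. u x + w x) \<in> L2 \<Omega>"
proof -
  note [measurable] = L2_measurable[OF assms(1)] L2_measurable[OF assms(2)]
  have "integrable (lebesgue_on \<Omega>) (\<lambda>x. (cmod (u x + w x))\<^sup>2)"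
  proof (rule Bochner_Integration.integrable_bound)
    show "integrable (lebesgue_on \<Omega>) (\<lambda>x. 2 * (cmod (u x))\<^sup>2 + 2 * (cmod (w x))\<^sup>2)"
      using assms by (simp add: L2_def)
    show "AE x in lebesgue_on \<Omega>. norm ((cmod (u x + w x))\<^sup>2) \<le>
        norm (2 * (cmod (u x))\<^sup>2 + 2 * (cmod (w x))\<^sup>2)"
    proof (rule AE_I2)
      fix x
      have "(cmod (u x + w x))\<^sup>2 \<le> (cmod (u x) + cmod (w x))\<^sup>2"
        by (intro power_mono norm_triangle_ineq) simp
      also have "\<dots> \<le> 2 * (cmod (u x))\<^sup>2 + 2 * (cmod (w x))\<^sup>2"
        using sum_squares_bound[of "cmod (u x)" "cmod (w x)"] by (simp add: power2_sum)
      finally show "norm ((cmod (u x + w x))\<^sup>2) \<le> norm (2 * (cmod (u x))\<^sup>2 + 2 * (cmod (w x))\<^sup>2)"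
        by simp
    qed
  qed measurable
  then show ?thesis by (simp add: L2_def)
qed

lemma L2_zero: "(\<lambda>x. 0) \<in> L2 \<Omega>"
  by (simp add: L2_def)

lemma L2_sum: "finite I \<Longrightarrow> (\<And>i. i \<in> I \<Longrightarrow> u i \<in> L2 \<Omega>) \<Longrightarrow> (\<lambda>x. \<Sum>i\<in>I. u i x) \<in> L2 \<Omega>"
  by (induction I rule: finite_induct) (auto simp: L2_zero intro: L2_add)

section \<open>Test functions paired with square integrable functions\<close>

lemma test_functions_mono: "O' \<subseteq> \<Omega> \<Longrightarrow> test_functions O' \<subseteq> test_functions \<Omega>"
  unfolding test_functions_def by auto

lemma test_functions_C1: "\<phi> \<in> test_functions \<Omega> \<Longrightarrow> C1_function \<phi>"
  by (simp add: test_functions_def C1_function_def)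

lemma partial_outside_support:
  assumes "x \<notin> closure {x. \<phi> x \<noteq> 0}"
  shows "partial k \<phi> x = 0"
proof -
  have "((\<lambda>_. 0) has_derivative (\<lambda>_. 0)) (at x)" by simp
  then have "(\<phi> has_derivative (\<lambda>_. 0)) (at x)"
    by (rule has_derivative_transform_within_open[where s = "- closure {x. \<phi> x \<noteq> 0}"])
      (use assms closure_subset[of "{x. \<phi> x \<noteq> 0}"] in auto)
  then show ?thesis by (rule partial_eq)
qed

lemma test_function_outside:
  assumes "\<phi> \<in> test_functions O'" "x \<notin> O'"
  shows "\<phi> x = 0" "partial k \<phi> x = 0"
proof -
  have x: "x \<notin> closure {x. \<phi> x \<noteq> 0}" using assms by (auto simp: test_functions_def)
  then show "\<phi> x = 0" using closure_subset[of "{x. \<phi> x \<noteq> 0}"] by auto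
  show "partial k \<phi> x = 0" using x by (rule partial_outside_support)
qed

lemma bounded_function_L2:
  fixes \<Omega> :: "(real ^ 'd::finite) set" and \<psi> :: "real ^ 'd \<Rightarrow> complex"
  assumes \<Omega>: "open \<Omega>" "bounded \<Omega>" and meas: "\<psi> \<in> borel_measurable (lebesgue_on \<Omega>)"
    and C: "\<And>x. x \<in> \<Omega> \<Longrightarrow> cmod (\<psi> x) \<le> C"
  shows "\<psi> \<in> L2 \<Omega>"
proof -
  have "\<Omega> \<in> lmeasurable" using \<Omega> by (simp add: lmeasurable_open)
  then interpret finite_measure "lebesgue_on \<Omega>" by (rule finite_measure_lebesgue_on)
  have "integrable (lebesgue_on \<Omega>) (\<lambda>x. (cmod (\<psi> x))\<^sup>2)"
  proof (rule integrable_const_bound[where B = "C\<^sup>2"])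
    show "AE x in lebesgue_on \<Omega>. norm ((cmod (\<psi> x))\<^sup>2) \<le> C\<^sup>2"
      using C by (intro AE_I2) (auto intro: power_mono)
  qed (use meas in measurable)
  then show ?thesis using meas by (simp add: L2_def)
qed

lemma compactly_supported_L2:
  fixes \<Omega> :: "(real ^ 'd::finite) set" and \<psi> :: "real ^ 'd \<Rightarrow> real"
  assumes \<Omega>: "open \<Omega>" "bounded \<Omega>" and cont: "continuous_on UNIV \<psi>"
    and K: "compact K" "\<And>x. x \<notin> K \<Longrightarrow> \<psi> x = 0"
  shows "(\<lambda>x. complex_of_real (\<psi> x)) \<in> L2 \<Omega>"
proof -
  have "bounded (\<psi> ` K)"
    by (intro compact_imp_bounded compact_continuous_image continuous_on_subset[OF cont] K) simp
  then obtain C where C: "\<And>x. x \<in> K \<Longrightarrow> \<bar>\<psi> x\<bar> \<le> C" by (auto simp: bounded_iff)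
  have "\<bar>\<psi> x\<bar> \<le> max C 0" for x using C[of x] K(2)[of x] by (cases "x \<in> K") auto
  moreover have "(\<lambda>x. complex_of_real (\<psi> x)) \<in> borel_measurable lebesgue"
    by (intro continuous_imp_borel_measurable_lebesgue continuous_intros cont)
  then have "(\<lambda>x. complex_of_real (\<psi> x)) \<in> borel_measurable (lebesgue_on \<Omega>)"
    by (rule measurable_restrict_space1)
  ultimately show ?thesis by (intro bounded_function_L2[OF \<Omega>, of _ "max C 0"]) auto
qed

lemma test_function_L2:
  assumes "open \<Omega>" "bounded \<Omega>" and \<phi>: "\<phi> \<in> test_functions \<Omega>"
  shows "(\<lambda>x. complex_of_real (\<phi> x)) \<in> L2 \<Omega>" "(\<lambda>x. complex_of_real (partial k \<phi> x)) \<in> L2 \<Omega>"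
proof -
  define K where "K = closure {x. \<phi> x \<noteq> 0}"
  have K: "compact K" using \<phi> by (auto simp: K_def test_functions_def)
  have 0: "\<phi> x = 0" "partial k \<phi> x = 0" if "x \<notin> K" for x
    using that closure_subset[of "{x. \<phi> x \<noteq> 0}"] partial_outside_support[of x \<phi>] by (auto simp: K_def)
  have cont: "continuous_on UNIV \<phi>" "continuous_on UNIV (partial k \<phi>)"
    using test_functions_C1[OF \<phi>] C1_function_continuous by (auto simp: C1_function_def)
  show "(\<lambda>x. complex_of_real (\<phi> x)) \<in> L2 \<Omega>"
    by (rule compactly_supported_L2[OF assms(1,2) cont(1) K]) (rule 0)
  show "(\<lambda>x. complex_of_real (partial k \<phi> x)) \<in> L2 \<Omega>"
    by (rule compactly_supported_L2[OF assms(1,2) cont(2) K]) (rule 0)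
qed

text \<open>The constant 1 is square integrable on a bounded domain, so the product rule applies
  with it as second factor.\<close>

lemma L2_integrable:
  assumes "open \<Omega>" "bounded \<Omega>" "u \<in> L2 \<Omega>"
  shows "integrable (lebesgue_on \<Omega>) u"
proof -
  have "(\<lambda>x. 1) \<in> L2 \<Omega>" by (rule bounded_function_L2[OF assms(1,2), of _ 1]) auto
  from L2_integrable_mult[OF assms(3) this] show ?thesis by simp
qed

text \<open>Extension by zero yields an integrable function on the whole space, to which the
  fundamental lemma applies. With the full domain as \<open>O'\<close> this gives uniqueness of weak
  derivatives, with a subdomain their locality.\<close>

lemma L2_vanishes_on_open:
  fixes g :: "real ^ 'd::finite \<Rightarrow> complex"
  assumes \<Omega>: "open \<Omega>" "bounded \<Omega>" and g: "g \<in> L2 \<Omega>" and O': "open O'" "O' \<subseteq> \<Omega>"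
    and zero: "\<And>\<phi>. \<phi> \<in> test_functions O' \<Longrightarrow> (LINT x|lebesgue_on \<Omega>. g x * of_real (\<phi> x)) = 0"
  shows "AE x in lebesgue_on \<Omega>. x \<in> O' \<longrightarrow> g x = 0"
proof -
  define G where "G x = (if x \<in> \<Omega> then g x else 0)" for x
  have \<Omega>m: "\<Omega> \<in> sets lebesgue" using \<Omega> by simp
  have "integrable lebesgue G"
    unfolding G_def Lebesgue_Measure.integrable_restrict_UNIV[OF \<Omega>m] by (rule L2_integrable[OF \<Omega> g])
  moreover have "(LINT x|lebesgue. G x * of_real (\<phi> x)) = 0" if \<phi>: "\<phi> \<in> test_functions O'" for \<phi>
  proof -
    have "(LINT x|lebesgue. G x * of_real (\<phi> x)) =
        (LINT x|lebesgue. (if x \<in> \<Omega> then g x * of_real (\<phi> x) else 0))"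
      by (intro Bochner_Integration.integral_cong) (auto simp: G_def)
    then show ?thesis using Lebesgue_Measure.integral_restrict_UNIV[OF \<Omega>m] zero[OF \<phi>] by metis
  qed
  ultimately have "AE x in lebesgue. x \<in> O' \<longrightarrow> G x = 0"
    by (intro fundamental_lemma_calculus_of_variations O')
  then have "AE x in lebesgue. x \<in> \<Omega> \<longrightarrow> (x \<in> O' \<longrightarrow> g x = 0)"
    by eventually_elim (auto simp: G_def)
  then show ?thesis using \<Omega>m by (simp add: AE_restrict_space_iff)
qed

lemma weak_partial_unique:
  assumes \<Omega>: "open \<Omega>" "bounded \<Omega>" and g: "g1 \<in> L2 \<Omega>" "g2 \<in> L2 \<Omega>"
    and w: "is_weak_partial \<Omega> k u g1" "is_weak_partial \<Omega> k u g2"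
  shows "AE x in lebesgue_on \<Omega>. g1 x = g2 x"
proof -
  have d: "(\<lambda>x. g1 x + (-1) * g2 x) \<in> L2 \<Omega>" by (intro L2_add L2_scale g)
  have "AE x in lebesgue_on \<Omega>. x \<in> \<Omega> \<longrightarrow> g1 x + (-1) * g2 x = 0"
  proof (rule L2_vanishes_on_open[OF \<Omega> d \<Omega>(1) order_refl])
    fix \<phi> assume \<phi>: "\<phi> \<in> test_functions \<Omega>"
    note int = L2_integrable_mult[OF _ test_function_L2(1)[OF \<Omega> \<phi>]]
    have "(LINT x|lebesgue_on \<Omega>. g1 x * of_real (\<phi> x)) = (LINT x|lebesgue_on \<Omega>. g2 x * of_real (\<phi> x))"
      using w \<phi> by (simp add: is_weak_partial_def)
    then show "(LINT x|lebesgue_on \<Omega>. (g1 x + (-1) * g2 x) * of_real (\<phi> x)) = 0"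
      using int[OF g(1)] int[OF g(2)] by (simp add: left_diff_distrib)
  qed
  moreover have "AE x in lebesgue_on \<Omega>. x \<in> \<Omega>" by (rule AE_I2) simp
  ultimately show ?thesis by eventually_elim auto
qed

section \<open>Linearity and locality of the chosen weak derivative\<close>

lemma weak_partial_properties:
  assumes "u \<in> H1 \<Omega>"
  shows "weak_partial \<Omega> k u \<in> L2 \<Omega>" "is_weak_partial \<Omega> k u (weak_partial \<Omega> k u)"
proof -
  have "\<exists>g. g \<in> L2 \<Omega> \<and> is_weak_partial \<Omega> k u g" using assms by (auto simp: H1_def)
  from someI_ex[OF this] show "weak_partial \<Omega> k u \<in> L2 \<Omega>" "is_weak_partial \<Omega> k u (weak_partial \<Omega> k u)"
    by (auto simp: weak_partial_def)
qed

lemma is_weak_partial_add: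
  assumes \<Omega>: "open \<Omega>" "bounded \<Omega>" and "u1 \<in> L2 \<Omega>" "u2 \<in> L2 \<Omega>" "g1 \<in> L2 \<Omega>" "g2 \<in> L2 \<Omega>"
    and "is_weak_partial \<Omega> k u1 g1" "is_weak_partial \<Omega> k u2 g2"
  shows "is_weak_partial \<Omega> k (\<lambda>x. u1 x + u2 x) (\<lambda>x. g1 x + g2 x)"
  unfolding is_weak_partial_def
proof
  fix \<phi> assume \<phi>: "\<phi> \<in> test_functions \<Omega>"
  note int = L2_integrable_mult[OF _ test_function_L2(1)[OF \<Omega> \<phi>]]
    L2_integrable_mult[OF _ test_function_L2(2)[OF \<Omega> \<phi>]]
  show "(LINT x|lebesgue_on \<Omega>. (u1 x + u2 x) * of_real (partial k \<phi> x)) =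
      - (LINT x|lebesgue_on \<Omega>. (g1 x + g2 x) * of_real (\<phi> x))"
    using assms \<phi> by (simp add: distrib_right int is_weak_partial_def)
qed

lemma is_weak_partial_scale:
  "is_weak_partial \<Omega> k u g \<Longrightarrow> is_weak_partial \<Omega> k (\<lambda>x. c * u x) (\<lambda>x. c * g x)"
  unfolding is_weak_partial_def by (simp add: mult.assoc)

lemma H1_add:
  assumes "open \<Omega>" "bounded \<Omega>" "u \<in> H1 \<Omega>" "w \<in> H1 \<Omega>"
  shows "(\<lambda>x. u x + w x) \<in> H1 \<Omega>"
proof -
  have L: "u \<in> L2 \<Omega>" "w \<in> L2 \<Omega>" using assms by (auto simp: H1_def)
  have "is_weak_partial \<Omega> k (\<lambda>x. u x + w x) (\<lambda>x. weak_partial \<Omega> k u x + weak_partial \<Omega> k w x)" for k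
    by (intro is_weak_partial_add assms weak_partial_properties L)
  moreover have "(\<lambda>x. weak_partial \<Omega> k u x + weak_partial \<Omega> k w x) \<in> L2 \<Omega>" for k
    by (intro L2_add weak_partial_properties assms)
  ultimately show ?thesis unfolding H1_def using L L2_add by blast
qed

lemma H1_scale:
  assumes "u \<in> H1 \<Omega>"
  shows "(\<lambda>x. c * u x) \<in> H1 \<Omega>"
proof -
  have L: "u \<in> L2 \<Omega>" using assms by (auto simp: H1_def)
  have "is_weak_partial \<Omega> k (\<lambda>x. c * u x) (\<lambda>x. c * weak_partial \<Omega> k u x)" for k
    by (intro is_weak_partial_scale weak_partial_properties assms)
  moreover have "(\<lambda>x. c * weak_partial \<Omega> k u x) \<in> L2 \<Omega>" for k
    by (intro L2_scale weak_partial_properties assms)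
  ultimately show ?thesis unfolding H1_def using L L2_scale by blast
qed

lemma H1_zero: "(\<lambda>x. 0) \<in> H1 \<Omega>"
  using L2_zero by (auto simp: H1_def is_weak_partial_def intro!: bexI[of _ "\<lambda>x. 0"])

text \<open>\<open>weak_partial\<close> picks some representative, and the choices for different
  functions are unrelated. Both sides are weak derivatives of the sum, so uniqueness identifies them
  almost everywhere, and only in that sense.\<close>

lemma weak_partial_add:
  assumes \<Omega>: "open \<Omega>" "bounded \<Omega>" and "u \<in> H1 \<Omega>" "w \<in> H1 \<Omega>"
  shows "AE x in lebesgue_on \<Omega>. weak_partial \<Omega> k (\<lambda>x. u x + w x) x =
    weak_partial \<Omega> k u x + weak_partial \<Omega> k w x"
proof (rule weak_partial_unique[OF \<Omega>])
  have L: "u \<in> L2 \<Omega>" "w \<in> L2 \<Omega>" using assms by (auto simp: H1_def)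
  show "is_weak_partial \<Omega> k (\<lambda>x. u x + w x) (\<lambda>x. weak_partial \<Omega> k u x + weak_partial \<Omega> k w x)"
    by (intro is_weak_partial_add assms weak_partial_properties L)
qed (intro weak_partial_properties H1_add L2_add assms)+

lemma weak_partial_scale:
  assumes \<Omega>: "open \<Omega>" "bounded \<Omega>" and "u \<in> H1 \<Omega>"
  shows "AE x in lebesgue_on \<Omega>. weak_partial \<Omega> k (\<lambda>x. c * u x) x = c * weak_partial \<Omega> k u x"
  by (rule weak_partial_unique[OF \<Omega>, where k = k and u = "\<lambda>x. c * u x"])
    (intro weak_partial_properties H1_scale L2_scale is_weak_partial_scale assms)+

text \<open>A test function supported in \<open>O'\<close> meets \<open>u\<close> only where
  \<open>u\<close> vanishes, so the derivative integrates to zero against every such function.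
  Openness of \<open>O'\<close> is what provides enough of them.\<close>

lemma weak_partial_local:
  assumes \<Omega>: "open \<Omega>" "bounded \<Omega>" and u: "u \<in> H1 \<Omega>"
    and O': "open O'" "O' \<subseteq> \<Omega>" and zero: "\<And>x. x \<in> O' \<Longrightarrow> u x = 0"
  shows "AE x in lebesgue_on \<Omega>. x \<in> O' \<longrightarrow> weak_partial \<Omega> k u x = 0"
proof (rule L2_vanishes_on_open[OF \<Omega> weak_partial_properties(1)[OF u] O'])
  fix \<phi> assume \<phi>: "\<phi> \<in> test_functions O'"
  have "u x * of_real (partial k \<phi> x) = 0" for x
    using zero[of x] test_function_outside(2)[OF \<phi>] by (cases "x \<in> O'") auto
  then have "(\<lambda>x. u x * of_real (partial k \<phi> x)) = (\<lambda>x. 0)" by (rule ext)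
  then have "(LINT x|lebesgue_on \<Omega>. u x * of_real (partial k \<phi> x)) = 0" by simp
  then show "(LINT x|lebesgue_on \<Omega>. weak_partial \<Omega> k u x * of_real (\<phi> x)) = 0"
    using weak_partial_properties(2)[OF u, of k] subsetD[OF test_functions_mono[OF O'(2)] \<phi>]
    unfolding is_weak_partial_def by auto
qed

text \<open>The common building block: weight 1 gives the mass form, the Lame weights give the
  strain and divergence parts. The algebra is done once here; real weights make it
  Hermitian.\<close>

definition weighted_inner ::
  "(real ^ 'd::finite) set \<Rightarrow> (real ^ 'd \<Rightarrow> real) \<Rightarrow> (real ^ 'd \<Rightarrow> complex) \<Rightarrow> (real ^ 'd \<Rightarrow> complex) \<Rightarrow> complex"
  where "weighted_inner \<Omega> \<mu> u w = (LINT x|lebesgue_on \<Omega>. of_real (\<mu> x) * u x * cnj (w x))"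

lemma weighted_integrable:
  assumes "essentially_bounded \<Omega> \<mu>" "u \<in> L2 \<Omega>" "w \<in> L2 \<Omega>"
  shows "integrable (lebesgue_on \<Omega>) (\<lambda>x. of_real (\<mu> x) * u x * cnj (w x))"
proof -
  obtain C where C: "AE x in lebesgue_on \<Omega>. \<bar>\<mu> x\<bar> \<le> C"
    using assms by (auto simp: essentially_bounded_def)
  have [measurable]: "\<mu> \<in> borel_measurable (lebesgue_on \<Omega>)"
    using assms by (simp add: essentially_bounded_def)
  note [measurable] = L2_measurable[OF assms(2)] L2_measurable[OF L2_cnj[OF assms(3)]]
  show ?thesis
  proof (rule Bochner_Integration.integrable_bound)
    show "integrable (lebesgue_on \<Omega>) (\<lambda>x. of_real C * (u x * cnj (w x)))"
      by (intro integrable_mult_right L2_integrable_mult L2_cnj assms)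
    show "AE x in lebesgue_on \<Omega>. norm (of_real (\<mu> x) * u x * cnj (w x)) \<le>
        norm (of_real C * (u x * cnj (w x)))"
      using C
    proof eventually_elim
      case (elim x)
      then have "\<bar>\<mu> x\<bar> * (cmod (u x) * cmod (w x)) \<le> \<bar>C\<bar> * (cmod (u x) * cmod (w x))"
        by (intro mult_right_mono) auto
      then show ?case by (simp add: norm_mult mult.assoc)
    qed
  qed measurable
qed

lemma weighted_inner_add:
  assumes "essentially_bounded \<Omega> \<mu>" "u \<in> L2 \<Omega>" "v \<in> L2 \<Omega>" "w \<in> L2 \<Omega>"
  shows "weighted_inner \<Omega> \<mu> (\<lambda>x. u x + v x) w = weighted_inner \<Omega> \<mu> u w + weighted_inner \<Omega> \<mu> v w"
  unfolding weighted_inner_def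
  using weighted_integrable[OF assms(1,2,4)] weighted_integrable[OF assms(1,3,4)]
  by (simp add: algebra_simps)

lemma weighted_inner_scale:
  "weighted_inner \<Omega> \<mu> (\<lambda>x. c * u x) w = c * weighted_inner \<Omega> \<mu> u w"
proof -
  have "weighted_inner \<Omega> \<mu> (\<lambda>x. c * u x) w =
      (LINT x|lebesgue_on \<Omega>. c * (of_real (\<mu> x) * u x * cnj (w x)))"
    unfolding weighted_inner_def by (simp only: ac_simps)
  then show ?thesis by (simp add: weighted_inner_def)
qed

lemma weighted_inner_cnj: "weighted_inner \<Omega> \<mu> w u = cnj (weighted_inner \<Omega> \<mu> u w)"
proof -
  have "cnj (weighted_inner \<Omega> \<mu> u w) = (LINT x|lebesgue_on \<Omega>. cnj (of_real (\<mu> x) * u x * cnj (w x)))"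
    unfolding weighted_inner_def by (simp only: Bochner_Integration.integral_cnj)
  also have "\<dots> = weighted_inner \<Omega> \<mu> w u"
    unfolding weighted_inner_def by (simp add: ac_simps)
  finally show ?thesis by simp
qed

text \<open>Here identities of weak derivatives that hold almost everywhere become equalities of
  forms.\<close>

lemma weighted_inner_cong_AE:
  assumes "essentially_bounded \<Omega> \<mu>" "u \<in> L2 \<Omega>" "u' \<in> L2 \<Omega>" "w \<in> L2 \<Omega>"
    and "AE x in lebesgue_on \<Omega>. u x = u' x"
  shows "weighted_inner \<Omega> \<mu> u w = weighted_inner \<Omega> \<mu> u' w"
  unfolding weighted_inner_def
proof (rule integral_cong_AE)
  show "AE x in lebesgue_on \<Omega>. of_real (\<mu> x) * u x * cnj (w x) = of_real (\<mu> x) * u' x * cnj (w x)"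
    using assms(5) by eventually_elim simp
qed (intro borel_measurable_integrable weighted_integrable assms)+

lemma weighted_inner_eq_0_AE:
  assumes "AE x in lebesgue_on \<Omega>. u x = 0 \<or> w x = 0"
  shows "weighted_inner \<Omega> \<mu> u w = 0"
  unfolding weighted_inner_def
  by (rule integral_eq_zero_AE) (use assms in \<open>eventually_elim, auto\<close>)

lemma essentially_bounded_const: "essentially_bounded \<Omega> (\<lambda>x. c)"
  by (auto simp: essentially_bounded_def)


section \<open>The elasticity form on the finite element space\<close>

text \<open>The regularity that supports the sesquilinear algebra of both forms; strict positivity
  is proved later, using the continuity of finite element fields.\<close>

definition H1_fields :: "(real ^ 'd::finite) set \<Rightarrow> 'd cfield set" where
  "H1_fields \<Omega> = {v. \<forall>i. (\<lambda>x. v x $ i) \<in> H1 \<Omega>}"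

lemma H1_fieldsD: "v \<in> H1_fields \<Omega> \<Longrightarrow> (\<lambda>x. v x $ i) \<in> H1 \<Omega>" "v \<in> H1_fields \<Omega> \<Longrightarrow> (\<lambda>x. v x $ i) \<in> L2 \<Omega>"
  by (auto simp: H1_fields_def H1_def)

lemma H1_fields_add: "open \<Omega> \<Longrightarrow> bounded \<Omega> \<Longrightarrow> v \<in> H1_fields \<Omega> \<Longrightarrow> w \<in> H1_fields \<Omega> \<Longrightarrow> v + w \<in> H1_fields \<Omega>"
  by (auto simp: H1_fields_def intro: H1_add)

lemma H1_fields_scale: "v \<in> H1_fields \<Omega> \<Longrightarrow> cscale c v \<in> H1_fields \<Omega>"
  by (auto simp: H1_fields_def cscale_def intro: H1_scale)

lemma l2_inner_eq_weighted:
  assumes "v \<in> H1_fields \<Omega>" "w \<in> H1_fields \<Omega>"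
  shows "l2_inner \<Omega> v w = (\<Sum>i\<in>UNIV. weighted_inner \<Omega> (\<lambda>x. 1) (\<lambda>x. v x $ i) (\<lambda>x. w x $ i))"
proof -
  have "integrable (lebesgue_on \<Omega>) (\<lambda>x. v x $ i * cnj (w x $ i))" for i
    by (intro L2_integrable_mult L2_cnj H1_fieldsD assms)
  then show ?thesis
    unfolding l2_inner_def weighted_inner_def by (simp add: Bochner_Integration.integral_sum)
qed

lemma l2_inner_add:
  assumes \<Omega>: "open \<Omega>" "bounded \<Omega>" and "u \<in> H1_fields \<Omega>" "v \<in> H1_fields \<Omega>" "w \<in> H1_fields \<Omega>"
  shows "l2_inner \<Omega> (u + v) w = l2_inner \<Omega> u w + l2_inner \<Omega> v w"
  using assms
  by (simp add: l2_inner_eq_weighted H1_fields_add weighted_inner_add essentially_bounded_const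
      H1_fieldsD sum.distrib)

lemma l2_inner_scale:
  assumes "u \<in> H1_fields \<Omega>" "w \<in> H1_fields \<Omega>"
  shows "l2_inner \<Omega> (cscale c u) w = c * l2_inner \<Omega> u w"
proof -
  have "l2_inner \<Omega> (cscale c u) w =
      (\<Sum>i\<in>UNIV. weighted_inner \<Omega> (\<lambda>x. 1) (\<lambda>x. c * u x $ i) (\<lambda>x. w x $ i))"
    using assms by (simp add: l2_inner_eq_weighted H1_fields_scale) (simp add: cscale_def)
  then show ?thesis
    by (simp add: weighted_inner_scale l2_inner_eq_weighted assms sum_distrib_left)
qed

lemma l2_inner_cnj:
  assumes "u \<in> H1_fields \<Omega>" "w \<in> H1_fields \<Omega>"
  shows "l2_inner \<Omega> w u = cnj (l2_inner \<Omega> u w)"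
  unfolding l2_inner_eq_weighted[OF assms] l2_inner_eq_weighted[OF assms(2,1)] cnj_sum
  by (intro sum.cong refl weighted_inner_cnj)

lemma strain_L2: "v \<in> H1_fields \<Omega> \<Longrightarrow> strain \<Omega> v i j \<in> L2 \<Omega>"
proof -
  assume v: "v \<in> H1_fields \<Omega>"
  have "(\<lambda>x. (1 / 2) * (weak_partial \<Omega> j (\<lambda>x. v x $ i) x + weak_partial \<Omega> i (\<lambda>x. v x $ j) x)) \<in> L2 \<Omega>"
    by (intro L2_scale L2_add weak_partial_properties H1_fieldsD v)
  then show ?thesis by (simp add: strain_def[abs_def])
qed

lemma divergence_L2: "v \<in> H1_fields \<Omega> \<Longrightarrow> divergence \<Omega> v \<in> L2 \<Omega>"
  unfolding divergence_def[abs_def] by (intro L2_sum weak_partial_properties H1_fieldsD) auto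

lemma strain_add:
  assumes "open \<Omega>" "bounded \<Omega>" "u \<in> H1_fields \<Omega>" "v \<in> H1_fields \<Omega>"
  shows "AE x in lebesgue_on \<Omega>. strain \<Omega> (u + v) i j x = strain \<Omega> u i j x + strain \<Omega> v i j x"
  using weak_partial_add[OF assms(1,2) H1_fieldsD(1)[OF assms(3), of i] H1_fieldsD(1)[OF assms(4), of i], of j]
    weak_partial_add[OF assms(1,2) H1_fieldsD(1)[OF assms(3), of j] H1_fieldsD(1)[OF assms(4), of j], of i]
  by eventually_elim (simp add: strain_def field_simps)

lemma strain_scale:
  assumes "open \<Omega>" "bounded \<Omega>" "u \<in> H1_fields \<Omega>"
  shows "AE x in lebesgue_on \<Omega>. strain \<Omega> (cscale c u) i j x = c * strain \<Omega> u i j x"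
  using weak_partial_scale[OF assms(1,2) H1_fieldsD(1)[OF assms(3), of i], of j c]
    weak_partial_scale[OF assms(1,2) H1_fieldsD(1)[OF assms(3), of j], of i c]
  by eventually_elim (simp add: strain_def cscale_def field_simps)

lemma divergence_add:
  assumes "open \<Omega>" "bounded \<Omega>" "u \<in> H1_fields \<Omega>" "v \<in> H1_fields \<Omega>"
  shows "AE x in lebesgue_on \<Omega>. divergence \<Omega> (u + v) x = divergence \<Omega> u x + divergence \<Omega> v x"
proof -
  have "AE x in lebesgue_on \<Omega>. \<forall>i\<in>UNIV. weak_partial \<Omega> i (\<lambda>x. u x $ i + v x $ i) x =
      weak_partial \<Omega> i (\<lambda>x. u x $ i) x + weak_partial \<Omega> i (\<lambda>x. v x $ i) x"
    by (intro AE_finite_allI weak_partial_add H1_fieldsD assms) simp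
  then show ?thesis by eventually_elim (simp add: divergence_def sum.distrib)
qed

lemma divergence_scale:
  assumes "open \<Omega>" "bounded \<Omega>" "u \<in> H1_fields \<Omega>"
  shows "AE x in lebesgue_on \<Omega>. divergence \<Omega> (cscale c u) x = c * divergence \<Omega> u x"
proof -
  have "AE x in lebesgue_on \<Omega>. \<forall>i\<in>UNIV. weak_partial \<Omega> i (\<lambda>x. c * u x $ i) x =
      c * weak_partial \<Omega> i (\<lambda>x. u x $ i) x"
    by (intro AE_finite_allI weak_partial_scale H1_fieldsD assms) simp
  then show ?thesis by eventually_elim (simp add: divergence_def cscale_def sum_distrib_left)
qed

text \<open>The finite sums leave the integral because each strain product is integrable: the weight
  is essentially bounded and the strains are square integrable.\<close>

lemma elasticity_form_eq_weighted:
  assumes \<mu>: "essentially_bounded \<Omega> \<mu>" and v: "v \<in> H1_fields \<Omega>" and w: "w \<in> H1_fields \<Omega>"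
  shows "elasticity_form \<Omega> \<mu> \<kappa> v w =
    2 * (\<Sum>i\<in>UNIV. \<Sum>j\<in>UNIV. weighted_inner \<Omega> \<mu> (strain \<Omega> v i j) (strain \<Omega> w i j)) +
    weighted_inner \<Omega> \<kappa> (divergence \<Omega> v) (divergence \<Omega> w)"
proof -
  have "integrable (lebesgue_on \<Omega>) (\<lambda>x. of_real (\<mu> x) * strain \<Omega> v i j x * cnj (strain \<Omega> w i j x))" for i j
    by (intro weighted_integrable \<mu> strain_L2 v w)
  then show ?thesis
    unfolding elasticity_form_def weighted_inner_def
    by (simp add: sum_distrib_left Bochner_Integration.integral_sum mult.assoc)
qed

lemma elasticity_form_add:
  assumes \<Omega>: "open \<Omega>" "bounded \<Omega>" and \<mu>: "essentially_bounded \<Omega> \<mu>" and \<kappa>: "essentially_bounded \<Omega> \<kappa>"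
    and u: "u \<in> H1_fields \<Omega>" and v: "v \<in> H1_fields \<Omega>" and w: "w \<in> H1_fields \<Omega>"
  shows "elasticity_form \<Omega> \<mu> \<kappa> (u + v) w = elasticity_form \<Omega> \<mu> \<kappa> u w + elasticity_form \<Omega> \<mu> \<kappa> v w"
proof -
  have uv: "u + v \<in> H1_fields \<Omega>" by (intro H1_fields_add \<Omega> u v)
  have s: "weighted_inner \<Omega> \<mu> (strain \<Omega> (u + v) i j) (strain \<Omega> w i j) =
      weighted_inner \<Omega> \<mu> (strain \<Omega> u i j) (strain \<Omega> w i j) +
      weighted_inner \<Omega> \<mu> (strain \<Omega> v i j) (strain \<Omega> w i j)" for i j
  proof -
    have "weighted_inner \<Omega> \<mu> (strain \<Omega> (u + v) i j) (strain \<Omega> w i j) =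
        weighted_inner \<Omega> \<mu> (\<lambda>x. strain \<Omega> u i j x + strain \<Omega> v i j x) (strain \<Omega> w i j)"
      by (rule weighted_inner_cong_AE[OF \<mu>]) (intro strain_L2 L2_add strain_add \<Omega> u v w uv)+
    then show ?thesis
      using weighted_inner_add[OF \<mu> strain_L2[OF u] strain_L2[OF v] strain_L2[OF w]] by simp
  qed
  have "weighted_inner \<Omega> \<kappa> (divergence \<Omega> (u + v)) (divergence \<Omega> w) =
      weighted_inner \<Omega> \<kappa> (\<lambda>x. divergence \<Omega> u x + divergence \<Omega> v x) (divergence \<Omega> w)"
    by (rule weighted_inner_cong_AE[OF \<kappa>]) (intro divergence_L2 L2_add divergence_add \<Omega> u v w uv)+
  also have "\<dots> = weighted_inner \<Omega> \<kappa> (divergence \<Omega> u) (divergence \<Omega> w) +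
      weighted_inner \<Omega> \<kappa> (divergence \<Omega> v) (divergence \<Omega> w)"
    by (intro weighted_inner_add \<kappa> divergence_L2 u v w)
  finally show ?thesis
    by (simp add: elasticity_form_eq_weighted \<mu> u v w uv s sum.distrib algebra_simps)
qed

lemma elasticity_form_scale:
  assumes \<Omega>: "open \<Omega>" "bounded \<Omega>" and \<mu>: "essentially_bounded \<Omega> \<mu>" and \<kappa>: "essentially_bounded \<Omega> \<kappa>"
    and u: "u \<in> H1_fields \<Omega>" and w: "w \<in> H1_fields \<Omega>"
  shows "elasticity_form \<Omega> \<mu> \<kappa> (cscale c u) w = c * elasticity_form \<Omega> \<mu> \<kappa> u w"
proof -
  have cu: "cscale c u \<in> H1_fields \<Omega>" by (intro H1_fields_scale u)
  have s: "weighted_inner \<Omega> \<mu> (strain \<Omega> (cscale c u) i j) (strain \<Omega> w i j) =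
      c * weighted_inner \<Omega> \<mu> (strain \<Omega> u i j) (strain \<Omega> w i j)" for i j
    unfolding weighted_inner_scale[symmetric]
    by (rule weighted_inner_cong_AE[OF \<mu>]) (intro strain_L2 L2_scale strain_scale \<Omega> u w cu)+
  have "weighted_inner \<Omega> \<kappa> (divergence \<Omega> (cscale c u)) (divergence \<Omega> w) =
      c * weighted_inner \<Omega> \<kappa> (divergence \<Omega> u) (divergence \<Omega> w)"
    unfolding weighted_inner_scale[symmetric]
    by (rule weighted_inner_cong_AE[OF \<kappa>]) (intro divergence_L2 L2_scale divergence_scale \<Omega> u w cu)+
  then show ?thesis
    by (simp add: elasticity_form_eq_weighted \<mu> u w cu s sum_distrib_left algebra_simps)
qed

lemma elasticity_form_cnj:
  assumes "essentially_bounded \<Omega> \<mu>" "u \<in> H1_fields \<Omega>" "w \<in> H1_fields \<Omega>"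
  shows "elasticity_form \<Omega> \<mu> \<kappa> w u = cnj (elasticity_form \<Omega> \<mu> \<kappa> u w)"
  unfolding elasticity_form_eq_weighted[OF assms] elasticity_form_eq_weighted[OF assms(1,3,2)]
    complex_cnj_add complex_cnj_mult cnj_sum complex_cnj_numeral
  by (intro arg_cong2[where f = "(+)"] arg_cong2[where f = "(*)"] sum.cong refl weighted_inner_cnj)

section \<open>Definiteness of the mass form\<close>

lemma l2_inner_self:
  assumes v: "v \<in> H1_fields \<Omega>"
  shows "integrable (lebesgue_on \<Omega>) (\<lambda>x. \<Sum>i\<in>UNIV. (cmod (v x $ i))\<^sup>2)"
    and "Re (l2_inner \<Omega> v v) = (LINT x|lebesgue_on \<Omega>. (\<Sum>i\<in>UNIV. (cmod (v x $ i))\<^sup>2))"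
proof -
  show "integrable (lebesgue_on \<Omega>) (\<lambda>x. \<Sum>i\<in>UNIV. (cmod (v x $ i))\<^sup>2)"
    using H1_fieldsD(2)[OF v] by (intro Bochner_Integration.integrable_sum) (simp add: L2_def)
  have "l2_inner \<Omega> v v = (LINT x|lebesgue_on \<Omega>. of_real (\<Sum>i\<in>UNIV. (cmod (v x $ i))\<^sup>2))"
    unfolding l2_inner_def of_real_sum by (simp only: complex_norm_square)
  then show "Re (l2_inner \<Omega> v v) = (LINT x|lebesgue_on \<Omega>. (\<Sum>i\<in>UNIV. (cmod (v x $ i))\<^sup>2))"
    by (simp only: integral_complex_of_real Re_complex_of_real)
qed

text \<open>A continuous field that vanishes on the domain vanishes on its closure, and by the
  extension by zero everywhere. A nonzero field is therefore nonzero on a nonempty open subset of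
  the domain, which is not a null set.\<close>

lemma l2_inner_positive:
  assumes v: "v \<in> H1_fields \<Omega>" and \<Omega>: "open \<Omega>"
    and cont: "continuous_on (closure \<Omega>) v" and ext: "\<And>x. x \<notin> closure \<Omega> \<Longrightarrow> v x = 0"
    and nz: "v \<noteq> 0"
  shows "Re (l2_inner \<Omega> v v) > 0"
proof -
  have "\<exists>x\<in>\<Omega>. v x \<noteq> 0"
  proof (rule ccontr)
    assume "\<not> (\<exists>x\<in>\<Omega>. v x \<noteq> 0)"
    then have "v x = 0" if "x \<in> closure \<Omega>" for x
      using continuous_constant_on_closure[OF cont, of 0] that by auto
    then have "v = 0" using ext by (auto simp: fun_eq_iff)
    then show False using nz by simp
  qed
  then obtain x0 where x0: "x0 \<in> \<Omega>" "v x0 \<noteq> 0" by auto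
  define A where "A = \<Omega> \<inter> v -` (- {0})"
  have "continuous_on \<Omega> v" using cont closure_subset continuous_on_subset by blast
  then have "open A" unfolding A_def using \<Omega> by (intro continuous_open_preimage) auto
  moreover have "A \<noteq> {}" using x0 by (auto simp: A_def)
  ultimately have A: "\<not> negligible A" by (rule open_not_negligible)
  let ?f = "\<lambda>x. \<Sum>i\<in>UNIV. (cmod (v x $ i))\<^sup>2"
  have "(LINT x|lebesgue_on \<Omega>. ?f x) \<noteq> 0"
  proof
    assume "(LINT x|lebesgue_on \<Omega>. ?f x) = 0"
    then have "AE x in lebesgue_on \<Omega>. ?f x = 0"
      by (subst (asm) integral_nonneg_eq_0_iff_AE) (auto simp: l2_inner_self[OF v] sum_nonneg)
    then have "AE x in lebesgue. x \<in> \<Omega> \<longrightarrow> ?f x = 0"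
      using \<Omega> by (simp add: AE_restrict_space_iff)
    then have "AE x in lebesgue. x \<notin> A"
      by eventually_elim (auto simp: A_def sum_nonneg_eq_0_iff vec_eq_iff)
    then have "A \<in> null_sets lebesgue"
      using \<open>open A\<close> by (simp add: AE_iff_null_sets)
    then show False using A by (simp add: negligible_iff_null_sets)
  qed
  moreover have "(LINT x|lebesgue_on \<Omega>. ?f x) \<ge> 0"
    by (rule Bochner_Integration.integral_nonneg) (simp add: sum_nonneg)
  ultimately show ?thesis unfolding l2_inner_self(2)[OF v] by simp
qed

lemma l2_norm_le_h1_norm:
  assumes "Re (l2_inner \<Omega> v v) \<ge> 0"
  shows "Re (l2_inner \<Omega> v v) \<le> (h1_norm \<Omega> v)\<^sup>2"
proof -
  have "(\<Sum>i\<in>UNIV. \<Sum>k\<in>UNIV. LINT x|lebesgue_on \<Omega>. (cmod (weak_partial \<Omega> k (\<lambda>x. v x $ i) x))\<^sup>2) \<ge> 0"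
    by (intro sum_nonneg Bochner_Integration.integral_nonneg) simp
  then show ?thesis using assms by (simp add: h1_norm_def l2_norm_def)
qed

section \<open>Linear structure of the finite element space\<close>

lemma polynomial_on_add:
  assumes "polynomial_on p T u" "polynomial_on p T w"
  shows "polynomial_on p T (\<lambda>x. u x + w x)"
proof -
  obtain c d where
    "\<forall>x\<in>T. u x = (\<Sum>e | (\<Sum>i\<in>UNIV. e i) \<le> p. c e * of_real (\<Prod>i\<in>UNIV. (x $ i) ^ e i))"
    "\<forall>x\<in>T. w x = (\<Sum>e | (\<Sum>i\<in>UNIV. e i) \<le> p. d e * of_real (\<Prod>i\<in>UNIV. (x $ i) ^ e i))"
    using assms unfolding polynomial_on_def by blast
  then show ?thesis
    unfolding polynomial_on_def
    by (intro exI[of _ "\<lambda>e. c e + d e"]) (simp add: distrib_right sum.distrib)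
qed

lemma polynomial_on_scale:
  assumes "polynomial_on p T u"
  shows "polynomial_on p T (\<lambda>x. k * u x)"
proof -
  obtain c where
    "\<forall>x\<in>T. u x = (\<Sum>e | (\<Sum>i\<in>UNIV. e i) \<le> p. c e * of_real (\<Prod>i\<in>UNIV. (x $ i) ^ e i))"
    using assms unfolding polynomial_on_def by blast
  then show ?thesis
    unfolding polynomial_on_def
    by (intro exI[of _ "\<lambda>e. k * c e"]) (simp add: sum_distrib_left mult.assoc)
qed

lemma polynomial_on_zero: "polynomial_on p T (\<lambda>x. 0)"
  unfolding polynomial_on_def by (intro exI[of _ "\<lambda>e. 0"]) simp

lemma fe_space_subset_H1: "fe_space \<Omega> \<Gamma>D \<T> p \<subseteq> H1_fields \<Omega>"
  by (auto simp: fe_space_def H1_fields_def)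

lemma subspace_fe_space:
  assumes \<Omega>: "open \<Omega>" "bounded \<Omega>"
  shows "cfield.subspace (fe_space \<Omega> \<Gamma>D \<T> p)"
proof (rule cfield.subspaceI)
  show "0 \<in> fe_space \<Omega> \<Gamma>D \<T> p"
    by (simp add: fe_space_def H1_zero polynomial_on_zero zero_fun_def)
  show "u + v \<in> fe_space \<Omega> \<Gamma>D \<T> p" if "u \<in> fe_space \<Omega> \<Gamma>D \<T> p" "v \<in> fe_space \<Omega> \<Gamma>D \<T> p" for u v
    using that unfolding fe_space_def plus_fun_def
    by (auto intro!: continuous_intros H1_add \<Omega> polynomial_on_add)
  show "cscale c v \<in> fe_space \<Omega> \<Gamma>D \<T> p" if "v \<in> fe_space \<Omega> \<Gamma>D \<T> p" for c v
  proof -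
    have "continuous_on (closure \<Omega>) (\<lambda>x. c *s v x)"
      using that unfolding fe_space_def vector_scalar_mult_def
      by (auto intro!: continuous_intros)
    then show ?thesis
      using that unfolding fe_space_def cscale_def
      by (auto intro!: H1_scale polynomial_on_scale)
  qed
qed


section \<open>The component decomposition\<close>

lemma subdomain_open:
  assumes "open \<Omega>" "subdomain_partition \<Omega> \<T> n \<Omega>s" "i \<in> {1..n}"
  shows "open (\<Omega>s i)" "\<Omega>s i \<subseteq> \<Omega>"
proof -
  obtain S where "\<Omega>s i = \<Omega> \<inter> interior (\<Union>S)"
    using assms(2,3) unfolding subdomain_partition_def by blast
  then show "open (\<Omega>s i)" "\<Omega>s i \<subseteq> \<Omega>" using assms(1) by auto
qed

text \<open>A point missed by all subdomains lies in the closure of one of them, hence in one of its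
  finitely many closed elements, but not in the interior of that element. The exceptional points are
  thus on element boundaries, which are null sets.\<close>

lemma subdomains_cover_AE:
  assumes \<Omega>: "open \<Omega>" and sd: "subdivision \<Omega> \<T>" and sp: "subdomain_partition \<Omega> \<T> n \<Omega>s"
  shows "AE x in lebesgue_on \<Omega>. \<exists>i\<in>{1..n}. x \<in> \<Omega>s i"
proof -
  have fin: "finite \<T>" and T: "\<And>T. T \<in> \<T> \<Longrightarrow> compact T" "\<And>T. T \<in> \<T> \<Longrightarrow> negligible (frontier T)"
    using sd by (auto simp: subdivision_def)
  have "x \<in> (\<Union>T\<in>\<T>. frontier T)" if x: "x \<in> \<Omega>" "\<not> (\<exists>i\<in>{1..n}. x \<in> \<Omega>s i)" for x
  proof -
    have "x \<in> (\<Union>i\<in>{1..n}. closure (\<Omega>s i))"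
      using sp x(1) closure_subset[of \<Omega>] by (auto simp: subdomain_partition_def)
    then obtain i where i: "i \<in> {1..n}" "x \<in> closure (\<Omega>s i)" by auto
    obtain S where S: "S \<subseteq> \<T>" "\<Omega>s i = \<Omega> \<inter> interior (\<Union>S)"
      using sp i(1) unfolding subdomain_partition_def by blast
    have "closed (\<Union>S)"
      using S(1) fin T(1) by (intro closed_Union) (auto intro: finite_subset compact_imp_closed)
    moreover have "\<Omega>s i \<subseteq> \<Union>S" using S(2) interior_subset by blast
    ultimately have "x \<in> \<Union>S" using i(2) closure_minimal by blast
    then obtain T where "T \<in> S" "x \<in> T" by auto
    moreover have "x \<notin> interior (\<Union>S)" using x i(1) S(2) by auto
    ultimately have "x \<notin> interior T" using interior_mono[of T "\<Union>S"] by auto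
    then show ?thesis
      using \<open>T \<in> S\<close> \<open>x \<in> T\<close> S(1) closure_subset[of T] by (auto simp: frontier_def)
  qed
  moreover have "negligible (\<Union>T\<in>\<T>. frontier T)"
    using fin T(2) by (intro negligible_Union) auto
  ultimately have "AE x in lebesgue. x \<in> \<Omega> \<longrightarrow> (\<exists>i\<in>{1..n}. x \<in> \<Omega>s i)"
    unfolding negligible_iff_null_sets by (intro AE_I') auto
  then show ?thesis using \<Omega> by (simp add: AE_restrict_space_iff)
qed

lemma strain_divergence_local:
  assumes \<Omega>: "open \<Omega>" "bounded \<Omega>" and v: "v \<in> H1_fields \<Omega>"
    and O': "open O'" "O' \<subseteq> \<Omega>" and zero: "\<And>x. x \<in> O' \<Longrightarrow> v x = 0"
  shows "AE x in lebesgue_on \<Omega>. x \<in> O' \<longrightarrow> (\<forall>i j. strain \<Omega> v i j x = 0) \<and> divergence \<Omega> v x = 0"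
proof -
  have "AE x in lebesgue_on \<Omega>. \<forall>i\<in>UNIV. \<forall>k\<in>UNIV. x \<in> O' \<longrightarrow> weak_partial \<Omega> k (\<lambda>x. v x $ i) x = 0"
    by (intro AE_finite_allI weak_partial_local H1_fieldsD \<Omega> v O') (auto simp: zero)
  then show ?thesis by eventually_elim (auto simp: strain_def divergence_def)
qed

text \<open>On each open subdomain one field vanishes, hence so do its weak derivatives almost
  everywhere. The interfaces, where no such localization is available, are absorbed by the null set
  outside the cover.\<close>

lemma elasticity_form_disjoint:
  assumes \<Omega>: "open \<Omega>" "bounded \<Omega>" and \<mu>: "essentially_bounded \<Omega> \<mu>"
    and v: "v \<in> H1_fields \<Omega>" and w: "w \<in> H1_fields \<Omega>"
    and I: "finite I" "\<And>l. l \<in> I \<Longrightarrow> open (\<Omega>s l)" "\<And>l. l \<in> I \<Longrightarrow> \<Omega>s l \<subseteq> \<Omega>"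
    and cover: "AE x in lebesgue_on \<Omega>. \<exists>l\<in>I. x \<in> \<Omega>s l"
    and zero: "\<And>l. l \<in> I \<Longrightarrow> (\<forall>x\<in>\<Omega>s l. v x = 0) \<or> (\<forall>x\<in>\<Omega>s l. w x = 0)"
  shows "elasticity_form \<Omega> \<mu> \<kappa> v w = 0"
proof -
  let ?P = "\<lambda>x. (\<forall>i j. strain \<Omega> v i j x = 0 \<or> strain \<Omega> w i j x = 0) \<and>
    (divergence \<Omega> v x = 0 \<or> divergence \<Omega> w x = 0)"
  have "AE x in lebesgue_on \<Omega>. x \<in> \<Omega>s l \<longrightarrow> ?P x" if l: "l \<in> I" for l
    using zero[OF l]
  proof
    assume "\<forall>x\<in>\<Omega>s l. v x = 0"
    then have "AE x in lebesgue_on \<Omega>. x \<in> \<Omega>s l \<longrightarrow>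
        (\<forall>i j. strain \<Omega> v i j x = 0) \<and> divergence \<Omega> v x = 0"
      by (intro strain_divergence_local \<Omega> v I l) auto
    then show ?thesis by eventually_elim auto
  next
    assume "\<forall>x\<in>\<Omega>s l. w x = 0"
    then have "AE x in lebesgue_on \<Omega>. x \<in> \<Omega>s l \<longrightarrow>
        (\<forall>i j. strain \<Omega> w i j x = 0) \<and> divergence \<Omega> w x = 0"
      by (intro strain_divergence_local \<Omega> w I l) auto
    then show ?thesis by eventually_elim auto
  qed
  then have "AE x in lebesgue_on \<Omega>. \<forall>l\<in>I. x \<in> \<Omega>s l \<longrightarrow> ?P x"
    by (intro AE_finite_allI I)
  then have P: "AE x in lebesgue_on \<Omega>. ?P x"
    using cover by eventually_elim auto
  have "weighted_inner \<Omega> \<mu> (strain \<Omega> v i j) (strain \<Omega> w i j) = 0" for i j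
    by (rule weighted_inner_eq_0_AE) (use P in \<open>eventually_elim, auto\<close>)
  moreover have "weighted_inner \<Omega> \<kappa> (divergence \<Omega> v) (divergence \<Omega> w) = 0"
    by (rule weighted_inner_eq_0_AE) (use P in \<open>eventually_elim, auto\<close>)
  ultimately show ?thesis by (simp add: elasticity_form_eq_weighted[OF \<mu> v w])
qed

lemma l2_inner_disjoint:
  assumes "\<And>x. x \<in> \<Omega> \<Longrightarrow> v x = 0 \<or> w x = 0"
  shows "l2_inner \<Omega> v w = 0"
proof -
  have "l2_inner \<Omega> v w = (LINT x|lebesgue_on \<Omega>. 0)"
    unfolding l2_inner_def
  proof (rule Bochner_Integration.integral_cong[OF refl])
    fix x assume "x \<in> space (lebesgue_on \<Omega>)"
    then show "(\<Sum>i\<in>UNIV. v x $ i * cnj (w x $ i)) = 0" using assms[of x] by auto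
  qed
  then show ?thesis by simp
qed

lemma local_space_vanishes:
  assumes sp: "subdomain_partition \<Omega> \<T> n \<Omega>s" and \<Omega>: "open \<Omega>"
    and v: "v \<in> local_space \<Omega> V (\<Omega>s i)" and ij: "i \<in> {1..n}" "j \<in> {1..n}" "i \<noteq> j" and x: "x \<in> \<Omega>s j"
  shows "v x = 0"
proof -
  have "\<Omega>s i \<inter> \<Omega>s j = {}" using sp ij by (auto simp: subdomain_partition_def disjoint_family_on_def)
  moreover have "\<Omega>s j \<subseteq> \<Omega>" using subdomain_open[OF \<Omega> sp] ij by auto
  ultimately have "x \<in> \<Omega> - \<Omega>s i" using x by auto
  then show ?thesis using v by (simp add: local_space_def)
qed

section \<open>The mass and elasticity forms as positive forms\<close>

lemma positive_form_cscaleI: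
  assumes "cfield.subspace X"
    and "\<And>u v w. u \<in> X \<Longrightarrow> v \<in> X \<Longrightarrow> w \<in> X \<Longrightarrow> h (u + v) w = h u w + h v w"
    and "\<And>u w c. u \<in> X \<Longrightarrow> w \<in> X \<Longrightarrow> h (cscale c u) w = c * h u w"
    and "\<And>u v. u \<in> X \<Longrightarrow> v \<in> X \<Longrightarrow> h v u = cnj (h u v)"
    and "\<And>u. u \<in> X \<Longrightarrow> u \<noteq> 0 \<Longrightarrow> Re (h u u) > 0"
  shows "positive_form cscale X h"
  by (intro positive_form.intro complex_vector_space.intro positive_form_axioms.intro
      cfield.vector_space_axioms assms)

lemma positive_form_l2_inner:
  assumes "open \<Omega>" "bounded \<Omega>"
  shows "positive_form cscale (fe_space \<Omega> \<Gamma>D \<T> p) (l2_inner \<Omega>)"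
proof (rule positive_form_cscaleI)
  note H1 = subsetD[OF fe_space_subset_H1]
  show "cfield.subspace (fe_space \<Omega> \<Gamma>D \<T> p)" by (rule subspace_fe_space[OF assms])
  show "l2_inner \<Omega> (u + v) w = l2_inner \<Omega> u w + l2_inner \<Omega> v w"
    if "u \<in> fe_space \<Omega> \<Gamma>D \<T> p" "v \<in> fe_space \<Omega> \<Gamma>D \<T> p" "w \<in> fe_space \<Omega> \<Gamma>D \<T> p" for u v w
    using that by (intro l2_inner_add assms H1)
  show "l2_inner \<Omega> (cscale c u) w = c * l2_inner \<Omega> u w"
    if "u \<in> fe_space \<Omega> \<Gamma>D \<T> p" "w \<in> fe_space \<Omega> \<Gamma>D \<T> p" for u w c
    using that by (intro l2_inner_scale H1)
  show "l2_inner \<Omega> v u = cnj (l2_inner \<Omega> u v)"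
    if "u \<in> fe_space \<Omega> \<Gamma>D \<T> p" "v \<in> fe_space \<Omega> \<Gamma>D \<T> p" for u v
    using that by (intro l2_inner_cnj H1)
  show "Re (l2_inner \<Omega> u u) > 0" if "u \<in> fe_space \<Omega> \<Gamma>D \<T> p" "u \<noteq> 0" for u
    using that H1[OF that(1)] by (intro l2_inner_positive assms) (auto simp: fe_space_def)
qed

text \<open>Definiteness is inherited through coercivity: the energy dominates a multiple of the
  squared H1 norm, which is at least the squared L2 norm, and that is positive for nonzero
  fields.\<close>

lemma positive_form_elasticity_form:
  assumes \<Omega>: "open \<Omega>" "bounded \<Omega>" and \<mu>: "essentially_bounded \<Omega> \<mu>" and \<kappa>: "essentially_bounded \<Omega> \<kappa>"
    and coercive: "coercive_form \<Omega> (fe_space \<Omega> \<Gamma>D \<T> p) (elasticity_form \<Omega> \<mu> \<kappa>)"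
  shows "positive_form cscale (fe_space \<Omega> \<Gamma>D \<T> p) (elasticity_form \<Omega> \<mu> \<kappa>)"
proof (rule positive_form_cscaleI)
  note H1 = subsetD[OF fe_space_subset_H1]
  interpret m: positive_form cscale "fe_space \<Omega> \<Gamma>D \<T> p" "l2_inner \<Omega>"
    by (rule positive_form_l2_inner[OF \<Omega>])
  show "cfield.subspace (fe_space \<Omega> \<Gamma>D \<T> p)" by (rule subspace_fe_space[OF \<Omega>])
  show "elasticity_form \<Omega> \<mu> \<kappa> (u + v) w = elasticity_form \<Omega> \<mu> \<kappa> u w + elasticity_form \<Omega> \<mu> \<kappa> v w"
    if "u \<in> fe_space \<Omega> \<Gamma>D \<T> p" "v \<in> fe_space \<Omega> \<Gamma>D \<T> p" "w \<in> fe_space \<Omega> \<Gamma>D \<T> p" for u v w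
    using that by (intro elasticity_form_add \<Omega> \<mu> \<kappa> H1)
  show "elasticity_form \<Omega> \<mu> \<kappa> (cscale c u) w = c * elasticity_form \<Omega> \<mu> \<kappa> u w"
    if "u \<in> fe_space \<Omega> \<Gamma>D \<T> p" "w \<in> fe_space \<Omega> \<Gamma>D \<T> p" for u w c
    using that by (intro elasticity_form_scale \<Omega> \<mu> \<kappa> H1)
  show "elasticity_form \<Omega> \<mu> \<kappa> v u = cnj (elasticity_form \<Omega> \<mu> \<kappa> u v)"
    if "u \<in> fe_space \<Omega> \<Gamma>D \<T> p" "v \<in> fe_space \<Omega> \<Gamma>D \<T> p" for u v
    using that by (intro elasticity_form_cnj \<mu> H1)
  show "Re (elasticity_form \<Omega> \<mu> \<kappa> u u) > 0" if u: "u \<in> fe_space \<Omega> \<Gamma>D \<T> p" "u \<noteq> 0" for u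
  proof -
    obtain c where c: "c > 0" "c * (h1_norm \<Omega> u)\<^sup>2 \<le> Re (elasticity_form \<Omega> \<mu> \<kappa> u u)"
      using coercive u(1) by (auto simp: coercive_form_def)
    have "0 < Re (l2_inner \<Omega> u u)" using m.positive[OF u] .
    also have "\<dots> \<le> (h1_norm \<Omega> u)\<^sup>2" using m.self_nonneg[OF u(1)] by (rule l2_norm_le_h1_norm)
    finally have "0 < c * (h1_norm \<Omega> u)\<^sup>2" using c(1) by simp
    then show ?thesis using c(2) by linarith
  qed
qed

text \<open>The inner product is linear in its first argument, so expanding it produces the
  transposed Gram matrix. Real basis fields make the Gram matrix symmetric, and the two expressions
  agree.\<close>

lemma mass_matrix_hermitian_product:
  assumes pf: "positive_form cscale X (l2_inner \<Omega>)"
    and \<phi>: "\<And>j. j \<in> {1..k} \<Longrightarrow> \<phi> j \<in> X" "\<And>j. j \<in> {1..k} \<Longrightarrow> real_valued (\<phi> j)"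
  shows "hermitian_product k (mass_matrix \<Omega> \<phi>) r =
    l2_inner \<Omega> (\<Sum>j\<in>{1..k}. cscale (r j) (\<phi> j)) (\<Sum>j\<in>{1..k}. cscale (r j) (\<phi> j))"
proof -
  interpret m: positive_form cscale X "l2_inner \<Omega>" by (rule pf)
  have sym: "l2_inner \<Omega> (\<phi> j) (\<phi> l) = l2_inner \<Omega> (\<phi> l) (\<phi> j)" if "j \<in> {1..k}" "l \<in> {1..k}" for j l
  proof -
    have "cnj (\<phi> l x $ i) = \<phi> l x $ i" "cnj (\<phi> j x $ i) = \<phi> j x $ i" for x i
      using \<phi>(2) that by (auto simp: real_valued_def Reals_cnj_iff)
    then show ?thesis unfolding l2_inner_def by (simp add: mult.commute)
  qed
  have X: "cscale (r j) (\<phi> j) \<in> X" if "j \<in> {1..k}" for j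
    using \<phi>(1)[OF that] by (intro m.X_intros)
  have sX: "(\<Sum>j\<in>{1..k}. cscale (r j) (\<phi> j)) \<in> X" using X by (rule m.X_intros)
  have "l2_inner \<Omega> (\<Sum>j\<in>{1..k}. cscale (r j) (\<phi> j)) (\<Sum>j\<in>{1..k}. cscale (r j) (\<phi> j)) =
      (\<Sum>l\<in>{1..k}. l2_inner \<Omega> (cscale (r l) (\<phi> l)) (\<Sum>j\<in>{1..k}. cscale (r j) (\<phi> j)))"
    using X sX by (intro m.sum_left) auto
  also have "\<dots> = (\<Sum>l\<in>{1..k}. \<Sum>j\<in>{1..k}. l2_inner \<Omega> (cscale (r l) (\<phi> l)) (cscale (r j) (\<phi> j)))"
    using X by (intro sum.cong m.sum_right) auto
  also have "\<dots> = (\<Sum>l\<in>{1..k}. \<Sum>j\<in>{1..k}. cnj (r j) * l2_inner \<Omega> (\<phi> j) (\<phi> l) * r l)"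
  proof (intro sum.cong refl)
    fix l j assume lj: "l \<in> {1..k}" "j \<in> {1..k}"
    show "l2_inner \<Omega> (cscale (r l) (\<phi> l)) (cscale (r j) (\<phi> j)) = cnj (r j) * l2_inner \<Omega> (\<phi> j) (\<phi> l) * r l"
      using \<phi>(1)[OF lj(1)] \<phi>(1)[OF lj(2)] X[OF lj(2)]
      by (simp add: m.scale_left m.scale_right sym[OF lj])
  qed
  also have "\<dots> = (\<Sum>j\<in>{1..k}. \<Sum>l\<in>{1..k}. cnj (r j) * l2_inner \<Omega> (\<phi> j) (\<phi> l) * r l)"
    by (rule sum.swap)
  finally show ?thesis by (simp add: hermitian_product_def mass_matrix_def)
qed

lemma subspace_residual_eqI:
  assumes "r \<in> Vi" and "\<And>v. v \<in> Vi \<Longrightarrow> l2_inner \<Omega> r v =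
      b v - a w v - \<i> * of_real \<omega> * damping_form \<Omega> a \<alpha> \<beta> w v + (of_real \<omega>)\<^sup>2 * l2_inner \<Omega> w v"
    and "\<And>r'. r' \<in> Vi \<Longrightarrow> (\<And>v. v \<in> Vi \<Longrightarrow> l2_inner \<Omega> r' v = l2_inner \<Omega> r v) \<Longrightarrow> r' = r"
  shows "subspace_residual \<Omega> a \<alpha> \<beta> \<omega> b Vi w = r"
  unfolding subspace_residual_def
proof (rule the_equality)
  fix r'
  assume r': "r' \<in> Vi \<and> (\<forall>v\<in>Vi. l2_inner \<Omega> r' v =
      b v - a w v - \<i> * of_real \<omega> * damping_form \<Omega> a \<alpha> \<beta> w v + (of_real \<omega>)\<^sup>2 * l2_inner \<Omega> w v)"
  show "r' = r"
  proof (rule assms(3))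
    show "l2_inner \<Omega> r' v = l2_inner \<Omega> r v" if "v \<in> Vi" for v
      using r' assms(2)[OF that] that by simp
  qed (use r' in simp)
qed (use assms(1,2) in simp)

lemma local_vectors_in_reduced_space:
  assumes "i \<in> {0..n}" "j \<in> {1..m i}"
  shows "Z i j \<in> reduced_space n Z m"
proof -
  define v where "v l = (if l = i then Z i j else 0)" for l
  have "Z i j = (\<Sum>l\<in>{0..n}. v l)" using assms by (simp add: v_def)
  moreover have "\<forall>l\<in>{0..n}. v l \<in> cfield.span (Z l ` {1..m l})"
    using assms by (auto simp: v_def cfield.span_base cfield.span_zero)
  ultimately show ?thesis unfolding reduced_space_def by blast
qed

text \<open>The list repeats each number as often as the dimension of its eigenspace, so a nonzero
  eigenvector forces at least one occurrence.\<close>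

lemma eigenvalue_list_complete:
  assumes list: "eigenvalue_list \<Omega> a V N lam" and fin: "finite B" "V \<subseteq> cfield.span B"
    and z: "z \<in> eigenspace \<Omega> a V l" "z \<noteq> 0"
  obtains j where "j \<in> {1..N}" "lam j = l"
proof -
  have "cfield.dim (eigenspace \<Omega> a V l) \<noteq> 0"
  proof
    assume 0: "cfield.dim (eigenspace \<Omega> a V l) = 0"
    obtain C where C: "C \<subseteq> eigenspace \<Omega> a V l" "cfield.independent C"
        "eigenspace \<Omega> a V l \<subseteq> cfield.span C" "card C = cfield.dim (eigenspace \<Omega> a V l)"
      using cfield.basis_exists by metis
    have "C \<subseteq> cfield.span B" using C(1) fin(2) by (auto simp: eigenspace_def)
    \<comment> \<open>An infinite basis would also have cardinality 0; the finite spanning set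
      excludes it, so dimension 0 really means the zero space.\<close>
    then have "finite C" using cfield.independent_span_bound[OF fin(1) C(2)] by simp
    then have "C = {}" using C(4) 0 by simp
    then show False using C(3) z by auto
  qed
  then have "{j \<in> {1..N}. lam j = l} \<noteq> {}"
    using list by (metis card.empty eigenvalue_list_def)
  then show thesis using that by auto
qed

text \<open>Such a field is the energy extension of its own trace on the interface.\<close>

lemma interface_spaceI:
  assumes "w \<in> V" and "\<And>i u. i \<in> {1..n} \<Longrightarrow> u \<in> local_space \<Omega> V (\<Omega>s i) \<Longrightarrow> a w u = 0"
  shows "w \<in> interface_space \<Omega> V a n \<Omega>s"
  unfolding interface_space_def energy_extension_def trace_space_def using assms by auto

text \<open>Subtract from \<open>v\<close> its energy projections onto the local spaces. As these
  spaces are mutually energy-orthogonal, the remainder is orthogonal to all of them and therefore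
  belongs to the interface space.\<close>

lemma component_decomposition:
  assumes \<Omega>: "open \<Omega>" and sp: "subdomain_partition \<Omega> \<T> n \<Omega>s"
    and fp: "form_pair cscale V (l2_inner \<Omega>) a"
    and eig: "\<And>i. i \<in> {1..n} \<Longrightarrow> form_pair.eigenbasis cscale V (l2_inner \<Omega>) a (Eb i)"
    and span: "\<And>i. i \<in> {1..n} \<Longrightarrow> cfield.span (Eb i) = local_space \<Omega> V (\<Omega>s i)"
    and orth: "\<And>i j u w. i \<in> {1..n} \<Longrightarrow> j \<in> {1..n} \<Longrightarrow> i \<noteq> j \<Longrightarrow>
        u \<in> local_space \<Omega> V (\<Omega>s i) \<Longrightarrow> w \<in> local_space \<Omega> V (\<Omega>s j) \<Longrightarrow> a u w = 0"
    and v: "v \<in> V"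
  shows "\<exists>w. (\<forall>i\<in>{0..n}. w i \<in> component_space \<Omega> V a n \<Omega>s i) \<and> v = (\<Sum>i\<in>{0..n}. w i)"
proof -
  interpret FP: form_pair cscale V "l2_inner \<Omega>" a by (rule fp)
  have "\<exists>w. w \<in> local_space \<Omega> V (\<Omega>s i) \<and> (\<forall>u\<in>local_space \<Omega> V (\<Omega>s i). a w u = a v u)"
    if i: "i \<in> {1..n}" for i
    using FP.energy_projection[OF eig[OF i] v] unfolding span[OF i] by metis
  then obtain w where w: "\<And>i. i \<in> {1..n} \<Longrightarrow> w i \<in> local_space \<Omega> V (\<Omega>s i)"
    and w_eq: "\<And>i u. i \<in> {1..n} \<Longrightarrow> u \<in> local_space \<Omega> V (\<Omega>s i) \<Longrightarrow> a (w i) u = a v u"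
    by metis
  have wV: "w i \<in> V" if "i \<in> {1..n}" for i using w[OF that] by (simp add: local_space_def)
  define w0 where "w0 = v - (\<Sum>i\<in>{1..n}. w i)"
  have sV: "(\<Sum>i\<in>{1..n}. w i) \<in> V" using wV by (rule FP.mass.X_intros)
  have "w0 \<in> interface_space \<Omega> V a n \<Omega>s"
  proof (rule interface_spaceI)
    show "w0 \<in> V" unfolding w0_def by (intro FP.mass.X_intros v sV)
    show "a w0 u = 0" if i: "i \<in> {1..n}" and u: "u \<in> local_space \<Omega> V (\<Omega>s i)" for i u
    proof -
      have uV: "u \<in> V" using u by (simp add: local_space_def)
      have "a (\<Sum>j\<in>{1..n}. w j) u = (\<Sum>j\<in>{1..n}. a (w j) u)"
        using wV uV by (intro FP.energy.sum_left) auto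
      also have "\<dots> = (\<Sum>j\<in>{1..n}. if j = i then a v u else 0)"
        using orth w u i w_eq by (intro sum.cong refl) auto
      finally show ?thesis
        unfolding w0_def using i FP.energy.diff_left[OF v sV uV] by simp
    qed
  qed
  then have "\<forall>i\<in>{0..n}. (if i = 0 then w0 else w i) \<in> component_space \<Omega> V a n \<Omega>s i"
    using w by (auto simp: component_space_def)
  moreover have "v = (\<Sum>i\<in>{0..n}. if i = 0 then w0 else w i)"
    by (simp add: w0_def sum.atLeast_Suc_atMost)
  ultimately show ?thesis by (intro exI conjI)
qed

section \<open>The error estimate for the reduced elasticity problem\<close>

theorem theorem1:
  fixes \<Omega> \<Gamma>D \<Gamma>N :: "(real ^ 'd::finite) set"
    and \<T> :: "(real ^ 'd) set set"
    and p n N :: nat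
    and \<mu> \<kappa> :: "real ^ 'd \<Rightarrow> real"
    and f g U Um :: "'d cfield"
    and \<alpha> \<beta> \<omega> :: real
    and \<Omega>s :: "nat \<Rightarrow> (real ^ 'd) set"
    and Vh :: "'d cfield set"
    and V :: "nat \<Rightarrow> 'd cfield set"
    and a :: "'d cfield \<Rightarrow> 'd cfield \<Rightarrow> complex"
    and b :: "'d cfield \<Rightarrow> complex"
    and lam c :: "nat \<Rightarrow> real"
    and k m :: "nat \<Rightarrow> nat"
    and \<Lambda> :: "nat \<Rightarrow> nat \<Rightarrow> real"
    and Z :: "nat \<Rightarrow> nat \<Rightarrow> 'd cfield"
    and R :: "nat \<Rightarrow> 'd cfield"
    and I1 I2 S :: real
  assumes "CARD('d) = 2 \<or> CARD('d) = 3"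
    and "bounded_domain \<Omega>"
    and "\<Gamma>D \<union> \<Gamma>N = frontier \<Omega>" and "\<Gamma>D \<inter> \<Gamma>N = {}"
    and "subdivision \<Omega> \<T>"
    and "Vh = fe_space \<Omega> \<Gamma>D \<T> p"
    and "essentially_bounded \<Omega> \<mu>" and "essentially_bounded \<Omega> \<kappa>"
    and "a = elasticity_form \<Omega> \<mu> \<kappa>"
    and "bounded_form \<Omega> Vh a" and "coercive_form \<Omega> Vh a"
    and "b = load \<Omega> \<Gamma>N f g" and "bounded_load \<Omega> \<Gamma>N f g Vh"
    and "\<alpha> \<ge> 0" and "\<beta> \<ge> 0"
    and "eigenvalue_list \<Omega> a Vh N lam"
    and "subdomain_partition \<Omega> \<T> n \<Omega>s"
    and "V = component_space \<Omega> Vh a n \<Omega>s"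
    and "\<forall>i\<in>{0..n}. k i = cfield.dim (V i)"
    and "\<forall>i\<in>{0..n}. ordered_eigenbasis \<Omega> a (V i) (\<Lambda> i) (Z i)"
    and "\<forall>i\<in>{0..n}. 1 \<le> m i \<and> m i < k i"
    and "\<forall>j\<in>{1..N}. c j = \<alpha> * lam j + \<beta>"
    and "\<forall>j\<in>{1..N}. (lam j - \<omega>\<^sup>2)\<^sup>2 + \<omega>\<^sup>2 * (c j)\<^sup>2 \<noteq> 0"
    and "U \<in> Vh" and "\<forall>v\<in>Vh. dynamic_form \<Omega> a \<alpha> \<beta> \<omega> U v = b v"
    and "Um \<in> reduced_space n Z m"
    and "\<forall>v\<in>reduced_space n Z m. dynamic_form \<Omega> a \<alpha> \<beta> \<omega> Um v = b v"
    and "\<forall>i\<in>{0..n}. R i = subspace_residual \<Omega> a \<alpha> \<beta> \<omega> b (V i) Um"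
    and "I1 = (\<Sum>i\<in>{0..n}. 1 / \<Lambda> i (m i + 1) * (l2_norm \<Omega> (R i))\<^sup>2)"
    and "I2 = (\<Sum>i\<in>{0..n}. 1 / (\<Lambda> i (m i + 1))\<^sup>2 * (l2_norm \<Omega> (R i))\<^sup>2)"
    and "S = (SUP j\<in>{1..N}. sqrt ((\<omega> ^ 4 + \<omega>\<^sup>2 * (c j)\<^sup>2) * lam j) /
                             sqrt ((lam j - \<omega>\<^sup>2)\<^sup>2 + \<omega>\<^sup>2 * (c j)\<^sup>2))"
  shows "energy_norm a (U - Um) \<le> sqrt I1 + S * sqrt (2 * I2) \<and>
    (\<forall>\<phi> r. (\<forall>i\<in>{0..n}. real_basis (V i) (k i) (\<phi> i) \<and>
                       R i = (\<Sum>j\<in>{1..k i}. cscale (r i j) (\<phi> i j))) \<longrightarrow>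
       complex_of_real I1 = (\<Sum>i\<in>{0..n}. of_real (1 / \<Lambda> i (m i + 1)) *
          hermitian_product (k i) (mass_matrix \<Omega> (\<phi> i)) (r i)) \<and>
       complex_of_real I2 = (\<Sum>i\<in>{0..n}. of_real (1 / (\<Lambda> i (m i + 1))\<^sup>2) *
          hermitian_product (k i) (mass_matrix \<Omega> (\<phi> i)) (r i)))"
proof -
  note VH = assms(6) and a_def = assms(9) and V_def = assms(18)
  have \<Omega>: "open \<Omega>" "bounded \<Omega>" using assms(2) by (auto simp: bounded_domain_def)
  note sp = assms(17)
  have VH_H1: "v \<in> H1_fields \<Omega>" if "v \<in> Vh" for v
    using that unfolding VH by (rule subsetD[OF fe_space_subset_H1])
  have mass_pf: "positive_form cscale Vh (l2_inner \<Omega>)"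
    unfolding VH by (rule positive_form_l2_inner[OF \<Omega>])
  have "positive_form cscale Vh a"
    using assms(11) unfolding VH a_def by (intro positive_form_elasticity_form \<Omega> assms(7,8))
  with mass_pf interpret FP: form_pair cscale Vh "l2_inner \<Omega>" a
    by (rule form_pair.intro)
  define Eb where "Eb i = Z i ` {1..k i}" for i
  have V_local: "V i = local_space \<Omega> Vh (\<Omega>s i)" if "i \<in> {1..n}" for i
    using that by (simp add: V_def component_space_def)
  have V_Vh: "V i \<subseteq> Vh" for i
    by (auto simp: V_def component_space_def local_space_def interface_space_def energy_extension_def)
  have Z_eig: "Z i j \<in> eigenspace \<Omega> a (V i) (\<Lambda> i j)"
    and Z_on: "l \<in> {1..k i} \<Longrightarrow> l2_inner \<Omega> (Z i j) (Z i l) = (if j = l then 1 else 0)"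
    if "i \<in> {0..n}" "j \<in> {1..k i}" for i j l
    using assms(20) assms(19) that unfolding ordered_eigenbasis_def Let_def by auto
  have \<Lambda>_mono: "mono_on {1..k i} (\<Lambda> i)" and span_Eb: "cfield.span (Eb i) = V i"
    if "i \<in> {0..n}" for i
    using assms(20) assms(19) that unfolding ordered_eigenbasis_def Let_def Eb_def by auto
  have Z_V: "Z i j \<in> V i" if "i \<in> {0..n}" "j \<in> {1..k i}" for i j
    using Z_eig[OF that] by (simp add: eigenspace_def)
  have Z_energy: "Re (a (Z i j) (Z i j)) = \<Lambda> i j" if "i \<in> {0..n}" "j \<in> {1..k i}" for i j
    using Z_eig[OF that] Z_on[OF that that(2)] Z_V[OF that] by (simp add: eigenspace_def)
  have eig: "FP.eigenbasis (Eb i)" if i: "i \<in> {0..n}" for i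
    unfolding FP.eigenbasis_def FP.mass.orthonormal_def span_Eb[OF i]
  proof (intro conjI ballI)
    show "finite (Eb i)" by (simp add: Eb_def)
    show "Eb i \<subseteq> Vh" using Z_V[OF i] V_Vh[of i] by (auto simp: Eb_def)
    show "l2_inner \<Omega> u v = (if u = v then 1 else 0)" if uv: "u \<in> Eb i" "v \<in> Eb i" for u v
    proof -
      obtain j l where jl: "j \<in> {1..k i}" "u = Z i j" "l \<in> {1..k i}" "v = Z i l"
        using uv by (auto simp: Eb_def)
      \<comment> \<open>Eigenbases are sets here, whereas the given eigenvectors form a family;
        orthonormality shows that no vector is repeated.\<close>
      have "j = l" if "Z i j = Z i l"
        using Z_on[OF i jl(1,1)] Z_on[OF i jl(1,3)] that by (auto split: if_splits)
      then show ?thesis using Z_on[OF i jl(1,3)] jl by auto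
    qed
    show "a e v = of_real (Re (a e e)) * l2_inner \<Omega> e v" if e: "e \<in> Eb i" and v: "v \<in> V i" for e v
    proof -
      obtain j where j: "j \<in> {1..k i}" "e = Z i j" using e by (auto simp: Eb_def)
      then show ?thesis using Z_eig[OF i j(1)] Z_energy[OF i j(1)] v by (simp add: eigenspace_def)
    qed
  qed
  \<comment> \<open>The index \<open>l\<close> differs from at least one of \<open>i\<close> and
    \<open>j\<close>, and the field belonging to that index vanishes on the l-th subdomain.\<close>
  have vanish: "(\<forall>x\<in>\<Omega>s l. u x = 0) \<or> (\<forall>x\<in>\<Omega>s l. v x = 0)"
    if "i \<in> {1..n}" "j \<in> {1..n}" "i \<noteq> j" "u \<in> local_space \<Omega> Vh (\<Omega>s i)"
      "v \<in> local_space \<Omega> Vh (\<Omega>s j)" "l \<in> {1..n}" for i j l u v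
    using local_space_vanishes[OF sp \<Omega>(1) that(4) that(1) that(6)]
      local_space_vanishes[OF sp \<Omega>(1) that(5) that(2) that(6)] that(3) by blast
  have local_energy_orth: "a u v = 0"
    if ij: "i \<in> {1..n}" "j \<in> {1..n}" "i \<noteq> j" and u: "u \<in> local_space \<Omega> Vh (\<Omega>s i)"
      and v: "v \<in> local_space \<Omega> Vh (\<Omega>s j)" for i j u v
    unfolding a_def
  proof (rule elasticity_form_disjoint[OF \<Omega> assms(7), where I = "{1..n}" and \<Omega>s = \<Omega>s])
    show "u \<in> H1_fields \<Omega>" "v \<in> H1_fields \<Omega>"
      using u v VH_H1 by (auto simp: local_space_def)
    show "AE x in lebesgue_on \<Omega>. \<exists>l\<in>{1..n}. x \<in> \<Omega>s l"
      by (rule subdomains_cover_AE[OF \<Omega>(1) assms(5) sp])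
    show "(\<forall>x\<in>\<Omega>s l. u x = 0) \<or> (\<forall>x\<in>\<Omega>s l. v x = 0)" if "l \<in> {1..n}" for l
      by (rule vanish[OF ij u v that])
  qed (use subdomain_open[OF \<Omega>(1) sp] in auto)
  have interface_orth: "a u v = 0"
    if "u \<in> V 0" "j \<in> {1..n}" "v \<in> V j" for u v j
    using that V_local[of j]
    by (auto simp: V_def component_space_def interface_space_def energy_extension_def)
  have energy_orth: "a u v = 0"
    if ij: "i \<in> {0..n}" "j \<in> {0..n}" "i \<noteq> j" and u: "u \<in> V i" and v: "v \<in> V j" for i j u v
  proof -
    have uv: "u \<in> Vh" "v \<in> Vh" using u v V_Vh by blast+
    consider "i = 0" "j \<in> {1..n}" | "j = 0" "i \<in> {1..n}" | "i \<in> {1..n}" "j \<in> {1..n}"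
      using ij by fastforce
    then show ?thesis
    proof cases
      case 1
      then show ?thesis using interface_orth u v by blast
    next
      case 2
      then have "a v u = 0" using interface_orth u v by blast
      then show ?thesis using FP.energy.hermitian[OF uv(2,1)] by simp
    next
      case 3
      then show ?thesis using local_energy_orth ij(3) u v V_local by blast
    qed
  qed
  have mass_orth: "l2_inner \<Omega> u v = 0"
    if ij: "i \<in> {1..n}" "j \<in> {1..n}" "i \<noteq> j" and u: "u \<in> V i" and v: "v \<in> V j" for i j u v
  proof (rule l2_inner_disjoint)
    fix x assume "x \<in> \<Omega>"
    moreover have "\<Omega>s i \<inter> \<Omega>s j = {}"
      using sp ij by (auto simp: subdomain_partition_def disjoint_family_on_def)
    ultimately show "u x = 0 \<or> v x = 0"
      using u v unfolding V_local[OF ij(1)] V_local[OF ij(2)] local_space_def by blast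
  qed
  have decomp: "\<exists>w. (\<forall>i\<in>{0..n}. w i \<in> V i) \<and> v = (\<Sum>i\<in>{0..n}. w i)" if v: "v \<in> Vh" for v
    unfolding V_def
    by (rule component_decomposition[OF \<Omega>(1) sp FP.form_pair_axioms, of Eb])
      (use eig span_Eb V_local local_energy_orth v in auto)
  \<comment> \<open>The eigenvectors of all components form a finite spanning set, by the
    decomposition. This is where finite dimension of the finite element space comes from.\<close>
  define B where "B = (\<Union>i\<in>{0..n}. Eb i)"
  have finB: "finite B" by (simp add: B_def Eb_def)
  have B_Vh: "B \<subseteq> Vh" using eig
    unfolding B_def FP.eigenbasis_def FP.mass.orthonormal_def by blast
  have spanB: "cfield.span B = Vh"
  proof
    show "cfield.span B \<subseteq> Vh" by (rule FP.mass.span_subset_X[OF B_Vh])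
    show "Vh \<subseteq> cfield.span B"
    proof
      fix v assume "v \<in> Vh"
      then obtain w where w: "\<forall>i\<in>{0..n}. w i \<in> V i" "v = (\<Sum>i\<in>{0..n}. w i)"
        using decomp by blast
      have "w i \<in> cfield.span B" if i: "i \<in> {0..n}" for i
      proof -
        have "Eb i \<subseteq> B" using i by (auto simp: B_def)
        then show ?thesis using w(1) i span_Eb[OF i] cfield.span_mono by blast
      qed
      then show "v \<in> cfield.span B" unfolding w(2) by (rule cfield.span_sum)
    qed
  qed
  obtain E0 where E0: "FP.eigenbasis E0" "cfield.span E0 = Vh"
    using FP.eigenbasis_exists[OF finB B_Vh] unfolding spanB by metis
  \<comment> \<open>The eigenvalue of each vector of \<open>E0\<close> occurs in the list
    \<open>lam\<close>, so its quotient is one of those under the supremum; the supremum bounds it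
    since the index set is finite.\<close>
  have bound: "(Re (a z z) - \<omega>\<^sup>2)\<^sup>2 + \<omega>\<^sup>2 * (\<alpha> * Re (a z z) + \<beta>)\<^sup>2 \<noteq> 0 \<and>
      sqrt ((\<omega> ^ 4 + \<omega>\<^sup>2 * (\<alpha> * Re (a z z) + \<beta>)\<^sup>2) * Re (a z z)) /
        sqrt ((Re (a z z) - \<omega>\<^sup>2)\<^sup>2 + \<omega>\<^sup>2 * (\<alpha> * Re (a z z) + \<beta>)\<^sup>2) \<le> S" if z: "z \<in> E0" for z
  proof -
    have zV: "z \<in> Vh" and zz: "l2_inner \<Omega> z z = 1"
      using E0(1) z by (auto simp: FP.eigenbasis_def FP.mass.orthonormal_def)
    have "z \<noteq> 0" using zz FP.mass.zero_left[OF zV] by auto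
    moreover have "z \<in> eigenspace \<Omega> a Vh (Re (a z z))"
      using E0(1)[unfolded FP.eigenbasis_def E0(2)] z zV unfolding eigenspace_def by blast
    ultimately obtain j where j: "j \<in> {1..N}" "lam j = Re (a z z)"
      using eigenvalue_list_complete[OF assms(16) finB] spanB by (metis order_refl)
    have cj: "c j = \<alpha> * Re (a z z) + \<beta>" using assms(22) j by auto
    have "sqrt ((\<omega> ^ 4 + \<omega>\<^sup>2 * (c j)\<^sup>2) * lam j) / sqrt ((lam j - \<omega>\<^sup>2)\<^sup>2 + \<omega>\<^sup>2 * (c j)\<^sup>2) \<le> S"
      unfolding assms(31) using j(1) by (intro cSUP_upper) auto
    moreover have "(lam j - \<omega>\<^sup>2)\<^sup>2 + \<omega>\<^sup>2 * (c j)\<^sup>2 \<noteq> 0" using assms(23) j(1) by blast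
    ultimately show ?thesis unfolding j(2) cj by blast
  qed
  \<comment> \<open>Strict truncation makes \<open>m i + 1\<close> a genuine index, so the
    denominators in I1 and I2 are eigenvalues and hence positive.\<close>
  have k_pos: "m i + 1 \<in> {1..k i}" if "i \<in> {0..n}" for i
    using bspec[OF assms(21) that] by simp
  have L_pos: "\<Lambda> i (m i + 1) > 0" if i: "i \<in> {0..n}" for i
    using FP.eigenbasis_positive[OF eig[OF i], of "Z i (m i + 1)"] k_pos[OF i] Z_energy[OF i k_pos[OF i]]
    by (simp add: Eb_def)
  \<comment> \<open>Nonnegativity of \<open>S\<close> needs one actual quotient below it. A
    discarded interface mode is a unit vector, so the space is nonzero and a global mode
    exists.\<close>
  have "E0 \<noteq> {}"
  proof
    assume "E0 = {}"
    then have "Vh = {0}" using E0(2) by simp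
    then have "Z 0 (m 0 + 1) = 0" using Z_V[OF _ k_pos, of 0] V_Vh[of 0] by auto
    moreover have "l2_inner \<Omega> (Z 0 (m 0 + 1)) (Z 0 (m 0 + 1)) = 1"
      using Z_on[OF _ k_pos k_pos, of 0] by simp
    ultimately show False using FP.mass.zero_left[OF FP.mass.X_intros(1)] by simp
  qed
  then obtain z where z: "z \<in> E0" by auto
  have "0 \<le> sqrt ((\<omega> ^ 4 + \<omega>\<^sup>2 * (\<alpha> * Re (a z z) + \<beta>)\<^sup>2) * Re (a z z)) /
        sqrt ((Re (a z z) - \<omega>\<^sup>2)\<^sup>2 + \<omega>\<^sup>2 * (\<alpha> * Re (a z z) + \<beta>)\<^sup>2)"
    using FP.eigenbasis_positive[OF E0(1) z] by simp
  then have S: "S \<ge> 0" using bound[OF z] by linarith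
  have reduced_Vh: "v \<in> Vh" if "v \<in> reduced_space n Z m" for v
  proof -
    obtain w where w: "v = (\<Sum>i\<in>{0..n}. w i)" "\<forall>i\<in>{0..n}. w i \<in> cfield.span (Z i ` {1..m i})"
      using \<open>v \<in> reduced_space n Z m\<close> unfolding reduced_space_def by blast
    have "w i \<in> Vh" if i: "i \<in> {0..n}" for i
    proof -
      have "Z i ` {1..m i} \<subseteq> Eb i" using k_pos[OF i] by (auto simp: Eb_def)
      then show ?thesis using w(2) i span_Eb[OF i] V_Vh cfield.span_mono by blast
    qed
    then show ?thesis unfolding w(1) by (rule FP.mass.X_intros)
  qed
  define e where "e = U - Um"
  have UV: "U \<in> Vh" and UmV: "Um \<in> Vh" using assms(24,26) reduced_Vh by auto
  then have eV: "e \<in> Vh" unfolding e_def by (intro FP.mass.X_intros)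
  \<comment> \<open>Replacing the load by the dynamic form of \<open>U\<close> expresses the
    residual of \<open>Um\<close> as the dynamic form of the error.\<close>
  have dyn: "b v - dynamic_form \<Omega> a \<alpha> \<beta> \<omega> Um v =
      a e v + \<i> * of_real \<omega> * (of_real \<alpha> * a e v + of_real \<beta> * l2_inner \<Omega> e v) -
        (of_real \<omega>)\<^sup>2 * l2_inner \<Omega> e v" if v: "v \<in> Vh" for v
  proof -
    have "b v = dynamic_form \<Omega> a \<alpha> \<beta> \<omega> U v" using assms(25) v by simp
    then show ?thesis
      unfolding e_def dynamic_form_def damping_form_def
      by (simp add: FP.mass.diff_left[OF UV UmV v] FP.energy.diff_left[OF UV UmV v] algebra_simps)
  qed
  have R: "R i \<in> V i \<and> (\<forall>v\<in>V i. l2_inner \<Omega> (R i) v = b v - dynamic_form \<Omega> a \<alpha> \<beta> \<omega> Um v)"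
    if i: "i \<in> {0..n}" for i
  proof -
    \<comment> \<open>The dynamic form of the error regrouped: \<open>x\<close> collects the factors
      of the energy form, \<open>y\<close> those of the mass form.\<close>
    define x y where "x = cscale (1 + \<i> * of_real \<omega> * of_real \<alpha>) e"
      and "y = cscale (\<i> * of_real \<omega> * of_real \<beta> - (of_real \<omega>)\<^sup>2) e"
    have xy: "x \<in> Vh" "y \<in> Vh" unfolding x_def y_def by (intro FP.mass.X_intros eV)+
    have Eo: "FP.mass.orthonormal (Eb i)" using eig[OF i] by (simp add: FP.eigenbasis_def)
    then have EbV: "Eb i \<subseteq> Vh" by (simp add: FP.mass.orthonormal_def)
    obtain r where r: "r \<in> V i" and r_eq: "\<And>v. v \<in> V i \<Longrightarrow> l2_inner \<Omega> r v = a x v + l2_inner \<Omega> y v"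
      using FP.riesz_representation[OF Eo xy] unfolding span_Eb[OF i] by metis
    have r_dyn: "l2_inner \<Omega> r v = b v - dynamic_form \<Omega> a \<alpha> \<beta> \<omega> Um v" if v: "v \<in> V i" for v
    proof -
      have vV: "v \<in> Vh" using v V_Vh by blast
      show ?thesis
        unfolding r_eq[OF v] dyn[OF vV] x_def y_def
          FP.energy.scale_left[OF eV vV] FP.mass.scale_left[OF eV vV]
        by (simp add: algebra_simps)
    qed
    have "subspace_residual \<Omega> a \<alpha> \<beta> \<omega> b (V i) Um = r"
    proof (rule subspace_residual_eqI[OF r])
      show "l2_inner \<Omega> r v = b v - a Um v - \<i> * of_real \<omega> * damping_form \<Omega> a \<alpha> \<beta> Um v +
          (of_real \<omega>)\<^sup>2 * l2_inner \<Omega> Um v" if "v \<in> V i" for v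
        using r_dyn[OF that] by (simp add: dynamic_form_def)
      show "r' = r" if "r' \<in> V i" "\<And>v. v \<in> V i \<Longrightarrow> l2_inner \<Omega> r' v = l2_inner \<Omega> r v" for r'
        by (rule FP.riesz_unique[OF EbV]) (use that r in \<open>simp_all add: span_Eb[OF i]\<close>)
    qed
    then show ?thesis using assms(28) i r r_dyn by simp
  qed
  have gap: "\<Lambda> i (m i + 1) \<le> Re (a z z)"
    if i: "i \<in> {0..n}" and z: "z \<in> Eb i" and nz: "l2_inner \<Omega> (R i) z \<noteq> 0" for i z
  proof -
    obtain j where j: "j \<in> {1..k i}" "z = Z i j" using z by (auto simp: Eb_def)
    \<comment> \<open>A retained mode is an admissible test field of the reduced problem, so the
      residual cannot have a component along it. The first mode left is \<open>m i + 1\<close>, and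
      monotonicity makes its eigenvalue the least.\<close>
    have "\<not> j \<le> m i"
    proof
      assume "j \<le> m i"
      then have "Z i j \<in> reduced_space n Z m"
        using j i by (intro local_vectors_in_reduced_space) auto
      then have "b z - dynamic_form \<Omega> a \<alpha> \<beta> \<omega> Um z = 0" using assms(27) j by simp
      then show False using nz R[OF i] Z_V[OF i j(1)] j by simp
    qed
    then have "\<Lambda> i (m i + 1) \<le> \<Lambda> i j"
      using \<Lambda>_mono[OF i] k_pos[OF i] j(1) by (auto simp: mono_on_def)
    then show ?thesis using Z_energy[OF i j(1)] j by simp
  qed
  have RV: "R i \<in> Vh" if "i \<in> {0..n}" for i using R[OF that] V_Vh by blast
  have norm_R: "(l2_norm \<Omega> (R i))\<^sup>2 = Re (l2_inner \<Omega> (R i) (R i))" if "i \<in> {0..n}" for i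
    using FP.mass.self_nonneg[OF RV[OF that]] by (simp add: l2_norm_def)
  have "sqrt (Re (a e e)) \<le> sqrt (\<Sum>i\<in>{0..n}. 1 / \<Lambda> i (m i + 1) * Re (l2_inner \<Omega> (R i) (R i))) +
      S * sqrt (2 * (\<Sum>i\<in>{0..n}. 1 / (\<Lambda> i (m i + 1))\<^sup>2 * Re (l2_inner \<Omega> (R i) (R i))))"
  proof (rule FP.component_mode_error_bound[where Eb = Eb and E = E0 and \<omega> = \<omega> and \<alpha> = \<alpha> and \<beta> = \<beta>])
    show "R i \<in> cfield.span (Eb i)" if "i \<in> {0..n}" for i
      using R[OF that] span_Eb[OF that] by simp
    show "l2_inner \<Omega> (R i) v = a e v + \<i> * of_real \<omega> * (of_real \<alpha> * a e v + of_real \<beta> * l2_inner \<Omega> e v) -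
        (of_real \<omega>)\<^sup>2 * l2_inner \<Omega> e v" if "i \<in> {0..n}" "v \<in> cfield.span (Eb i)" for i v
      using R[OF that(1)] that dyn[of v] V_Vh[of i] span_Eb[OF that(1)] by auto
    show "\<exists>w. (\<forall>i\<in>{0..n}. w i \<in> cfield.span (Eb i)) \<and> v = (\<Sum>i\<in>{0..n}. w i)" if "v \<in> Vh" for v
      using decomp[OF that] span_Eb by auto
    show "a u v = 0" if "i \<in> {0..n}" "j \<in> {0..n}" "i \<noteq> j" "u \<in> cfield.span (Eb i)"
        "v \<in> cfield.span (Eb j)" for i j u v
      using energy_orth[OF that(1-3)] that span_Eb by auto
    show "l2_inner \<Omega> u v = 0" if "i \<in> {1..n}" "j \<in> {1..n}" "i \<noteq> j" "u \<in> cfield.span (Eb i)"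
        "v \<in> cfield.span (Eb j)" for i j u v
      using mass_orth[OF that(1-3)] that span_Eb by auto
  qed (use eig E0 eV L_pos gap bound S in auto)
  also have "(\<Sum>i\<in>{0..n}. 1 / \<Lambda> i (m i + 1) * Re (l2_inner \<Omega> (R i) (R i))) = I1"
    unfolding assms(29) by (intro sum.cong refl) (simp add: norm_R)
  also have "(\<Sum>i\<in>{0..n}. 1 / (\<Lambda> i (m i + 1))\<^sup>2 * Re (l2_inner \<Omega> (R i) (R i))) = I2"
    unfolding assms(30) by (intro sum.cong refl) (simp add: norm_R)
  finally have "energy_norm a (U - Um) \<le> sqrt I1 + S * sqrt (2 * I2)"
    unfolding energy_norm_def e_def .
  moreover have "hermitian_product (k i) (mass_matrix \<Omega> (\<phi> i)) (r i) = of_real ((l2_norm \<Omega> (R i))\<^sup>2)"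
    if basis: "\<forall>i\<in>{0..n}. real_basis (V i) (k i) (\<phi> i) \<and>
        R i = (\<Sum>j\<in>{1..k i}. cscale (r i j) (\<phi> i j))" and i: "i \<in> {0..n}" for \<phi> r i
  proof -
    have \<phi>: "\<phi> i j \<in> Vh" "real_valued (\<phi> i j)" if "j \<in> {1..k i}" for j
      using basis i that V_Vh[of i] cfield.span_base[of "\<phi> i j" "\<phi> i ` {1..k i}"]
      by (auto simp: real_basis_def)
    have "hermitian_product (k i) (mass_matrix \<Omega> (\<phi> i)) (r i) = l2_inner \<Omega> (R i) (R i)"
      using mass_matrix_hermitian_product[OF mass_pf \<phi>] basis i by simp
    then show ?thesis using FP.mass.self_real[OF RV[OF i]] norm_R[OF i] by simp
  qed
  ultimately show ?thesis
    unfolding assms(29,30) by (auto simp: of_real_sum intro!: sum.cong)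
qed

end
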